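(* Let $X$ be an irreducible SFT, $p$ a prime and $m\ge1$ an integer. There exists a subspace $W\subseteq H^1(G_X,\mathbb{F}_p)$, invariant under the representation $\Upsilon_p:\mathrm{Aut}(X)\to\mathrm{GL}(H^1(G_X,\mathbb{F}_p))$, such that, denoting by $\overline{\Upsilon_p}(\cdot)_m:\mathrm{Aut}(X)\to\mathrm{GL}(H^1(G_X,\mathbb{F}_p)/W)$ the quotient representation of $\Upsilon_p$ with respect to $W$, for any $f\in\mathrm{Aut}(X)$ the following hold: (1) the matrix of $\overline{\Upsilon_p}(f)_m:H^1(G_X,\mathbb{F}_p)/W\to H^1(G_X,\mathbb{F}_p)/W$ with respect to a certain basis of $H^1(G_X,\mathbb{F}_p)/W$ is exactly the permutation matrix of the permutation of $\mathcal{P}_m(X)$ induced by $f$; (2) $\det(\overline{\Upsilon_p}(f)_m)\equiv\mathrm{OS}_m(f)\pmod p$; (3) the characteristic polynomial, determinant and trace of $\overline{\Upsilon_p}(\cdot)_m$ are conjugacy invariants of automorphisms, i.e. they take the same value at $f$ and at $hfh^{-1}$ for every $h\in\mathrm{Aut}(X)$.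
   Context: A shift space over a finite alphabet $\mathcal{A}$ is a nonempty closed shift-invariant subset $X\subseteq\mathcal{A}^{\mathbb{Z}}$ (product topology), with shift map $\sigma_X$. It is a shift of finite type (SFT) if it is defined by a finite set of forbidden words, and irreducible if for all words $u,v$ occurring in points of $X$ there is a nonempty word $w$ with $uwv$ occurring in a point of $X$. A sliding block code is a continuous shift-commuting map; a factor map is a surjective one; a topological conjugacy is a bijective one; $\mathrm{Aut}(X)$ is the group of topological conjugacies $X\to X$. For irreducible SFTs $X,Y$, a factor map $\varpi:Y\to X$ is unramified if there is an integer $d\ge1$ with $|\varpi^{-1}(x)|=d$ for all $x\in X$; $\deg(\varpi)=d$. Put $\mathrm{Aut}(Y/X,\varpi)=\{\varphi\in\mathrm{Aut}(Y)\mid\varpi\circ\varphi=\varpi\}$. The map $\varpi$ is a Galois factor if it is unramified and $|\mathrm{Aut}(Y/X,\varpi)|=\deg(\varpi)$; then $\mathrm{Gal}(Y/X,\varpi):=\mathrm{Aut}(Y/X,\varpi)$. Absolute Galois group. Let $X$ be an irreducible SFT and $x_0\in X$. A pointed Galois factor over $(X,x_0)$ is a triple $(Y,y_0,\varpi)$ with $Y$ an irreducible SFT, $y_0\in Y$ and $\varpi:Y\to X$ a Galois factor with $\varpi(y_0)=x_0$. Two of them, $(Y,y_0,\varpi)$ and $(Y',y_0',\varpi')$, are equivalent if there is a topological conjugacy $\gamma:Y\to Y'$ with $\gamma(y_0)=y_0'$ and $\varpi=\varpi'\circ\gamma$; $\mathcal{I}(X,x_0)$ is the set of equivalence classes. Fix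 a representative $(Y_i,y_{i,0},\varpi_i)$ of each $i\in\mathcal{I}(X,x_0)$ and set $G_i=\mathrm{Gal}(Y_i/X,\varpi_i)$. Write $i\le j$ if there is an unramified factor map $\alpha_{ij}:Y_j\to Y_i$ with $\alpha_{ij}(y_{j,0})=y_{i,0}$ and $\varpi_j=\varpi_i\circ\alpha_{ij}$; such a map is unique, and $\le$ is a directed partial order. For $i\le j$ and $\varphi\in G_j$, $p_{ij}(\varphi)$ is the unique element of $G_i$ with $p_{ij}(\varphi)\circ\alpha_{ij}=\alpha_{ij}\circ\varphi$. The absolute Galois group is the profinite group $G_{X,x_0}=\varprojlim_{i}G_i$ with respect to the maps $p_{ij}$ (each $G_i$ discrete). Up to isomorphism it does not depend on the representatives or on $x_0$, and is denoted $G_X$. For $g=(g_i)_i\in G_{X,x_0}$ and any pointed Galois factor $(Y,y,\varpi)$ over $(X,x_0)$, of class $i$, with $\theta:Y_i\to Y$ the unique topological conjugacy satisfying $\theta(y_{i,0})=y$ and $\varpi_i=\varpi\circ\theta$, write $g_{(Y,y,\varpi)}=\theta\circ g_i\circ\theta^{-1}\in\mathrm{Gal}(Y/X,\varpi)$. The representation $\Upsilon_p$. Fix $x_0\in X$. For $x\in X$ let $F(x)=\varprojlim_{i\in\mathcal{I}(X,x_0)}\varpi_i^{-1}(x)$ with transition maps the restrictions of $\alpha_{ij}$ (nonempty). For $f\in\mathrm{Aut}(X)$ and $\xi=(\xi_i)_i\in F(f(x_0))$, the automorphism $\beta_{f,\xi}$ of $G_{X,x_0}$ is defined by $\beta_{f,\xi}(g)_i=g_{(Y_i,\xi_i,f^{-1}\circ\varpi_i)}$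 (note $\mathrm{Gal}(Y_i/X,f^{-1}\circ\varpi_i)=\mathrm{Gal}(Y_i/X,\varpi_i)$). Up to inner automorphisms it does not depend on $\xi$. For a prime $p$, with $\mathbb{F}_p$ discrete and with trivial action, $H^1(G_X,\mathbb{F}_p)=\mathrm{Hom}_{\mathrm{cont}}(G_{X,x_0},\mathbb{F}_p)$, an $\mathbb{F}_p$-vector space, and $\Upsilon_p(f)(\chi)=\chi\circ\beta_{f,\xi}^{-1}$ (independent of $\xi$). $\mathcal{P}_m(X)$ is the (finite) set of periodic orbits of $\sigma_X$ of length (least period) $m$. Each $f\in\mathrm{Aut}(X)$ permutes $\mathcal{P}_m(X)$; $\mathrm{OS}_m(f)\in\{-1,1\}$ is the sign of this permutation. *)

theory Defs
  imports
    "HOL-Analysis.Function_Topology"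
    "HOL-Algebra.Bij"
    "HOL-Algebra.Product_Groups"
    "HOL-Algebra.AbelCoset"
    "HOL-Combinatorics.Orbits"
    "Jordan_Normal_Form.VS_Connect"
    "Jordan_Normal_Form.Char_Poly"
    "Berlekamp_Zassenhaus.Finite_Field"
begin

section \<open>Shift spaces and sliding block codes\<close>

type_synonym 'a point = "int \<Rightarrow> 'a"

definition shift :: "'a point \<Rightarrow> 'a point" where
  "shift x = (\<lambda>i. x (i + 1))"

text \<open>The letters range over a whole type with the discrete topology.  For every
  \<open>A :: 'a set\<close> the subspace topology on the sequences with letters in \<open>A\<close> is the product
  topology on \<open>A\<close>-valued sequences, and these form a closed subset; so closedness and continuity
  can be tested here independently of the alphabet.\<close>

definition seq_top :: "'a point topology" where
  "seq_top = product_topology (\<lambda>_. discrete_topology UNIV) UNIV"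

definition shift_space :: "'a set \<Rightarrow> 'a point set \<Rightarrow> bool" where
  "shift_space A X \<longleftrightarrow>
     finite A \<and> X \<noteq> {} \<and> X \<subseteq> {x. range x \<subseteq> A} \<and> closedin seq_top X \<and> shift ` X = X"

definition occurs_in :: "'a list \<Rightarrow> 'a point \<Rightarrow> bool" where
  "occurs_in w x \<longleftrightarrow> (\<exists>i. \<forall>k<length w. x (i + int k) = w ! k)"

definition language :: "'a point set \<Rightarrow> 'a list set" where
  "language X = {w. \<exists>x\<in>X. occurs_in w x}"

definition sft :: "'a point set \<Rightarrow> bool" where
  "sft X \<longleftrightarrow> (\<exists>A F. shift_space A X \<and> finite F \<and> F \<subseteq> lists A \<and>
     X = {x. range x \<subseteq> A \<and> (\<forall>w\<in>F. \<not> occurs_in w x)})"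

definition irreducible_sft :: "'a point set \<Rightarrow> bool" where
  "irreducible_sft X \<longleftrightarrow> sft X \<and>
     (\<forall>u\<in>language X. \<forall>v\<in>language X. \<exists>w. w \<noteq> [] \<and> u @ w @ v \<in> language X)"

text \<open>Maps are kept extensional (as in \<^const>\<open>Bij\<close>), so that equality of maps is equality
  on their domain.\<close>

definition sliding_block_code :: "'a point set \<Rightarrow> 'b point set \<Rightarrow> ('a point \<Rightarrow> 'b point) \<Rightarrow> bool" where
  "sliding_block_code X Y f \<longleftrightarrow> f \<in> extensional X \<and>
     continuous_map (subtopology seq_top X) (subtopology seq_top Y) f \<and>
     (\<forall>x\<in>X. f (shift x) = shift (f x))"

definition factor_map :: "'a point set \<Rightarrow> 'b point set \<Rightarrow> ('a point \<Rightarrow> 'b point) \<Rightarrow> bool" where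
  "factor_map Y X \<pi> \<longleftrightarrow> sliding_block_code Y X \<pi> \<and> \<pi> ` Y = X"

definition topological_conjugacy ::
    "'a point set \<Rightarrow> 'b point set \<Rightarrow> ('a point \<Rightarrow> 'b point) \<Rightarrow> bool" where
  "topological_conjugacy X Y f \<longleftrightarrow> sliding_block_code X Y f \<and> bij_betw f X Y"

definition shift_aut :: "'a point set \<Rightarrow> ('a point \<Rightarrow> 'a point) monoid" where
  "shift_aut X = (BijGroup X)\<lparr>carrier := {f. topological_conjugacy X X f}\<rparr>"


section \<open>Galois factors\<close>

definition fibre :: "'a point set \<Rightarrow> ('a point \<Rightarrow> 'b point) \<Rightarrow> 'b point \<Rightarrow> 'a point set" where
  "fibre Y \<pi> x = {y\<in>Y. \<pi> y = x}"

definition unramified :: "'a point set \<Rightarrow> 'b point set \<Rightarrow> ('a point \<Rightarrow> 'b point) \<Rightarrow> bool" where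
  "unramified Y X \<pi> \<longleftrightarrow> irreducible_sft Y \<and> irreducible_sft X \<and> factor_map Y X \<pi> \<and>
     (\<exists>d\<ge>1. \<forall>x\<in>X. card (fibre Y \<pi> x) = d)"

definition factor_degree :: "'a point set \<Rightarrow> 'b point set \<Rightarrow> ('a point \<Rightarrow> 'b point) \<Rightarrow> nat" where
  "factor_degree Y X \<pi> = (THE d. \<forall>x\<in>X. card (fibre Y \<pi> x) = d)"

definition rel_aut :: "'a point set \<Rightarrow> ('a point \<Rightarrow> 'b point) \<Rightarrow> ('a point \<Rightarrow> 'a point) monoid" where
  "rel_aut Y \<pi> =
     (shift_aut Y)\<lparr>carrier := {\<phi> \<in> carrier (shift_aut Y). \<forall>y\<in>Y. \<pi> (\<phi> y) = \<pi> y}\<rparr>"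

definition galois_factor :: "'a point set \<Rightarrow> 'b point set \<Rightarrow> ('a point \<Rightarrow> 'b point) \<Rightarrow> bool" where
  "galois_factor Y X \<pi> \<longleftrightarrow>
     unramified Y X \<pi> \<and> card (carrier (rel_aut Y \<pi>)) = factor_degree Y X \<pi>"


section \<open>The absolute Galois group\<close>

text \<open>A pointed Galois factor is a triple (total space, base point, projection).  Its alphabet
  is a finite set of natural numbers; up to renaming of letters, hence up to equivalence, this
  covers all finite alphabets.\<close>

type_synonym 'a pgf = "nat point set \<times> nat point \<times> (nat point \<Rightarrow> 'a point)"

abbreviation total_space :: "'a pgf \<Rightarrow> nat point set" where "total_space P \<equiv> fst P"
abbreviation basept :: "'a pgf \<Rightarrow> nat point" where "basept P \<equiv> fst (snd P)"
abbreviation projection :: "'a pgf \<Rightarrow> nat point \<Rightarrow> 'a point" where "projection P \<equiv> snd (snd P)"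

definition pointed_galois_factors :: "'a point set \<Rightarrow> 'a point \<Rightarrow> 'a pgf set" where
  "pointed_galois_factors X x0 =
     {P. galois_factor (total_space P) X (projection P) \<and>
        basept P \<in> total_space P \<and> projection P (basept P) = x0}"

definition pointed_conjugacy :: "'a pgf \<Rightarrow> 'a pgf \<Rightarrow> (nat point \<Rightarrow> nat point) \<Rightarrow> bool" where
  "pointed_conjugacy P Q \<gamma> \<longleftrightarrow> topological_conjugacy (total_space P) (total_space Q) \<gamma> \<and>
     \<gamma> (basept P) = basept Q \<and> (\<forall>y\<in>total_space P. projection P y = projection Q (\<gamma> y))"

definition pgf_equiv :: "'a point set \<Rightarrow> 'a point \<Rightarrow> 'a pgf rel" where
  "pgf_equiv X x0 = {(P, Q). P \<in> pointed_galois_factors X x0 \<and>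
     Q \<in> pointed_galois_factors X x0 \<and> (\<exists>\<gamma>. pointed_conjugacy P Q \<gamma>)}"

definition galois_classes :: "'a point set \<Rightarrow> 'a point \<Rightarrow> 'a pgf set set" where
  "galois_classes X x0 = pointed_galois_factors X x0 // pgf_equiv X x0"

text \<open>In the following \<open>R\<close> is a choice of representatives of the equivalence classes.\<close>

type_synonym 'a reps = "'a pgf set \<Rightarrow> 'a pgf"

definition pointed_unramified :: "'a pgf \<Rightarrow> 'a pgf \<Rightarrow> (nat point \<Rightarrow> nat point) \<Rightarrow> bool" where
  "pointed_unramified Q P \<alpha> \<longleftrightarrow> unramified (total_space Q) (total_space P) \<alpha> \<and>
     \<alpha> (basept Q) = basept P \<and> (\<forall>y\<in>total_space Q. projection Q y = projection P (\<alpha> y))"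

definition class_le :: "'a reps \<Rightarrow> 'a pgf set \<Rightarrow> 'a pgf set \<Rightarrow> bool" where
  "class_le R i j \<longleftrightarrow> (\<exists>\<alpha>. pointed_unramified (R j) (R i) \<alpha>)"

definition connecting :: "'a reps \<Rightarrow> 'a pgf set \<Rightarrow> 'a pgf set \<Rightarrow> nat point \<Rightarrow> nat point" where
  "connecting R i j = (THE \<alpha>. pointed_unramified (R j) (R i) \<alpha>)"

definition gal :: "'a pgf \<Rightarrow> (nat point \<Rightarrow> nat point) monoid" where
  "gal P = rel_aut (total_space P) (projection P)"

definition gal_transition ::
    "'a reps \<Rightarrow> 'a pgf set \<Rightarrow> 'a pgf set \<Rightarrow> (nat point \<Rightarrow> nat point) \<Rightarrow> nat point \<Rightarrow> nat point" where
  "gal_transition R i j \<phi> = (THE \<psi>. \<psi> \<in> carrier (gal (R i)) \<and>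
     (\<forall>y\<in>total_space (R j). \<psi> (connecting R i j y) = connecting R i j (\<phi> y)))"

type_synonym 'a gal_elem = "'a pgf set \<Rightarrow> nat point \<Rightarrow> nat point"

definition abs_gal :: "'a point set \<Rightarrow> 'a point \<Rightarrow> 'a reps \<Rightarrow> 'a gal_elem monoid" where
  "abs_gal X x0 R = (product_group (galois_classes X x0) (\<lambda>i. gal (R i)))
     \<lparr>carrier := {g \<in> (\<Pi>\<^sub>E i\<in>galois_classes X x0. carrier (gal (R i))).
        \<forall>i\<in>galois_classes X x0. \<forall>j\<in>galois_classes X x0.
          class_le R i j \<longrightarrow> gal_transition R i j (g j) = g i}\<rparr>"

definition abs_gal_top :: "'a point set \<Rightarrow> 'a point \<Rightarrow> 'a reps \<Rightarrow> 'a gal_elem topology" where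
  "abs_gal_top X x0 R = subtopology
     (product_topology (\<lambda>i. discrete_topology (carrier (gal (R i)))) (galois_classes X x0))
     (carrier (abs_gal X x0 R))"

text \<open>The element \<open>g\<^sub>P\<close> of the Galois group of an arbitrary pointed Galois factor \<open>P\<close>, obtained
  by transport along the unique pointed conjugacy from the representative of its class.\<close>

definition gal_component ::
    "'a point set \<Rightarrow> 'a point \<Rightarrow> 'a reps \<Rightarrow> 'a gal_elem \<Rightarrow> 'a pgf \<Rightarrow> nat point \<Rightarrow> nat point" where
  "gal_component X x0 R g P =
     (let i = pgf_equiv X x0 `` {P};
          \<theta> = (THE \<theta>. pointed_conjugacy (R i) P \<theta>)
      in (\<lambda>y\<in>total_space P. \<theta> (g i (inv_into (total_space (R i)) \<theta> y))))"


section \<open>The representation on first cohomology\<close>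

definition profinite_fibre ::
    "'a point set \<Rightarrow> 'a point \<Rightarrow> 'a reps \<Rightarrow> 'a point \<Rightarrow> ('a pgf set \<Rightarrow> nat point) set" where
  "profinite_fibre X x0 R x =
     {\<xi> \<in> (\<Pi>\<^sub>E i\<in>galois_classes X x0. fibre (total_space (R i)) (projection (R i)) x).
        \<forall>i\<in>galois_classes X x0. \<forall>j\<in>galois_classes X x0.
          class_le R i j \<longrightarrow> connecting R i j (\<xi> j) = \<xi> i}"

definition beta :: "'a point set \<Rightarrow> 'a point \<Rightarrow> 'a reps \<Rightarrow> ('a point \<Rightarrow> 'a point) \<Rightarrow>
    ('a pgf set \<Rightarrow> nat point) \<Rightarrow> 'a gal_elem \<Rightarrow> 'a gal_elem" where
  "beta X x0 R f \<xi> = (\<lambda>g\<in>carrier (abs_gal X x0 R). \<lambda>i\<in>galois_classes X x0.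
     gal_component X x0 R g
       (total_space (R i), \<xi> i, \<lambda>y\<in>total_space (R i). inv_into X f (projection (R i) y)))"

text \<open>\<open>'p mod_ring\<close> with \<open>'p :: prime_card\<close> is the field with \<open>p = CARD('p)\<close> elements.\<close>

definition H1 :: "'a point set \<Rightarrow> 'a point \<Rightarrow> 'a reps \<Rightarrow>
    ('p::prime_card mod_ring, 'a gal_elem \<Rightarrow> 'p mod_ring) module" where
  "H1 X x0 R = (let G = abs_gal X x0 R in
     \<lparr>carrier = {\<chi> \<in> hom G (add_monoid class_ring). \<chi> \<in> extensional (carrier G) \<and>
         continuous_map (abs_gal_top X x0 R) (discrete_topology UNIV) \<chi>},
      monoid.mult = undefined, one = undefined,
      zero = (\<lambda>g\<in>carrier G. 0),
      add = (\<lambda>\<chi> \<psi>. \<lambda>g\<in>carrier G. \<chi> g + \<psi> g),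
      module.smult = (\<lambda>c \<chi>. \<lambda>g\<in>carrier G. c * \<chi> g)\<rparr>)"

text \<open>The value does not depend on the chosen point of the profinite fibre.\<close>

definition upsilon :: "'a point set \<Rightarrow> 'a point \<Rightarrow> 'a reps \<Rightarrow> ('a point \<Rightarrow> 'a point) \<Rightarrow>
    ('a gal_elem \<Rightarrow> 'p::prime_card mod_ring) \<Rightarrow> 'a gal_elem \<Rightarrow> 'p mod_ring" where
  "upsilon X x0 R f \<chi> =
     (let G = abs_gal X x0 R; \<xi> = (SOME \<xi>. \<xi> \<in> profinite_fibre X x0 R (f x0))
      in (\<lambda>g\<in>carrier G. \<chi> (inv_into (carrier G) (beta X x0 R f \<xi>) g)))"


section \<open>Quotient spaces and matrices of endomorphisms\<close>

text \<open>The fields \<open>mult\<close> and \<open>one\<close> of a module record are irrelevant.\<close>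

definition quotient_space :: "('k::field, 'v) module \<Rightarrow> 'v set \<Rightarrow> ('k, 'v set) module" where
  "quotient_space V W =
     \<lparr>carrier = a_rcosets\<^bsub>V\<^esub> W, monoid.mult = undefined, one = undefined,
      zero = W,
      add = set_add V,
      module.smult = (\<lambda>c C. \<Union>v\<in>C. W +>\<^bsub>V\<^esub> (c \<odot>\<^bsub>V\<^esub> v))\<rparr>"

definition quotient_endo :: "('k::field, 'v) module \<Rightarrow> 'v set \<Rightarrow> ('v \<Rightarrow> 'v) \<Rightarrow> 'v set \<Rightarrow> 'v set" where
  "quotient_endo V W T = (\<lambda>C\<in>carrier (quotient_space V W). \<Union>v\<in>C. W +>\<^bsub>V\<^esub> (T v))"

definition ordered_basis :: "('k::field, 'v) module \<Rightarrow> 'v list \<Rightarrow> bool" where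
  "ordered_basis V bs \<longleftrightarrow>
     vectorspace class_ring V \<and> distinct bs \<and> vectorspace.basis class_ring V (set bs)"

text \<open>The \<open>j\<close>-th column holds the coordinates of the image of the \<open>j\<close>-th basis vector.\<close>

definition matrix_wrt :: "('k::field, 'v) module \<Rightarrow> 'v list \<Rightarrow> ('v \<Rightarrow> 'v) \<Rightarrow> 'k mat" where
  "matrix_wrt V bs T = (THE A. A \<in> carrier_mat (length bs) (length bs) \<and>
     (\<forall>j<length bs. T (bs ! j) = (\<Oplus>\<^bsub>V\<^esub>i\<in>{..<length bs}. A $$ (i, j) \<odot>\<^bsub>V\<^esub> (bs ! i))))"

text \<open>Determinant, characteristic polynomial and trace of an endomorphism of a finite-dimensional
  space, computed in some basis; they do not depend on it.\<close>

definition endo_matrix :: "('k::field, 'v) module \<Rightarrow> ('v \<Rightarrow> 'v) \<Rightarrow> 'k mat" where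
  "endo_matrix V T = matrix_wrt V (SOME bs. ordered_basis V bs) T"

definition endo_det :: "('k::field, 'v) module \<Rightarrow> ('v \<Rightarrow> 'v) \<Rightarrow> 'k" where
  "endo_det V T = det (endo_matrix V T)"

definition endo_char_poly :: "('k::field, 'v) module \<Rightarrow> ('v \<Rightarrow> 'v) \<Rightarrow> 'k poly" where
  "endo_char_poly V T = char_poly (endo_matrix V T)"

definition endo_trace :: "('k::field, 'v) module \<Rightarrow> ('v \<Rightarrow> 'v) \<Rightarrow> 'k" where
  "endo_trace V T = (\<Sum>i<dim_row (endo_matrix V T). endo_matrix V T $$ (i, i))"

text \<open>The matrix of the linear map \<open>e\<^sub>o \<mapsto> e\<^sub>\<pi>\<^sub>o\<close>, for a permutation \<open>\<pi>\<close> of the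
  entries of the distinct list \<open>os\<close>.\<close>

definition permutation_matrix :: "'o list \<Rightarrow> ('o \<Rightarrow> 'o) \<Rightarrow> 'k::field mat" where
  "permutation_matrix os \<pi> =
     mat (length os) (length os) (\<lambda>(i, j). if os ! i = \<pi> (os ! j) then 1 else 0)"


section \<open>Periodic orbits\<close>

definition has_least_period :: "'a point \<Rightarrow> nat \<Rightarrow> bool" where
  "has_least_period x m \<longleftrightarrow>
     0 < m \<and> (shift ^^ m) x = x \<and> (\<forall>k. 0 < k \<and> k < m \<longrightarrow> (shift ^^ k) x \<noteq> x)"

definition periodic_orbits :: "nat \<Rightarrow> 'a point set \<Rightarrow> 'a point set set" where
  "periodic_orbits m X = {Orbits.orbit shift x | x. x \<in> X \<and> has_least_period x m}"

definition orbit_sign :: "nat \<Rightarrow> 'a point set \<Rightarrow> ('a point \<Rightarrow> 'a point) \<Rightarrow> int" where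
  "orbit_sign m X f = sign_on (periodic_orbits m X) (\<lambda>orb. f ` orb)"

end

(*
A periodic point x of least period m has a Frobenius class in the absolute Galois group: given a
compatible family of points above x, shift^m moves each of them inside its fibre, and the unique
deck transformations realising these moves form an element of the inverse limit. A continuous
character has the same value on all Frobenius elements of an orbit, so evaluation gives linear forms
E_o on H^1, one for each periodic orbit o of length m, and E_{f o} (Upsilon f chi) = E_o chi.
W is the common kernel of these forms. They are linearly independent: if c is the indicator of a
cylinder that meets the periodic points of length m only in one point of o, then the skew product of X
and F_p along c is irreducible, hence a Galois factor, and its character is dual to o. The dual
vectors descend to a basis of H^1/W that f permutes in the same way as it permutes the orbits.

The dynamical input is that distinct points of a fibre of an unramified factor map are uniformly
separated. It makes lifts of block codes unique, and it allows points to be lifted along half-lines;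
since any two points of X are joined by a zigzag of half-lines, every profinite fibre is nonempty
without an appeal to directedness.
*)
theory Submission
  imports Defs "HOL-Analysis.T1_Spaces"
begin

section \<open>Windows and block codes\<close>

text \<open>The obstacle is that being unramified is a condition on the cardinalities of fibres
  only, whereas lifting points and block codes needs one window length that serves all points at
  once. Over periodic points, agreement on a long window is excluded because finite type would allow
  segments of two preimages to be exchanged at infinitely many places; periodic points are dense,
  and the constant cardinality keeps preimages from merging in the limit. In a skew product over
  F_p, the sums of the cocycle along periodic orbits serve two purposes. A sum 1 along one orbit
  turns the group coordinate by a generator of F_p, and this is what joins the sheets of the skew
  product. The same sums are the values of its character on Frobenius elements. One indicator
  function therefore settles both irreducibility and duality. The quotient H^1/W is handled through
  the values of the forms E_o alone: the induced map, its linearity and its matrix are all read off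
  from them.\<close>

definition agree :: "int set \<Rightarrow> 'a point \<Rightarrow> 'a point \<Rightarrow> bool" where
  "agree S x y \<longleftrightarrow> (\<forall>i\<in>S. x i = y i)"

text \<open>Integer powers of the shift; negative exponents are needed to move words and lifts back
  to their place.\<close>

definition translate :: "int \<Rightarrow> 'a point \<Rightarrow> 'a point" where
  "translate k x = (\<lambda>i. x (i + k))"

definition subshift :: "'a point set \<Rightarrow> bool" where
  "subshift X \<longleftrightarrow> (\<exists>A. shift_space A X)"

lemma agreeD: "agree S x y \<Longrightarrow> i \<in> S \<Longrightarrow> x i = y i"
  by (simp add: agree_def)

lemma agree_refl [simp]: "agree S x x"
  by (simp add: agree_def)

lemma agree_sym: "agree S x y \<Longrightarrow> agree S y x"
  by (simp add: agree_def)

lemma agree_trans: "agree S x y \<Longrightarrow> agree S y z \<Longrightarrow> agree S x z"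
  by (simp add: agree_def)

lemma agree_mono: "agree S x y \<Longrightarrow> T \<subseteq> S \<Longrightarrow> agree T x y"
  by (auto simp: agree_def)

lemma agree_translate: "agree {a..b} (translate k x) (translate k y) \<longleftrightarrow> agree {a + k..b + k} x y"
proof
  assume L: "agree {a..b} (translate k x) (translate k y)"
  show "agree {a + k..b + k} x y"
    unfolding agree_def
  proof
    fix i assume "i \<in> {a + k..b + k}"
    then show "x i = y i"
      using agreeD[OF L, of "i - k"] by (simp add: translate_def)
  qed
qed (auto simp: agree_def translate_def)

lemma translate_apply: "translate k x i = x (i + k)"
  by (simp add: translate_def)

lemma translate_translate [simp]: "translate j (translate k x) = translate (j + k) x"
  by (simp add: translate_def fun_eq_iff algebra_simps)

lemma translate_0 [simp]: "translate 0 x = x"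
  by (simp add: translate_def)

lemma shift_eq_translate: "shift = translate 1"
  by (simp add: shift_def translate_def fun_eq_iff)

lemma shift_funpow: "(shift ^^ n) x = translate (int n) x"
  by (induction n) (simp_all add: shift_eq_translate)

lemma translate_periodic:
  assumes "translate P x = x"
  shows "translate (k * P) x = x"
proof -
  have nat: "translate (int n * P) x = x" for n
  proof (induction n)
    case (Suc n)
    have "translate (int (Suc n) * P) x = translate (int n * P) (translate P x)"
      by (simp add: algebra_simps)
    then show ?case
      using Suc assms by simp
  qed simp
  show ?thesis
  proof (cases "k \<ge> 0")
    case True
    then show ?thesis
      using nat[of "nat k"] by simp
  next
    case False
    have "translate (k * P) (translate (- k * P) x) = translate (k * P) x"
      using nat[of "nat (- k)"] False by simp
    then show ?thesis
      by simp
  qed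
qed

lemma translate_mem:
  assumes "subshift X" "x \<in> X"
  shows "translate k x \<in> X"
proof -
  obtain A where A: "shift_space A X"
    using assms by (auto simp: subshift_def)
  have fwd: "translate 1 z \<in> X" if "z \<in> X" for z
    using A that by (metis imageI shift_eq_translate shift_space_def)
  have bwd: "translate (-1) z \<in> X" if z: "z \<in> X" for z
  proof -
    obtain w where w: "w \<in> X" "z = translate 1 w"
      using A z by (metis imageE shift_eq_translate shift_space_def)
    then show ?thesis
      by simp
  qed
  show ?thesis
  proof (induction k rule: int_induct[where k = 0])
    case base
    then show ?case using assms by simp
  next
    case (step1 i)
    then show ?case using fwd[of "translate i x"] by (simp add: add.commute)
  next
    case (step2 i)
    then show ?case using bwd[of "translate i x"] by (simp add: algebra_simps)
  qed
qed

text \<open>A basic open set of the product restricts only finitely many coordinates, and these lie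
  in a symmetric window; so the cylinders over symmetric windows form a base of
  neighbourhoods.\<close>

lemma openin_seq_top:
  "openin seq_top U \<longleftrightarrow> (\<forall>x\<in>U. \<exists>n. \<forall>z. agree {-n..n} x z \<longrightarrow> z \<in> U)"
proof
  assume U: "openin seq_top U"
  show "\<forall>x\<in>U. \<exists>n. \<forall>z. agree {-n..n} x z \<longrightarrow> z \<in> U"
  proof
    fix x assume "x \<in> U"
    then obtain B where fin: "finite {i. B i \<noteq> UNIV}" and xB: "x \<in> Pi\<^sub>E UNIV B" and BU: "Pi\<^sub>E UNIV B \<subseteq> U"
      using U unfolding seq_top_def openin_product_topology_alt by auto
    obtain n where n: "\<forall>i\<in>{i. B i \<noteq> UNIV}. \<bar>i\<bar> \<le> n"
      using fin by (metis Max_ge finite_imageI imageI)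
    have "z \<in> U" if "agree {-n..n} x z" for z
    proof -
      have "z i \<in> B i" for i
      proof (cases "B i = UNIV")
        case False
        then have "x i = z i"
          using n that by (auto simp: agree_def abs_le_iff)
        then show ?thesis using xB by (metis PiE_mem UNIV_I)
      qed simp
      then show ?thesis using BU by (auto simp: PiE_def)
    qed
    then show "\<exists>n. \<forall>z. agree {-n..n} x z \<longrightarrow> z \<in> U" by blast
  qed
next
  assume R: "\<forall>x\<in>U. \<exists>n. \<forall>z. agree {-n..n} x z \<longrightarrow> z \<in> U"
  show "openin seq_top U"
    unfolding seq_top_def openin_product_topology_alt
  proof
    fix x assume "x \<in> U"
    then obtain n where n: "\<forall>z. agree {-n..n} x z \<longrightarrow> z \<in> U" using R by blast
    define B where "B = (\<lambda>i. if i \<in> {-n..n} then {x i} else UNIV)"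
    have "{i. B i \<noteq> UNIV} \<subseteq> {-n..n}"
      by (auto simp: B_def)
    then have "finite {i. B i \<noteq> UNIV}"
      using finite_subset by blast
    moreover have "Pi\<^sub>E UNIV B \<subseteq> U"
    proof
      fix z assume z: "z \<in> Pi\<^sub>E UNIV B"
      have "z i \<in> B i" for i using z by auto
      then have "agree {-n..n} x z"
        unfolding agree_def B_def by (metis singletonD)
      then show "z \<in> U" using n by blast
    qed
    ultimately show "\<exists>B. finite {i \<in> UNIV. B i \<noteq> topspace (discrete_topology UNIV)} \<and>
        (\<forall>i\<in>UNIV. openin (discrete_topology UNIV) (B i)) \<and> x \<in> Pi\<^sub>E UNIV B \<and> Pi\<^sub>E UNIV B \<subseteq> U"
      by (intro exI[of _ B]) (auto simp: B_def)
  qed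
qed

lemma topspace_seq_top [simp]: "topspace seq_top = UNIV"
  by (simp add: seq_top_def)

lemma openin_sub_seq_top:
  "openin (subtopology seq_top X) U \<longleftrightarrow>
     U \<subseteq> X \<and> (\<forall>x\<in>U. \<exists>n. \<forall>z\<in>X. agree {-n..n} x z \<longrightarrow> z \<in> U)"
proof
  assume "openin (subtopology seq_top X) U"
  then obtain T where T: "openin seq_top T" "U = T \<inter> X"
    by (auto simp: openin_subtopology)
  show "U \<subseteq> X \<and> (\<forall>x\<in>U. \<exists>n. \<forall>z\<in>X. agree {-n..n} x z \<longrightarrow> z \<in> U)"
    using T(1) unfolding openin_seq_top T(2) by blast
next
  assume R: "U \<subseteq> X \<and> (\<forall>x\<in>U. \<exists>n. \<forall>z\<in>X. agree {-n..n} x z \<longrightarrow> z \<in> U)"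
  then obtain n where n: "\<And>x z. x \<in> U \<Longrightarrow> z \<in> X \<Longrightarrow> agree {-n x..n x} x z \<Longrightarrow> z \<in> U"
    by metis
  define T where "T = {z. \<exists>x\<in>U. agree {-n x..n x} x z}"
  have "openin seq_top T"
    unfolding openin_seq_top T_def using agree_trans by blast
  moreover have "U = T \<inter> X"
    using R n by (auto simp: T_def intro: agree_refl)
  ultimately show "openin (subtopology seq_top X) U"
    by (auto simp: openin_subtopology)
qed

lemma Hausdorff_seq_top: "Hausdorff_space seq_top"
  unfolding seq_top_def by (simp add: Hausdorff_space_product_topology)

text \<open>By Tychonoff the sequences over the finite alphabet form a compact set, and X is closed
  in it.\<close>

lemma subshift_compact:
  assumes "subshift X"
  shows "compactin seq_top X"
proof -
  obtain A where A: "shift_space A X"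
    using assms by (auto simp: subshift_def)
  have "compactin seq_top (Pi\<^sub>E UNIV (\<lambda>_. A))"
    unfolding seq_top_def compactin_PiE
    using A by (auto simp: shift_space_def intro: finite_imp_compactin)
  moreover have "X \<subseteq> Pi\<^sub>E UNIV (\<lambda>_. A)"
    using A by (auto simp: shift_space_def)
  moreover have "closedin seq_top X"
    using A by (auto simp: shift_space_def)
  ultimately show ?thesis
    by (meson closed_compactin)
qed

lemma compact_space_subshift: "subshift X \<Longrightarrow> compact_space (subtopology seq_top X)"
  using subshift_compact compact_space_subtopology by blast

text \<open>Finitely many of the cylinders on which h is constant cover the compact space; the
  largest of their radii works at every point.\<close>

lemma locally_constant_imp_uniform:
  assumes X: "subshift X"
    and loc: "\<And>x. x \<in> X \<Longrightarrow> \<exists>n. \<forall>z\<in>X. agree {-n..n} x z \<longrightarrow> h z = h x"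
  shows "\<exists>n. \<forall>x\<in>X. \<forall>z\<in>X. agree {-n..n} x z \<longrightarrow> h x = h z"
proof -
  obtain n where n: "\<And>x z. x \<in> X \<Longrightarrow> z \<in> X \<Longrightarrow> agree {-n x..n x} x z \<Longrightarrow> h z = h x"
    using loc by metis
  define U where "U = (\<lambda>x. {z. agree {-n x..n x} x z})"
  have "openin seq_top (U x)" for x
    unfolding U_def openin_seq_top using agree_trans by blast
  moreover have "X \<subseteq> \<Union>(U ` X)"
    by (auto simp: U_def)
  ultimately obtain F where F: "finite F" "F \<subseteq> U ` X" "X \<subseteq> \<Union>F"
    using subshift_compact[OF X] unfolding compactin_def by (metis (no_types, lifting) imageE)
  obtain S where S: "finite S" "S \<subseteq> X" "F = U ` S"
    using F(1,2) by (meson finite_subset_image)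
  define M where "M = Max (insert 0 (n ` S))"
  have M: "n s \<le> M" if "s \<in> S" for s
    using S(1) that by (simp add: M_def)
  have "h x = h z" if xz: "x \<in> X" "z \<in> X" "agree {-M..M} x z" for x z
  proof -
    obtain s where "s \<in> S" "x \<in> U s"
      using F(3) xz(1) unfolding S(3) by blast
    then have s: "s \<in> S" "agree {-n s..n s} s x"
      by (simp_all add: U_def)
    have "agree {-n s..n s} x z"
      using that(3) by (rule agree_mono) (use M[OF s(1)] in auto)
    then have "agree {-n s..n s} s z"
      using s(2) agree_trans by blast
    then have "h z = h s" "h x = h s"
      using n[of s] s S(2) that(1,2) by blast+
    then show ?thesis by simp
  qed
  then show ?thesis by blast
qed

lemma continuous_map_seq_top:
  "continuous_map (subtopology seq_top X) (subtopology seq_top Y) f \<longleftrightarrow>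
     f \<in> X \<rightarrow> Y \<and> (\<forall>x\<in>X. \<forall>k. \<exists>n. \<forall>z\<in>X. agree {-n..n} x z \<longrightarrow> agree {-k..k} (f x) (f z))"
  (is "?L \<longleftrightarrow> ?R")
proof
  assume c: ?L
  then have fX: "f \<in> X \<rightarrow> Y"
    by (auto simp: continuous_map_def)
  have "\<exists>n. \<forall>z\<in>X. agree {-n..n} x z \<longrightarrow> agree {-k..k} (f x) (f z)" if x: "x \<in> X" for x k
  proof -
    have "openin (subtopology seq_top Y) {w \<in> Y. agree {-k..k} (f x) w}"
      unfolding openin_sub_seq_top using agree_trans by blast
    then have "openin (subtopology seq_top X) {z \<in> X. f z \<in> {w \<in> Y. agree {-k..k} (f x) w}}"
      using c openin_continuous_map_preimage by fastforce
    moreover have "x \<in> {z \<in> X. f z \<in> {w \<in> Y. agree {-k..k} (f x) w}}"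
      using x fX by auto
    ultimately obtain n where "\<forall>z\<in>X. agree {-n..n} x z \<longrightarrow> z \<in> {z \<in> X. f z \<in> {w \<in> Y. agree {-k..k} (f x) w}}"
      unfolding openin_sub_seq_top by blast
    then show ?thesis by blast
  qed
  with fX show ?R by blast
next
  assume R: ?R
  have "openin (subtopology seq_top X) {x \<in> X. f x \<in> U}" if U: "openin (subtopology seq_top Y) U" for U
    unfolding openin_sub_seq_top
  proof (intro conjI ballI)
    fix x assume x: "x \<in> {x \<in> X. f x \<in> U}"
    then obtain k where k: "\<forall>z\<in>Y. agree {-k..k} (f x) z \<longrightarrow> z \<in> U"
      using U unfolding openin_sub_seq_top by blast
    obtain n where "\<forall>z\<in>X. agree {-n..n} x z \<longrightarrow> agree {-k..k} (f x) (f z)"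
      using R x by blast
    then show "\<exists>n. \<forall>z\<in>X. agree {-n..n} x z \<longrightarrow> z \<in> {x \<in> X. f x \<in> U}"
      using k R by (intro exI[of _ n]) auto
  qed auto
  then show ?L
    using R by (auto simp: continuous_map_def)
qed

text \<open>Block codes of memory and anticipation r, except for the commutation with the shift,
  which is required separately.\<close>

definition local_map :: "int \<Rightarrow> 'a point set \<Rightarrow> ('a point \<Rightarrow> 'b point) \<Rightarrow> bool" where
  "local_map r X f \<longleftrightarrow> (\<forall>x\<in>X. \<forall>z\<in>X. \<forall>i. agree {i - r..i + r} x z \<longrightarrow> f x i = f z i)"

lemma local_map_mono:
  assumes "local_map r X f" "r \<le> s"
  shows "local_map s X f"
  unfolding local_map_def
proof (intro ballI allI impI)
  fix x z i assume *: "x \<in> X" "z \<in> X" "agree {i - s..i + s} x z"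
  have "agree {i - r..i + r} x z"
    using *(3) by (rule agree_mono) (use assms(2) in auto)
  then show "f x i = f z i"
    using assms(1) *(1,2) unfolding local_map_def by blast
qed

lemma commute_translate:
  assumes X: "subshift X" and f: "\<And>x. x \<in> X \<Longrightarrow> f (shift x) = shift (f x)" and x: "x \<in> X"
  shows "f (translate k x) = translate k (f x)"
proof (induction k rule: int_induct[where k = 0])
  case (step1 i)
  then show ?case
    using f[of "translate i x"] translate_mem[OF X x] by (simp add: shift_eq_translate add.commute)
next
  case (step2 i)
  have "translate 1 (f (translate (i - 1) x)) = translate i (f x)"
    using f[of "translate (i - 1) x"] step2 translate_mem[OF X x] by (simp add: shift_eq_translate)
  then have "translate (-1) (translate 1 (f (translate (i - 1) x))) = translate (-1) (translate i (f x))"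
    by simp
  then show ?case
    by simp
qed simp

lemma sliding_block_code_translate:
  "subshift X \<Longrightarrow> sliding_block_code X Y f \<Longrightarrow> x \<in> X \<Longrightarrow> f (translate k x) = translate k (f x)"
  by (rule commute_translate) (auto simp: sliding_block_code_def)

lemma sliding_block_code_mem:
  "sliding_block_code X Y f \<Longrightarrow> x \<in> X \<Longrightarrow> f x \<in> Y"
  unfolding sliding_block_code_def continuous_map_seq_top by blast

text \<open>Curtis-Hedlund-Lyndon: compactness makes the window for coordinate 0 uniform, and
  commutation with the shift moves it to every other coordinate.\<close>

lemma sliding_block_code_iff:
  assumes X: "subshift X"
  shows "sliding_block_code X Y f \<longleftrightarrow>
    f \<in> extensional X \<and> f \<in> X \<rightarrow> Y \<and> (\<forall>x\<in>X. f (shift x) = shift (f x)) \<and> (\<exists>r\<ge>0. local_map r X f)"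
    (is "_ \<longleftrightarrow> ?R")
proof
  assume f: "sliding_block_code X Y f"
  have c: "f \<in> X \<rightarrow> Y" and loc: "\<And>x k. x \<in> X \<Longrightarrow> \<exists>n. \<forall>z\<in>X. agree {-n..n} x z \<longrightarrow> agree {-k..k} (f x) (f z)"
    using f by (auto simp: sliding_block_code_def continuous_map_seq_top)
  have "\<exists>n. \<forall>z\<in>X. agree {-n..n} x z \<longrightarrow> f z 0 = f x 0" if "x \<in> X" for x
    using loc[OF that, of 0] by (fastforce simp: agree_def)
  then obtain n where n: "\<And>x z. x \<in> X \<Longrightarrow> z \<in> X \<Longrightarrow> agree {-n..n} x z \<Longrightarrow> f x 0 = f z 0"
    using locally_constant_imp_uniform[OF X, of "\<lambda>x. f x 0"] by blast
  have "local_map n X f"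
    unfolding local_map_def
  proof (intro ballI allI impI)
    fix x z i assume *: "x \<in> X" "z \<in> X" "agree {i - n..i + n} x z"
    then have "agree {-n..n} (translate i x) (translate i z)"
      by (simp add: agree_translate algebra_simps)
    then have "f (translate i x) 0 = f (translate i z) 0"
      using n translate_mem[OF X] * by blast
    then show "f x i = f z i"
      using sliding_block_code_translate[OF X f] *(1,2) by (simp add: translate_def)
  qed
  \<comment> \<open>The uniform window may be empty, with n negative; enlarging the radius keeps the
    property.\<close>
  then have "local_map (max 0 n) X f"
    by (rule local_map_mono) simp
  then show ?R
    using f c by (auto simp: sliding_block_code_def intro!: exI[of _ "max 0 n"])
next
  assume R: ?R
  then obtain r where r: "local_map r X f" by blast
  have "agree {-k..k} (f x) (f z)" if "x \<in> X" "z \<in> X" "agree {-(k+r)..k+r} x z" for x z k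
    unfolding agree_def
  proof
    fix i assume "i \<in> {-k..k}"
    then have "agree {i - r..i + r} x z"
      using agree_mono[OF that(3)] by auto
    then show "f x i = f z i"
      using r that(1,2) unfolding local_map_def by blast
  qed
  then show "sliding_block_code X Y f"
    using R unfolding sliding_block_code_def continuous_map_seq_top by blast
qed

section \<open>Subshifts of finite type\<close>

text \<open>Windows of n + 1 letters decide membership: this is the form of finite type in which
  points can be glued.\<close>

definition step :: "int \<Rightarrow> 'a point set \<Rightarrow> bool" where
  "step n X \<longleftrightarrow> (\<forall>x. (\<forall>i. \<exists>y\<in>X. agree {i..i + n} x y) \<longrightarrow> x \<in> X)"

definition glue :: "int \<Rightarrow> 'a point \<Rightarrow> 'a point \<Rightarrow> 'a point" where
  "glue a x y = (\<lambda>i. if i < a then x i else y i)"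

text \<open>Transitivity for half-infinite words: the left end of x up to n is joined to the right
  end of x' from n' on, up to a translation. The strict inequality leaves at least one free letter,
  which later makes the connecting word nonempty.\<close>

definition reach :: "'a point set \<Rightarrow> int \<Rightarrow> int \<Rightarrow> 'a point \<Rightarrow> 'a point \<Rightarrow> bool" where
  "reach X n n' x x' \<longleftrightarrow>
     (\<exists>z\<in>X. \<exists>l. n + 1 < n' + l \<and> (\<forall>i\<le>n. z i = x i) \<and> (\<forall>i\<ge>n'. z (i + l) = x' i))"

lemma step_mono:
  assumes "step n X" "n \<le> m"
  shows "step m X"
  unfolding step_def
proof (intro allI impI)
  fix x assume *: "\<forall>i. \<exists>y\<in>X. agree {i..i + m} x y"
  have "\<exists>y\<in>X. agree {i..i + n} x y" for i
  proof -
    obtain y where y: "y \<in> X" "agree {i..i + m} x y"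
      using * by blast
    from y(2) have "agree {i..i + n} x y"
      by (rule agree_mono) (use assms(2) in auto)
    with y(1) show ?thesis by blast
  qed
  then show "x \<in> X"
    using assms(1) unfolding step_def by blast
qed

text \<open>A window that starts before a ends before a + n, so the letters that it takes from y lie
  in the overlap, where x has the same ones.\<close>

lemma glue_agree:
  assumes "agree {a..a + n} x y"
  shows "agree {i..i + n} (glue a x y) (if i < a then x else y)"
  using assms by (auto simp: glue_def agree_def)

lemma glue_mem:
  assumes "step n X" "x \<in> X" "y \<in> X" "agree {a..a + n} x y"
  shows "glue a x y \<in> X"
proof -
  have "\<exists>w\<in>X. agree {i..i + n} (glue a x y) w" for i
    using glue_agree[OF assms(4), of i] assms(2,3) by (cases "i < a") auto
  then show ?thesis
    using assms(1) unfolding step_def by blast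
qed

lemma sft_subshift: "sft X \<Longrightarrow> subshift X"
  by (auto simp: sft_def subshift_def)

text \<open>A window longer than every forbidden word shows each violation, and being nonempty it
  also tests the alphabet.\<close>

lemma sft_step:
  assumes "sft X"
  shows "\<exists>n\<ge>0. step n X"
proof -
  obtain A F where F: "finite F" and X: "X = {x. range x \<subseteq> A \<and> (\<forall>w\<in>F. \<not> occurs_in w x)}"
    using assms unfolding sft_def by blast
  define n where "n = int (Max (insert 0 (length ` F)))"
  have n: "int (length w) \<le> n" if "w \<in> F" for w
    using F that by (simp add: n_def)
  have "step n X"
    unfolding step_def
  proof (intro allI impI)
    fix x assume *: "\<forall>i. \<exists>y\<in>X. agree {i..i + n} x y"
    have "x i \<in> A" for i
    proof -
      obtain y where y: "y \<in> X" "agree {i..i + n} x y"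
        using * by blast
      have "x i = y i"
        using y(2) by (rule agreeD) (simp add: n_def)
      then show ?thesis
        using y(1) X by auto
    qed
    moreover have "\<not> occurs_in w x" if w: "w \<in> F" for w
    proof
      assume "occurs_in w x"
      then obtain i where i: "\<And>k. k < length w \<Longrightarrow> x (i + int k) = w ! k"
        by (auto simp: occurs_in_def)
      obtain y where y: "y \<in> X" "agree {i..i + n} x y"
        using * by blast
      have "y (i + int k) = w ! k" if "k < length w" for k
        using i[OF that] agreeD[OF y(2), of "i + int k"] n[OF w] that by auto
      then have "occurs_in w y"
        by (auto simp: occurs_in_def)
      then show False
        using y(1) X w by auto
    qed
    ultimately show "x \<in> X"
      unfolding X by blast
  qed
  then show ?thesis
    by (intro exI[of _ n]) (simp add: n_def)
qed

text \<open>A sequence outside X has a window that no point of X shows, and nearby sequences share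
  this window; hence X is closed.\<close>

lemma step_shift_space:
  assumes "finite A" "X \<noteq> {}" "X \<subseteq> {x. range x \<subseteq> A}" "shift ` X = X" "step n X"
  shows "shift_space A X"
proof -
  have "openin seq_top (- X)"
    unfolding openin_seq_top
  proof
    fix x assume "x \<in> - X"
    then obtain i where i: "\<forall>y\<in>X. \<not> agree {i..i + n} x y"
      using assms(5) unfolding step_def by blast
    have "z \<in> - X" if "agree {-(\<bar>i\<bar> + \<bar>n\<bar>)..\<bar>i\<bar> + \<bar>n\<bar>} x z" for z
    proof -
      have "agree {i..i + n} x z"
        using that by (rule agree_mono) auto
      then show ?thesis using i by blast
    qed
    then show "\<exists>N. \<forall>z. agree {-N..N} x z \<longrightarrow> z \<in> - X"
      by blast
  qed
  then have "closedin seq_top X"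
    by (simp add: closedin_def Compl_eq_Diff_UNIV)
  then show ?thesis
    using assms by (simp add: shift_space_def)
qed

section \<open>Words, forbidden words and irreducibility\<close>

definition word :: "'a point \<Rightarrow> int \<Rightarrow> nat \<Rightarrow> 'a list" where
  "word x a k = map (\<lambda>j. x (a + int j)) [0..<k]"

lemma length_word [simp]: "length (word x a k) = k"
  by (simp add: word_def)

lemma nth_word [simp]: "j < k \<Longrightarrow> word x a k ! j = x (a + int j)"
  by (simp add: word_def)

lemma word_language: "x \<in> X \<Longrightarrow> word x a k \<in> language X"
  by (auto simp: language_def occurs_in_def)

lemma language_translate:
  assumes X: "subshift X" and "w \<in> language X"
  shows "\<exists>x\<in>X. \<forall>k<length w. x (a + int k) = w ! k"
proof -
  obtain x i where x: "x \<in> X" "\<forall>k<length w. x (i + int k) = w ! k"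
    using assms by (auto simp: language_def occurs_in_def)
  show ?thesis
  proof (intro bexI allI impI)
    show "translate (i - a) x \<in> X"
      using translate_mem[OF X x(1)] .
    fix k assume "k < length w"
    then show "translate (i - a) x (a + int k) = w ! k"
      using x(2) by (simp add: translate_def algebra_simps)
  qed
qed

text \<open>The forbidden words are the words of n + 1 letters that do not occur; over a finite
  alphabet there are finitely many.\<close>

lemma sft_intro:
  assumes X: "shift_space A X" and n: "0 \<le> n" and st: "step n X"
  shows "sft X"
proof -
  define F where "F = {w. set w \<subseteq> A \<and> length w = nat n + 1 \<and> w \<notin> language X}"
  have "finite A"
    using X by (simp add: shift_space_def)
  then have "finite {w. set w \<subseteq> A \<and> length w = nat n + 1}"
    by (rule finite_lists_length_eq)
  then have F: "finite F" "F \<subseteq> lists A"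
    by (auto simp: F_def elim: rev_finite_subset)
  have sub: "subshift X"
    using X by (auto simp: subshift_def)
  have "x \<in> X" if x: "range x \<subseteq> A" "\<forall>w\<in>F. \<not> occurs_in w x" for x
  proof -
    have "\<exists>y\<in>X. agree {i..i + n} x y" for i
    proof -
      have "occurs_in (word x i (nat n + 1)) x"
        by (auto simp: occurs_in_def)
      then have "word x i (nat n + 1) \<notin> F"
        using x(2) by blast
      moreover have "set (word x i (nat n + 1)) \<subseteq> A"
        using x(1) by (auto simp: word_def)
      ultimately have "word x i (nat n + 1) \<in> language X"
        by (simp add: F_def)
      then obtain y where y: "y \<in> X" "\<forall>k<nat n + 1. y (i + int k) = word x i (nat n + 1) ! k"
        using language_translate[OF sub] by (metis length_word)
      have "agree {i..i + n} x y"
        unfolding agree_def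
      proof
        fix j assume "j \<in> {i..i + n}"
        then show "x j = y j"
          using y(2)[rule_format, of "nat (j - i)"] by auto
      qed
      with y(1) show ?thesis by blast
    qed
    then show ?thesis
      using st unfolding step_def by blast
  qed
  moreover have "range x \<subseteq> A" "\<forall>w\<in>F. \<not> occurs_in w x" if "x \<in> X" for x
    using X that by (auto simp: shift_space_def F_def language_def)
  ultimately have "X = {x. range x \<subseteq> A \<and> (\<forall>w\<in>F. \<not> occurs_in w x)}"
    by blast
  then show ?thesis
    using X F unfolding sft_def by blast
qed

lemma irreducible_subshift: "irreducible_sft X \<Longrightarrow> subshift X"
  by (simp add: irreducible_sft_def sft_subshift)

lemma irreducible_step: "irreducible_sft X \<Longrightarrow> \<exists>n\<ge>0. step n X"
  by (simp add: irreducible_sft_def sft_step)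

text \<open>The word w connects a block of L + 1 letters at the end of the left half-line to a block
  of L + 1 letters at the start of the right one. These blocks are the overlaps at which both
  half-lines are glued to a point that contains the connected word.\<close>

lemma irreducible_reach:
  assumes X: "irreducible_sft X" and x: "x \<in> X" and x': "x' \<in> X"
  shows "reach X n n' x x'"
proof -
  obtain L where L: "0 \<le> L" "step L X"
    using irreducible_step[OF X] by blast
  define K where "K = nat L + 1"
  obtain w where w: "w \<noteq> []" "word x (n - L) K @ w @ word x' n' K \<in> language X"
    using X word_language[OF x] word_language[OF x'] unfolding irreducible_sft_def by blast
  let ?u = "word x (n - L) K @ w @ word x' n' K"
  obtain t where t: "t \<in> X" "\<forall>k<length ?u. t ((n - L) + int k) = ?u ! k"
    using language_translate[OF irreducible_subshift[OF X] w(2), of "n - L"] by blast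
  have t1: "agree {n - L..n - L + L} x t"
    unfolding agree_def
  proof
    fix i assume i: "i \<in> {n - L..n - L + L}"
    define k where "k = nat (i - (n - L))"
    have k: "k < K" "i = n - L + int k"
      using i L(1) by (auto simp: k_def K_def)
    then show "x i = t i"
      using t(2)[rule_format, of k] by (simp add: nth_append)
  qed
  \<comment> \<open>The connecting word occupies the positions n + 1 to n + \<open>length w\<close>;
    the translation by l puts position n' of x' right behind it.\<close>
  define l where "l = n + 1 + int (length w) - n'"
  define x'' where "x'' = translate (- l) x'"
  have x'': "x'' \<in> X"
    unfolding x''_def using irreducible_subshift[OF X] x' by (rule translate_mem)
  have t2: "agree {n' + l..n' + l + L} t x''"
    unfolding agree_def
  proof
    fix i assume i: "i \<in> {n' + l..n' + l + L}"
    define k where "k = nat (i - (n' + l))"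
    have k: "k < K" "i = n' + l + int k"
      using i L(1) by (auto simp: k_def K_def)
    have "t i = ?u ! (K + length w + k)"
      using t(2)[rule_format, of "K + length w + k"] k L(1) by (simp add: l_def K_def algebra_simps)
    also have "\<dots> = x' (n' + int k)"
      using k by (simp add: nth_append)
    finally show "t i = x'' i"
      by (simp add: x''_def translate_def k(2))
  qed
  define s where "s = glue (n - L) x t"
  have s: "s \<in> X"
    unfolding s_def using glue_mem[OF L(2) x t(1) t1] .
  have len: "int (length w) > 0"
    using w(1) by simp
  have "agree {n' + l..n' + l + L} s x''"
    using t2 len L(1) by (auto simp: agree_def s_def glue_def l_def)
  then have "glue (n' + l) s x'' \<in> X"
    using glue_mem[OF L(2) s x''] by blast
  moreover have "glue (n' + l) s x'' i = x i" if "i \<le> n" for i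
    using that len agreeD[OF t1, of i] by (auto simp: glue_def s_def l_def)
  moreover have "glue (n' + l) s x'' (i + l) = x' i" if "i \<ge> n'" for i
    using that by (auto simp: glue_def x''_def translate_def)
  moreover have "n + 1 < n' + l"
    using len by (simp add: l_def)
  ultimately show ?thesis
    unfolding reach_def by blast
qed

lemma irreducible_intro:
  assumes X: "sft X" and r: "\<And>x x' n n'. x \<in> X \<Longrightarrow> x' \<in> X \<Longrightarrow> reach X n n' x x'"
  shows "irreducible_sft X"
  unfolding irreducible_sft_def
proof (intro conjI ballI X)
  fix u v assume "u \<in> language X" "v \<in> language X"
  then obtain x a x' b where x: "x \<in> X" "\<forall>k<length u. x (a + int k) = u ! k"
    and x': "x' \<in> X" "\<forall>k<length v. x' (b + int k) = v ! k"
    by (auto simp: language_def occurs_in_def)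
  \<comment> \<open>The last position of u in x; the connecting word fills the positions after n and
    before b + l.\<close>
  define n where "n = a + int (length u) - 1"
  obtain z l where z: "z \<in> X" "n + 1 < b + l" "\<forall>i\<le>n. z i = x i" "\<forall>i\<ge>b. z (i + l) = x' i"
    using r[OF x(1) x'(1), of n b] unfolding reach_def by blast
  define w where "w = word z (n + 1) (nat (b + l - n - 1))"
  have "z (a + int k) = (u @ w @ v) ! k" if k: "k < length (u @ w @ v)" for k
  proof -
    consider "k < length u" | "length u \<le> k" "k < length u + length w"
      | "length u + length w \<le> k" "k < length u + length w + length v"
      using k by fastforce
    then show ?thesis
    proof cases
      case 1
      then show ?thesis
        using x(2) z(3) by (simp add: nth_append n_def)
    next
      case 2
      then have "k - length u < length w"
        by linarith
      with 2 have "(u @ w @ v) ! k = z (n + 1 + int (k - length u))"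
        unfolding nth_append by (simp add: w_def)
      with 2 show ?thesis
        by (simp add: n_def of_nat_diff)
    next
      case 3
      define j where "j = k - length u - length w"
      have j: "j < length v" "int k = int (length u) + int (length w) + int j"
        using 3 by (auto simp: j_def)
      have "\<not> k < length u" "\<not> k - length u < length w"
        using 3 by auto
      then have "(u @ w @ v) ! k = v ! j"
        unfolding nth_append by (simp add: j_def)
      also have "\<dots> = x' (b + int j)"
        using x'(2) j by simp
      also have "\<dots> = z (b + int j + l)"
        using z(4) by simp
      also have "b + int j + l = a + int k"
        using j z(2) by (simp add: n_def w_def)
      finally show ?thesis ..
    qed
  qed
  then have "u @ w @ v \<in> language X"
    using z(1) by (auto simp: language_def occurs_in_def)
  moreover have "w \<noteq> []"
    using z(2) by (simp add: w_def word_def)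
  ultimately show "\<exists>w. w \<noteq> [] \<and> u @ w @ v \<in> language X"
    by blast
qed

text \<open>A point that leaves x and later returns to x contains a block whose end fits its
  beginning, and repeating this block gives a periodic point. The return is made late enough that
  the first block shows x on the whole given window.\<close>

lemma periodic_dense:
  assumes X: "irreducible_sft X" and x: "x \<in> X"
  shows "\<exists>z\<in>X. \<exists>P>0. translate P z = z \<and> agree {-N..N} x z"
proof -
  obtain L where L: "0 \<le> L" "step L X"
    using irreducible_step[OF X] by blast
  define M where "M = max N 0"
  obtain z l where z: "z \<in> X" "M + L + 1 < - M + l" "\<forall>i\<le>M + L. z i = x i" "\<forall>i\<ge>-M. z (i + l) = x i"
    using irreducible_reach[OF X x x, of "M + L" "- M"] unfolding reach_def by blast
  have M: "0 \<le> M" "N \<le> M"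
    by (auto simp: M_def)
  \<comment> \<open>The positions -M to l - M - 1 of z, repeated with period l.\<close>
  define z' where "z' = (\<lambda>i. z ((i + M) mod l - M))"
  have per: "translate l z' = z'"
    by (simp add: z'_def translate_def fun_eq_iff) (metis add.assoc add.commute mod_add_self2)
  have "\<exists>y\<in>X. agree {i..i + L} z' y" for i
  proof
    define r where "r = (i + M) mod l"
    have r: "0 \<le> r" "r < l"
      using z(2) M L by (auto simp: r_def)
    show "translate (r - M - i) z \<in> X"
      using irreducible_subshift[OF X] z(1) by (rule translate_mem)
    show "agree {i..i + L} z' (translate (r - M - i) z)"
      unfolding agree_def
    proof
      fix j assume j: "j \<in> {i..i + L}"
      have m: "(j + M) mod l = (r + (j - i)) mod l"
        unfolding r_def by (simp add: mod_simps add.commute)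
      show "z' j = translate (r - M - i) z j"
      proof (cases "r + (j - i) < l")
        case True
        then have "(j + M) mod l = r + (j - i)"
          using m r j by simp
        then have "z' j = z (r + (j - i) - M)"
          by (simp add: z'_def)
        then show ?thesis
          by (simp add: translate_def algebra_simps)
      next
        \<comment> \<open>Behind the seam the repeated block starts again with x, and z itself has
          returned to x there, so the window still occurs in z.\<close>
        case False
        have "(r + (j - i)) mod l = (r + (j - i) - l) mod l"
          by simp
        also have "\<dots> = r + (j - i) - l"
          using False r j z(2) M L by (intro mod_pos_pos_trivial) auto
        finally have "(j + M) mod l = r + (j - i) - l"
          using m by simp
        then have "z' j = z (r + (j - i) - l - M)"
          by (simp add: z'_def)
        also have "\<dots> = x (r + (j - i) - l - M)"
          using z(3) r j M by simp
        also have "\<dots> = z (r + (j - i) - l - M + l)"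
          using z(4)[rule_format, of "r + (j - i) - l - M"] False by simp
        finally show ?thesis
          by (simp add: translate_def algebra_simps)
      qed
    qed
  qed
  then have "z' \<in> X"
    using L(2) unfolding step_def by blast
  moreover have "agree {-N..N} x z'"
    using z(2,3) M L by (auto simp: agree_def z'_def)
  moreover have "l > 0"
    using z(2) M L by simp
  ultimately show ?thesis
    using per by blast
qed

section \<open>Unramified factor maps\<close>

lemma fibreD: "y \<in> fibre Y \<pi> x \<Longrightarrow> y \<in> Y" "y \<in> fibre Y \<pi> x \<Longrightarrow> \<pi> y = x"
  by (auto simp: fibre_def)

text \<open>As n is at least 2 * r, each window on which \<pi> depends sits inside n + 1 letters,
  and there the glued point looks like y or like y', both of which have image x.\<close>

lemma fibre_glue:
  assumes Y: "step n Y" and loc: "local_map r Y \<pi>" and n: "2 * r \<le> n"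
    and y: "y \<in> fibre Y \<pi> x" and y': "y' \<in> fibre Y \<pi> x" and ag: "agree {a..a + n} y y'"
  shows "glue a y y' \<in> fibre Y \<pi> x"
proof -
  have mem: "glue a y y' \<in> Y"
    using glue_mem[OF Y _ _ ag] y y' by (simp add: fibreD)
  have "\<pi> (glue a y y') i = x i" for i
  proof -
    define w where "w = (if i - r < a then y else y')"
    have "agree {i - r..i - r + n} (glue a y y') w"
      unfolding w_def using glue_agree[OF ag] .
    then have "agree {i - r..i + r} (glue a y y') w"
      by (rule agree_mono) (use n in auto)
    moreover have w: "w \<in> Y" "\<pi> w = x"
      using y y' by (auto simp: w_def fibre_def)
    ultimately have "\<pi> (glue a y y') i = \<pi> w i"
      using loc mem unfolding local_map_def by blast
    then show ?thesis
      using w(2) by simp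
  qed
  with mem show ?thesis
    by (auto simp: fibre_def)
qed

text \<open>Two periodic preimages that agree on a long window but differ elsewhere could be exchanged
  on any single period, which gives infinitely many preimages.\<close>

lemma no_diamond:
  assumes Y: "step n Y" and n: "0 \<le> n" and loc: "local_map r Y \<pi>" "2 * r \<le> n"
    and fin: "finite (fibre Y \<pi> x)"
    and y: "y \<in> fibre Y \<pi> x" and y': "y' \<in> fibre Y \<pi> x" and ag: "agree {a..a + n} y y'"
    and P: "P > 0" "translate P y = y" "translate P y' = y'"
  shows "y = y'"
proof (rule ccontr)
  assume "y \<noteq> y'"
  then obtain j0 where j0: "y j0 \<noteq> y' j0"
    by auto
  have per: "y (i + k * P) = y i" "y' (i + k * P) = y' i" for i k
    using translate_periodic[OF P(2), of k] translate_periodic[OF P(3), of k]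
    by (metis translate_apply)+
  \<comment> \<open>The difference recurs with period P, so it can be moved into the period that
    begins at a.\<close>
  define j where "j = a + (j0 - a) mod P"
  have j: "a \<le> j" "j < a + P"
    using P(1) by (auto simp: j_def)
  have "j0 = j + (j0 - a) div P * P"
    unfolding j_def by (simp add: algebra_simps)
  then have yj: "y j \<noteq> y' j"
    using j0 per by metis
  \<comment> \<open>\<open>z k\<close> follows y' on the k-th period counted from a and y elsewhere;
    position j + k * P distinguishes it from the other members of the family.\<close>
  define z where "z = (\<lambda>k. glue (a + (k + 1) * P) (glue (a + k * P) y y') y)"
  have agk: "agree {a + k * P..a + k * P + n} y y'" for k
    unfolding agree_def
  proof
    fix i assume "i \<in> {a + k * P..a + k * P + n}"
    then have "y (i + (- k) * P) = y' (i + (- k) * P)"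
      by (intro agreeD[OF ag]) auto
    then show "y i = y' i"
      by (simp only: per)
  qed
  have "z k \<in> fibre Y \<pi> x" for k
    unfolding z_def
  proof (rule fibre_glue[OF Y loc _ y])
    show "glue (a + k * P) y y' \<in> fibre Y \<pi> x"
      by (rule fibre_glue[OF Y loc y y' agk])
    show "agree {a + (k + 1) * P..a + (k + 1) * P + n} (glue (a + k * P) y y') y"
      using agk[of "k + 1"] P(1) by (auto simp: agree_def glue_def algebra_simps)
  qed
  moreover have "inj z"
  proof (rule injI, rule ccontr)
    fix k k' assume eq: "z k = z k'" and ne: "k \<noteq> k'"
    have zk: "z k (j + k * P) = y' j"
      using j per(2)[of j k] by (simp add: z_def glue_def algebra_simps)
    have "z k' (j + k * P) = y j"
    proof (cases "k < k'")
      case True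
      have "(k + 1) * P \<le> k' * P"
        using True P(1) by (intro mult_right_mono) auto
      then have "j + k * P < a + k' * P"
        using j by (simp add: algebra_simps)
      moreover have "k' * P \<le> (k' + 1) * P"
        using P(1) by simp
      ultimately show ?thesis
        using per(1)[of j k] by (simp add: z_def glue_def)
    next
      case False
      then have "(k' + 1) * P \<le> k * P"
        using ne P(1) by (intro mult_right_mono) auto
      then have "\<not> j + k * P < a + (k' + 1) * P"
        using j by linarith
      then show ?thesis
        using per(1)[of j k] by (simp add: z_def glue_def)
    qed
    with zk eq yj show False by simp
  qed
  ultimately have "infinite (fibre Y \<pi> x)"
    by (metis image_subsetI infinite_UNIV_int finite_imageD finite_subset)
  with fin show False by simp
qed

text \<open>Translation by multiples of P keeps y in its finite fibre, so two of the translates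
  coincide.\<close>

lemma periodic_fibre:
  assumes Y: "subshift Y" and \<pi>: "sliding_block_code Y X \<pi>" and fin: "finite (fibre Y \<pi> x)"
    and P: "P > 0" "translate P x = x" and y: "y \<in> fibre Y \<pi> x"
  shows "\<exists>k>0. translate (k * P) y = y"
proof -
  define g where "g = (\<lambda>k::nat. translate (int k * P) y)"
  have "g k \<in> fibre Y \<pi> x" for k
    using y translate_mem[OF Y] sliding_block_code_translate[OF Y \<pi>] translate_periodic[OF P(2)]
    by (auto simp: g_def fibre_def)
  then have "\<not> inj g"
    using fin by (metis finite_imageD finite_subset image_subsetI infinite_UNIV_nat)
  then obtain i k where ik: "g i = g k" "i < k"
    by (metis injI nat_neq_iff)
  have "translate (- int i * P) (g k) = translate (- int i * P) (g i)"
    using ik by simp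
  then have "translate ((int k - int i) * P) y = y"
    by (simp add: g_def algebra_simps)
  then show ?thesis
    using ik(2) by (intro exI[of _ "int k - int i"]) auto
qed

lemma unramifiedD:
  assumes "unramified Y X \<pi>"
  shows "irreducible_sft Y" "irreducible_sft X" "subshift Y" "subshift X"
    "sliding_block_code Y X \<pi>" "\<pi> ` Y = X" "\<And>x. x \<in> X \<Longrightarrow> finite (fibre Y \<pi> x)"
    "\<And>x. x \<in> X \<Longrightarrow> fibre Y \<pi> x \<noteq> {}"
proof -
  show "irreducible_sft Y" "irreducible_sft X" "sliding_block_code Y X \<pi>" "\<pi> ` Y = X"
    using assms by (auto simp: unramified_def factor_map_def)
  then show "subshift Y" "subshift X"
    by (simp_all add: irreducible_subshift)
  fix x assume "x \<in> X"
  then have "card (fibre Y \<pi> x) \<ge> 1"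
    using assms by (auto simp: unramified_def)
  \<comment> \<open>Infinite sets have \<open>card\<close> 0, so a positive value gives finiteness
    as well.\<close>
  then show "finite (fibre Y \<pi> x)" "fibre Y \<pi> x \<noteq> {}"
    using card.infinite by fastforce+
qed

text \<open>A continuous map from a compact space to a Hausdorff space is closed. The points with a
  preimage outside the neighbourhood \<open>U\<close> of the fibre thus form a closed set, which
  misses x.\<close>

lemma fibre_upper_semicontinuous:
  assumes Y: "subshift Y" and \<pi>: "sliding_block_code Y X \<pi>" and x: "x \<in> X"
  shows "\<exists>M. \<forall>z\<in>X. agree {-M..M} x z \<longrightarrow>
           (\<forall>y'\<in>fibre Y \<pi> z. \<exists>y\<in>fibre Y \<pi> x. agree {-K..K} y y')"
proof -
  define U where "U = {y'\<in>Y. \<exists>y\<in>fibre Y \<pi> x. agree {-K..K} y y'}"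
  have U: "openin (subtopology seq_top Y) U"
    unfolding openin_sub_seq_top U_def using agree_trans by blast
  have cl: "closed_map (subtopology seq_top Y) (subtopology seq_top X) \<pi>"
    using \<pi> compact_space_subshift[OF Y] Hausdorff_seq_top
    by (intro continuous_imp_closed_map Hausdorff_space_subtopology) (auto simp: sliding_block_code_def)
  have "closedin (subtopology seq_top X) (\<pi> ` (Y - U))"
    using cl U unfolding closed_map_def by (metis closedin_diff closedin_topspace topspace_subtopology_subset subset_UNIV topspace_seq_top)
  then have "openin (subtopology seq_top X) (X - \<pi> ` (Y - U))"
    by (metis openin_diff openin_topspace topspace_subtopology_subset subset_UNIV topspace_seq_top)
  moreover have "x \<in> X - \<pi> ` (Y - U)"
    using x by (auto simp: U_def fibre_def)
  ultimately obtain M where M: "\<forall>z\<in>X. agree {-M..M} x z \<longrightarrow> z \<in> X - \<pi> ` (Y - U)"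
    unfolding openin_sub_seq_top by blast
  show ?thesis
  proof (intro exI[of _ M] ballI impI)
    fix z y' assume "z \<in> X" "agree {-M..M} x z" and y': "y' \<in> fibre Y \<pi> z"
    then have "z \<notin> \<pi> ` (Y - U)"
      using M by blast
    then have "y' \<in> U"
      using y' by (auto simp: fibre_def)
    then show "\<exists>y\<in>fibre Y \<pi> x. agree {-K..K} y y'"
      by (simp add: U_def)
  qed
qed

definition separated :: "int \<Rightarrow> 'a point set \<Rightarrow> ('a point \<Rightarrow> 'b point) \<Rightarrow> bool" where
  "separated n Y \<pi> \<longleftrightarrow>
     (\<forall>y\<in>Y. \<forall>y'\<in>Y. \<forall>a. \<pi> y = \<pi> y' \<and> agree {a..a + n} y y' \<longrightarrow> y = y')"

lemma restrict_eq_iff_agree: "restrict y S = restrict z S \<longleftrightarrow> agree S y z"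
  by (auto simp: agree_def restrict_def fun_eq_iff)

text \<open>Preimages of periodic points are separated by \<open>no_diamond\<close>, and since all fibres have the
  same number of points, two preimages of an arbitrary point cannot collapse on a window either:
  otherwise nearby periodic points would have too few preimages.\<close>

lemma unramified_separated:
  fixes Y :: "'a point set"
  assumes un: "unramified Y X \<pi>"
  shows "\<exists>n\<ge>0. separated n Y \<pi>"
proof -
  note u = unramifiedD[OF un]
  obtain L where L: "0 \<le> L" "step L Y"
    using irreducible_step[OF u(1)] by blast
  obtain r where r: "0 \<le> r" "local_map r Y \<pi>"
    using u(5) sliding_block_code_iff[OF u(3)] by blast
  obtain d where d: "\<And>x. x \<in> X \<Longrightarrow> card (fibre Y \<pi> x) = d"
    using un by (auto simp: unramified_def)
  \<comment> \<open>Long enough for gluing in Y and for the windows that \<pi> reads.\<close>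
  define n where "n = max L (2 * r)"
  have n: "0 \<le> n" "2 * r \<le> n" "step n Y"
    using L(1) step_mono[OF L(2), of n] by (auto simp: n_def)
  have per: "y = y'"
    if y: "y \<in> fibre Y \<pi> x" "y' \<in> fibre Y \<pi> x" and ag: "agree {a..a + n} y y'"
      and x: "x \<in> X" and P: "P > 0" "translate P x = x" for x y y' a P
  proof -
    note pf = periodic_fibre[OF u(3,5) u(7)[OF x] P]
    obtain k where k: "k > 0" "translate (k * P) y = y"
      using pf[OF y(1)] by blast
    obtain k' where k': "k' > 0" "translate (k' * P) y' = y'"
      using pf[OF y(2)] by blast
    have "translate (k' * (k * P)) y = y" "translate (k * (k' * P)) y' = y'"
      using translate_periodic k(2) k'(2) by blast+
    then show ?thesis
      using no_diamond[OF n(3,1) r(2) n(2) u(7)[OF x] y ag, of "k' * (k * P)"] k(1) k'(1) P(1)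
      by (simp add: ac_simps)
  qed
  have "separated n Y \<pi>"
    unfolding separated_def
  proof (intro ballI allI impI, rule ccontr)
    fix y y' a assume y: "y \<in> Y" "y' \<in> Y" "\<pi> y = \<pi> y' \<and> agree {a..a + n} y y'" "y \<noteq> y'"
    define x where "x = \<pi> y"
    have x: "x \<in> X"
      using u(6) y(1) by (auto simp: x_def)
    define K where "K = \<bar>a\<bar> + n"
    obtain M where M: "\<forall>z\<in>X. agree {-M..M} x z \<longrightarrow>
           (\<forall>y'\<in>fibre Y \<pi> z. \<exists>y\<in>fibre Y \<pi> x. agree {-K..K} y y')"
      using fibre_upper_semicontinuous[OF u(3,5) x] by blast
    obtain z P where z: "z \<in> X" "P > 0" "translate P z = z" "agree {-M..M} x z"
      using periodic_dense[OF u(2) x] by blast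
    define W :: "'a point \<Rightarrow> 'a point" where "W = (\<lambda>y. restrict y {a..a + n})"
    have inj: "inj_on W (fibre Y \<pi> z)"
      using per[OF _ _ _ z(1,2,3)] by (auto simp: inj_on_def W_def restrict_eq_iff_agree)
    have "W ` fibre Y \<pi> z \<subseteq> W ` fibre Y \<pi> x"
    proof
      fix v assume "v \<in> W ` fibre Y \<pi> z"
      then obtain w where w: "w \<in> fibre Y \<pi> z" "v = W w"
        by blast
      then obtain w' where w': "w' \<in> fibre Y \<pi> x" "agree {-K..K} w' w"
        using M z by blast
      have "agree {a..a + n} w' w"
        using w'(2) by (rule agree_mono) (auto simp: K_def)
      then have "W w' = W w"
        by (simp add: W_def restrict_eq_iff_agree)
      then show "v \<in> W ` fibre Y \<pi> x"
        using w' w by (metis image_eqI)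
    qed
    then have "card (W ` fibre Y \<pi> z) \<le> card (W ` fibre Y \<pi> x)"
      using u(7)[OF x] by (intro card_mono) auto
    then have "d \<le> card (W ` fibre Y \<pi> x)"
      using card_image[OF inj] d[OF z(1)] by simp
    then have "inj_on W (fibre Y \<pi> x)"
      using u(7)[OF x] d[OF x] card_image_le[OF u(7)[OF x], of W] by (intro eq_card_imp_inj_on) auto
    moreover have "y \<in> fibre Y \<pi> x" "y' \<in> fibre Y \<pi> x" "W y = W y'"
      using y by (auto simp: x_def fibre_def W_def restrict_eq_iff_agree)
    ultimately show False
      using y(4) by (auto dest: inj_onD)
  qed
  with n(1) show ?thesis by blast
qed

lemma separated_mono:
  assumes "separated n Y \<pi>" "n \<le> m"
  shows "separated m Y \<pi>"
  unfolding separated_def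
proof (intro ballI allI impI)
  fix y y' a assume *: "y \<in> Y" "y' \<in> Y" "\<pi> y = \<pi> y' \<and> agree {a..a + m} y y'"
  then have "agree {a..a + n} y y'"
    using assms(2) by (auto intro: agree_mono)
  then show "y = y'"
    using assms(1) * unfolding separated_def by blast
qed

text \<open>On a window that separates the points of each fibre, closeness of z to x gives an
  inclusion between the sets of patterns of their fibres, and equal cardinality turns it into an
  equality. The set of patterns is therefore locally constant, and compactness makes the radius
  uniform.\<close>

lemma fibre_lift_uniform:
  fixes Y :: "'a point set"
  assumes un: "unramified Y X \<pi>"
  shows "\<exists>M. \<forall>x\<in>X. \<forall>z\<in>X. \<forall>a. agree {a - M..a + M} x z \<longrightarrow>
           (\<forall>y\<in>fibre Y \<pi> x. \<exists>y'\<in>fibre Y \<pi> z. agree {a - K..a + K} y y')"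
proof -
  note u = unramifiedD[OF un]
  obtain d where d: "\<And>x. x \<in> X \<Longrightarrow> card (fibre Y \<pi> x) = d"
    using un by (auto simp: unramified_def)
  obtain n where n: "0 \<le> n" "separated n Y \<pi>"
    using unramified_separated[OF un] by blast
  \<comment> \<open>The window has to contain the requested radius K and to be long enough for
    separation.\<close>
  define J where "J = max K n"
  define W :: "'a point \<Rightarrow> 'a point" where "W = (\<lambda>y. restrict y {-J..J})"
  have "separated (2 * J) Y \<pi>"
    using n(2) by (rule separated_mono) (use n(1) in \<open>auto simp: J_def\<close>)
  then have inj: "inj_on W (fibre Y \<pi> x)" for x
  proof -
    have "y = y'" if "y \<in> fibre Y \<pi> x" "y' \<in> fibre Y \<pi> x" "W y = W y'" for y y'
    proof -
      have "agree {-J..-J + 2 * J} y y'"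
        using that(3) by (simp add: W_def restrict_eq_iff_agree)
      moreover have "y \<in> Y" "y' \<in> Y" "\<pi> y = \<pi> y'"
        using that(1,2) by (auto simp: fibre_def)
      ultimately show ?thesis
        using \<open>separated (2 * J) Y \<pi>\<close> unfolding separated_def by blast
    qed
    then show ?thesis
      by (rule inj_onI)
  qed
  have cardW: "card (W ` fibre Y \<pi> x) = d" if "x \<in> X" for x
    using card_image[OF inj] d[OF that] by simp
  have "\<exists>n. \<forall>z\<in>X. agree {-n..n} x z \<longrightarrow> W ` fibre Y \<pi> z = W ` fibre Y \<pi> x" if x: "x \<in> X" for x
  proof -
    obtain M where M: "\<forall>z\<in>X. agree {-M..M} x z \<longrightarrow>
           (\<forall>y'\<in>fibre Y \<pi> z. \<exists>y\<in>fibre Y \<pi> x. agree {-J..J} y y')"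
      using fibre_upper_semicontinuous[OF u(3,5) x] by blast
    have "W ` fibre Y \<pi> z = W ` fibre Y \<pi> x" if z: "z \<in> X" "agree {-M..M} x z" for z
    proof (rule card_subset_eq)
      show "W ` fibre Y \<pi> z \<subseteq> W ` fibre Y \<pi> x"
      proof (rule image_subsetI)
        fix v assume "v \<in> fibre Y \<pi> z"
        then obtain w where "w \<in> fibre Y \<pi> x" "agree {-J..J} w v"
          using M z by blast
        then have "w \<in> fibre Y \<pi> x" "W w = W v"
          by (simp_all add: W_def restrict_eq_iff_agree)
        then show "W v \<in> W ` fibre Y \<pi> x"
          by (metis image_eqI)
      qed
    qed (use u(7) x z cardW in auto)
    then show ?thesis by blast
  qed
  then have "\<exists>M. \<forall>x\<in>X. \<forall>z\<in>X. agree {-M..M} x z \<longrightarrow> W ` fibre Y \<pi> x = W ` fibre Y \<pi> z"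
    by (rule locally_constant_imp_uniform[OF u(4)])
  then obtain M where M: "\<forall>x\<in>X. \<forall>z\<in>X. agree {-M..M} x z \<longrightarrow> W ` fibre Y \<pi> x = W ` fibre Y \<pi> z" ..
  have tr: "translate c y \<in> fibre Y \<pi> (translate c x)" if "y \<in> fibre Y \<pi> x" for c x y
    using that translate_mem[OF u(3)] sliding_block_code_translate[OF u(3,5)] by (auto simp: fibre_def)
  show ?thesis
  proof (intro exI[of _ M] ballI allI impI)
    fix x z a y assume x: "x \<in> X" and z: "z \<in> X" and ag: "agree {a - M..a + M} x z" and y: "y \<in> fibre Y \<pi> x"
    have "agree {-M..M} (translate a x) (translate a z)"
      using ag by (simp add: agree_translate add.commute)
    then have "W ` fibre Y \<pi> (translate a x) = W ` fibre Y \<pi> (translate a z)"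
      using M translate_mem[OF u(4) x] translate_mem[OF u(4) z] by simp
    then have "W (translate a y) \<in> W ` fibre Y \<pi> (translate a z)"
      using tr[OF y, of a] by (metis image_eqI)
    then obtain w where w: "w \<in> fibre Y \<pi> (translate a z)" "agree {-J..J} (translate a y) w"
      by (auto simp: W_def restrict_eq_iff_agree)
    show "\<exists>y'\<in>fibre Y \<pi> z. agree {a - K..a + K} y y'"
    proof
      show "translate (- a) w \<in> fibre Y \<pi> z"
        using tr[OF w(1), of "- a"] by simp
      have "agree {-J..J} (translate a y) (translate a (translate (- a) w))"
        using w(2) by simp
      then have "agree {-J + a..J + a} y (translate (- a) w)"
        unfolding agree_translate .
      then show "agree {a - K..a + K} y (translate (- a) w)"
        by (rule agree_mono) (auto simp: J_def)
    qed
  qed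
qed

text \<open>The sign s selects the direction, 1 for right half-lines and -1 for left ones, so that
  each argument is made once for both.\<close>

definition asymptotic :: "int \<Rightarrow> 'a point \<Rightarrow> 'a point \<Rightarrow> bool" where
  "asymptotic s x z \<longleftrightarrow> (\<exists>n. agree {i. s * i \<ge> n} x z)"

lemma asymptotic_sym: "asymptotic s x z \<Longrightarrow> asymptotic s z x"
  unfolding asymptotic_def using agree_sym by blast

lemma asymptotic_trans:
  assumes "asymptotic s x y" "asymptotic s y z"
  shows "asymptotic s x z"
proof -
  obtain n m where "agree {i. s * i \<ge> n} x y" "agree {i. s * i \<ge> m} y z"
    using assms by (auto simp: asymptotic_def)
  then have "agree {i. s * i \<ge> max n m} x z"
    by (auto simp: agree_def)
  then show ?thesis
    unfolding asymptotic_def by blast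
qed

lemma asymptotic_window:
  assumes s: "s = 1 \<or> s = - 1" and "asymptotic s x y"
  shows "\<exists>a. agree {a..a + n} x y"
proof -
  obtain m where m: "agree {i. s * i \<ge> m} x y"
    using assms(2) by (auto simp: asymptotic_def)
  show ?thesis
  proof (cases "s = 1")
    case True
    then show ?thesis
      by (intro exI[of _ m] agree_mono[OF m]) auto
  next
    case False
    then show ?thesis
      using s by (intro exI[of _ "- m - n"] agree_mono[OF m]) auto
  qed
qed

lemma separated_asymptotic:
  assumes "separated n Y \<pi>" "s = 1 \<or> s = - 1" "y \<in> Y" "y' \<in> Y" "\<pi> y = \<pi> y'" "asymptotic s y y'"
  shows "y = y'"
proof -
  obtain a where "agree {a..a + n} y y'"
    using asymptotic_window[OF assms(2,6)] by blast
  then show ?thesis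
    using assms(1,3-5) unfolding separated_def by blast
qed

lemma asymptotic_map:
  assumes f: "local_map r Y f" "r \<ge> 0" and s: "s = 1 \<or> s = - 1"
    and y: "y \<in> Y" "y' \<in> Y" "asymptotic s y y'"
  shows "asymptotic s (f y) (f y')"
proof -
  obtain m where m: "agree {i. s * i \<ge> m} y y'"
    using y(3) by (auto simp: asymptotic_def)
  have "agree {i. s * i \<ge> m + r} (f y) (f y')"
    unfolding agree_def
  proof
    fix i assume i: "i \<in> {i. s * i \<ge> m + r}"
    have "agree {i - r..i + r} y y'"
      using m by (rule agree_mono) (use i s f(2) in auto)
    then show "f y i = f y' i"
      using f(1) y(1,2) unfolding local_map_def by blast
  qed
  then show ?thesis
    unfolding asymptotic_def by blast
qed

text \<open>Wherever x and z agree on a long window around a, y has a partner \<open>w a\<close>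
  over z that agrees with it near a. Partners at neighbouring positions agree with y on a common
  window, so separation makes them equal, and the constant partner is the lift. Separation also
  gives uniqueness.\<close>

lemma asymptotic_lift:
  assumes un: "unramified Y X \<pi>" and s: "s = 1 \<or> s = - 1"
    and x: "x \<in> X" and z: "z \<in> X" and xz: "asymptotic s x z" and y: "y \<in> fibre Y \<pi> x"
  shows "\<exists>!y'. y' \<in> fibre Y \<pi> z \<and> asymptotic s y y'"
proof -
  note u = unramifiedD[OF un]
  obtain n where n: "0 \<le> n" "separated n Y \<pi>"
    using unramified_separated[OF un] by blast
  \<comment> \<open>Radius n + 1 rather than n: the windows around two consecutive positions then
    share n + 1 letters, in either direction.\<close>
  obtain M where M: "\<forall>x\<in>X. \<forall>z\<in>X. \<forall>a. agree {a - M..a + M} x z \<longrightarrow>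
           (\<forall>y\<in>fibre Y \<pi> x. \<exists>y'\<in>fibre Y \<pi> z. agree {a - (n + 1)..a + (n + 1)} y y')"
    using fibre_lift_uniform[OF un] by blast
  obtain m where m: "agree {i. s * i \<ge> m} x z"
    using xz by (auto simp: asymptotic_def)
  have "\<exists>y'. y' \<in> fibre Y \<pi> z \<and> agree {a - (n + 1)..a + (n + 1)} y y'" if "s * a \<ge> m + M" for a
  proof -
    have "agree {a - M..a + M} x z"
      using m by (rule agree_mono) (use that s in auto)
    then show ?thesis
      using M x z y by blast
  qed
  then obtain w where w: "\<And>a. s * a \<ge> m + M \<Longrightarrow> w a \<in> fibre Y \<pi> z"
      "\<And>a. s * a \<ge> m + M \<Longrightarrow> agree {a - (n + 1)..a + (n + 1)} y (w a)"
    by metis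
  have ss: "s * s = 1"
    using s by auto
  \<comment> \<open>The position at which the half-line begins: since s is its own inverse, s * c =
    m + M.\<close>
  define c where "c = s * (m + M)"
  have c: "s * (c + s * int k) = m + M + int k" for k
    using ss by (simp add: c_def distrib_left flip: mult.assoc)
  have step: "w (c + s * int (Suc k)) = w (c + s * int k)" for k
  proof -
    let ?a = "c + s * int k" and ?b = "c + s * int (Suc k)"
    have ab: "s * ?a \<ge> m + M" "s * ?b \<ge> m + M"
      unfolding c by auto
    have "agree {?a..?a + n} y (w ?b)"
      using w(2)[OF ab(2)] by (rule agree_mono) (use s in \<open>auto simp: algebra_simps\<close>)
    moreover have "agree {?a..?a + n} y (w ?a)"
      using w(2)[OF ab(1)] by (rule agree_mono) (use n in auto)
    ultimately have "agree {?a..?a + n} (w ?b) (w ?a)"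
      using agree_sym agree_trans by blast
    then show ?thesis
      using n(2) w(1)[OF ab(1)] w(1)[OF ab(2)] unfolding separated_def fibre_def by auto
  qed
  have const: "w (c + s * int k) = w c" for k
  proof (induction k)
    case (Suc k)
    then show ?case
      using step[of k] by metis
  qed simp
  have w0: "w c \<in> fibre Y \<pi> z"
    using w(1)[of c] c[of 0] by simp
  have "agree {i. s * i \<ge> m + M} y (w c)"
    unfolding agree_def
  proof
    fix i assume i: "i \<in> {i. s * i \<ge> m + M}"
    define k where "k = nat (s * i - (m + M))"
    have "c + s * int k = s * (s * i)"
      using i by (simp add: k_def c_def algebra_simps)
    also have "\<dots> = i"
      using ss by (simp flip: mult.assoc)
    finally have ik: "c + s * int k = i" .
    have "agree {i - (n + 1)..i + (n + 1)} y (w i)"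
      using w(2) i by simp
    then have "y i = w i i"
      using n(1) by (auto intro: agreeD)
    then show "y i = w c i"
      using const[of k] ik by simp
  qed
  then have "asymptotic s y (w c)"
    by (auto simp: asymptotic_def)
  moreover have "y1 = y2" if "y1 \<in> fibre Y \<pi> z \<and> asymptotic s y y1" "y2 \<in> fibre Y \<pi> z \<and> asymptotic s y y2" for y1 y2
    using separated_asymptotic[OF n(2) s, of y1 y2] that asymptotic_sym asymptotic_trans by (fastforce simp: fibre_def)
  ultimately show ?thesis
    using w0 by blast
qed

text \<open>The connecting point has the left end of x and the right end of a translate of x', so
  two half-lines always suffice.\<close>

lemma irreducible_zigzag:
  assumes "irreducible_sft X" "x \<in> X" "x' \<in> X"
  shows "\<exists>z\<in>X. \<exists>k. asymptotic (- 1) x z \<and> asymptotic 1 z (translate k x')"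
proof -
  obtain z l where z: "z \<in> X" "\<forall>i\<le>0. z i = x i" "\<forall>i\<ge>0. z (i + l) = x' i"
    using irreducible_reach[OF assms, of 0 0] unfolding reach_def by blast
  have "agree {i. - 1 * i \<ge> 0} x z"
    using z(2) by (auto simp: agree_def)
  moreover have "agree {i. 1 * i \<ge> l} z (translate (- l) x')"
    unfolding agree_def
  proof
    fix i assume "i \<in> {i. 1 * i \<ge> l}"
    then show "z i = translate (- l) x' i"
      using z(3)[rule_format, of "i - l"] by (simp add: translate_def)
  qed
  ultimately show ?thesis
    using z(1) unfolding asymptotic_def by blast
qed

text \<open>Where f and g agree at a point, their values at an asymptotic point are asymptotic and
  lie in one fibre, hence coincide. A zigzag of two half-lines reaches a translate of every point,
  and both maps commute with translation.\<close>

lemma unique_lift: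
  assumes Y: "irreducible_sft Y" and un: "unramified Z X \<pi>"
    and f: "sliding_block_code Y Z f" and g: "sliding_block_code Y Z g"
    and fg: "\<And>y. y \<in> Y \<Longrightarrow> \<pi> (f y) = \<pi> (g y)"
    and y0: "y0 \<in> Y" "f y0 = g y0" and y: "y \<in> Y"
  shows "f y = g y"
proof -
  note sY = irreducible_subshift[OF Y]
  obtain n where n: "separated n Z \<pi>"
    using unramified_separated[OF un] by blast
  obtain r where r: "r \<ge> 0" "local_map r Y f"
    using f sliding_block_code_iff[OF sY] by blast
  obtain q where q: "q \<ge> 0" "local_map q Y g"
    using g sliding_block_code_iff[OF sY] by blast
  have transport: "f b = g b" if "a \<in> Y" "b \<in> Y" "f a = g a" "asymptotic s a b" "s = 1 \<or> s = - 1" for a b s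
  proof (rule separated_asymptotic[OF n that(5)])
    have "asymptotic s (f a) (f b)" "asymptotic s (g a) (g b)"
      using asymptotic_map[OF r(2,1) that(5,1,2,4)] asymptotic_map[OF q(2,1) that(5,1,2,4)] by auto
    then show "asymptotic s (f b) (g b)"
      using that(3) asymptotic_sym asymptotic_trans by metis
  qed (use that f g fg sliding_block_code_mem in auto)
  obtain z k where z: "z \<in> Y" "asymptotic (- 1) y0 z" "asymptotic 1 z (translate k y)"
    using irreducible_zigzag[OF Y y0(1) y] by blast
  have "f z = g z"
    using transport[OF y0(1) z(1) y0(2) z(2)] by simp
  then have "f (translate k y) = g (translate k y)"
    using transport[OF z(1) translate_mem[OF sY y] _ z(3)] by simp
  then have "translate k (f y) = translate k (g y)"
    using sliding_block_code_translate[OF sY f y] sliding_block_code_translate[OF sY g y] by simp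
  then have "translate (- k) (translate k (f y)) = translate (- k) (translate k (g y))"
    by simp
  then show ?thesis
    by simp
qed

section \<open>Topological conjugacies\<close>

abbreviation (input) conj_inv :: "'a point set \<Rightarrow> 'b point set \<Rightarrow> ('a point \<Rightarrow> 'b point) \<Rightarrow> 'b point \<Rightarrow> 'a point"
  where "conj_inv X Y f \<equiv> (\<lambda>y\<in>Y. inv_into X f y)"

lemma sliding_block_code_compose:
  assumes X: "subshift X" and f: "sliding_block_code X Y f" and g: "sliding_block_code Y Z g"
  shows "sliding_block_code X Z (compose X g f)"
  unfolding sliding_block_code_def
proof (intro conjI ballI)
  have "continuous_map (subtopology seq_top X) (subtopology seq_top Z) (g \<circ> f)"
    using f g unfolding sliding_block_code_def by (blast intro: continuous_map_compose)
  then show "continuous_map (subtopology seq_top X) (subtopology seq_top Z) (compose X g f)"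
    by (rule continuous_map_eq) (simp add: compose_def)
  fix x assume x: "x \<in> X"
  then have "shift x \<in> X"
    using translate_mem[OF X x, of 1] by (simp add: shift_eq_translate)
  then show "compose X g f (shift x) = shift (compose X g f x)"
    using x f g sliding_block_code_mem[OF f x] by (simp add: compose_def sliding_block_code_def)
qed (simp add: compose_extensional)

lemma conjugacyD:
  assumes "topological_conjugacy X Y f"
  shows "sliding_block_code X Y f" "bij_betw f X Y" "f \<in> extensional X" "f ` X = Y" "inj_on f X"
    "\<And>x. x \<in> X \<Longrightarrow> f x \<in> Y"
proof -
  show sbc: "sliding_block_code X Y f" and bij: "bij_betw f X Y"
    using assms by (simp_all add: topological_conjugacy_def)
  show "f \<in> extensional X"
    using sbc by (simp add: sliding_block_code_def)
  show "f ` X = Y" "inj_on f X"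
    using bij by (simp_all add: bij_betw_def)
  show "f x \<in> Y" if "x \<in> X" for x
    using bij that by (rule bij_betwE[rule_format])
qed

lemma conjugacy_compose:
  assumes "subshift X" "topological_conjugacy X Y f" "topological_conjugacy Y Z g"
  shows "topological_conjugacy X Z (compose X g f)"
proof -
  have "bij_betw (g \<circ> f) X Z"
    by (rule bij_betw_trans[OF conjugacyD(2)[OF assms(2)] conjugacyD(2)[OF assms(3)]])
  then have "bij_betw (compose X g f) X Z"
    by (simp add: compose_def cong: bij_betw_cong)
  then show ?thesis
    using sliding_block_code_compose[OF assms(1)] conjugacyD(1) assms(2,3)
    by (auto simp: topological_conjugacy_def)
qed

lemma conjugacy_id:
  assumes "subshift X"
  shows "topological_conjugacy X X (\<lambda>x\<in>X. x)"
proof -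
  have "continuous_map (subtopology seq_top X) (subtopology seq_top X) (\<lambda>x\<in>X. x)"
    by (rule continuous_map_eq[OF continuous_map_id]) simp
  moreover have "shift x \<in> X" if "x \<in> X" for x
    using translate_mem[OF assms that, of 1] by (simp add: shift_eq_translate)
  ultimately show ?thesis
    by (auto simp: topological_conjugacy_def sliding_block_code_def bij_betw_def inj_on_def)
qed

lemma conj_inv_apply:
  assumes "topological_conjugacy X Y f"
  shows "x \<in> X \<Longrightarrow> inv_into X f (f x) = x" "y \<in> Y \<Longrightarrow> f (inv_into X f y) = y"
    "y \<in> Y \<Longrightarrow> inv_into X f y \<in> X"
  using conjugacyD[OF assms] by (simp_all add: bij_betw_inv_into_left bij_betw_inv_into_right inv_into_into)

text \<open>A continuous bijection from a compact space to a Hausdorff space is a homeomorphism, so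
  continuity of the inverse is automatic.\<close>

lemma conjugacy_inv:
  assumes X: "subshift X" and Y: "subshift Y" and f: "topological_conjugacy X Y f"
  shows "topological_conjugacy Y X (conj_inv X Y f)"
proof -
  note fD = conjugacyD[OF f] and inv = conj_inv_apply[OF f]
  have "homeomorphic_map (subtopology seq_top X) (subtopology seq_top Y) f"
    using fD Hausdorff_seq_top compact_space_subshift[OF X]
    by (intro continuous_imp_homeomorphic_map Hausdorff_space_subtopology) (auto simp: sliding_block_code_def)
  then obtain g where g: "homeomorphic_maps (subtopology seq_top X) (subtopology seq_top Y) f g"
    using homeomorphic_map_maps by blast
  then have "continuous_map (subtopology seq_top Y) (subtopology seq_top X) g"
    and "\<And>x. x \<in> X \<Longrightarrow> g (f x) = x"
    by (auto simp: homeomorphic_maps_def)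
  then have "continuous_map (subtopology seq_top Y) (subtopology seq_top X) (conj_inv X Y f)"
    using inv by (elim continuous_map_eq) (simp, metis)
  moreover have "conj_inv X Y f (shift y) = shift (conj_inv X Y f y)" if y: "y \<in> Y" for y
  proof -
    have sh: "shift y \<in> Y" "shift (inv_into X f y) \<in> X"
      using translate_mem[OF Y y, of 1] translate_mem[OF X inv(3)[OF y], of 1] by (auto simp: shift_eq_translate)
    have "f (shift (inv_into X f y)) = shift (f (inv_into X f y))"
      using fD(1) inv(3)[OF y] by (simp add: sliding_block_code_def)
    then have "f (shift (inv_into X f y)) = shift y"
      using inv(2)[OF y] by simp
    then have "inv_into X f (shift y) = shift (inv_into X f y)"
      using inv(1)[OF sh(2)] by simp
    then show ?thesis
      using sh y by simp
  qed
  moreover have "bij_betw (conj_inv X Y f) Y X"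
    using bij_betw_inv_into[OF fD(2)] by (simp cong: bij_betw_cong)
  ultimately show ?thesis
    by (simp add: topological_conjugacy_def sliding_block_code_def)
qed

lemma shift_aut_simps [simp]:
  "f \<in> carrier (shift_aut X) \<longleftrightarrow> topological_conjugacy X X f"
  "\<one>\<^bsub>shift_aut X\<^esub> = (\<lambda>x\<in>X. x)"
  by (simp_all add: shift_aut_def BijGroup_def)

lemma conjugacy_Bij: "topological_conjugacy X X f \<Longrightarrow> f \<in> Bij X"
  by (simp add: Bij_def conjugacyD)

lemma shift_aut_mult:
  "topological_conjugacy X X f \<Longrightarrow> topological_conjugacy X X g \<Longrightarrow> f \<otimes>\<^bsub>shift_aut X\<^esub> g = compose X f g"
  by (simp add: shift_aut_def BijGroup_def conjugacy_Bij)

lemma compose_conj_inv: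
  assumes "topological_conjugacy X Y f"
  shows "compose X (conj_inv X Y f) f = (\<lambda>x\<in>X. x)" "compose Y f (conj_inv X Y f) = (\<lambda>y\<in>Y. y)"
  using conj_inv_apply[OF assms] conjugacyD(6)[OF assms]
  by (simp_all add: compose_def cong: restrict_cong)

lemma shift_aut_group:
  assumes X: "subshift X"
  shows "group (shift_aut X)"
proof (rule groupI)
  fix f g h
  assume f: "f \<in> carrier (shift_aut X)" and g: "g \<in> carrier (shift_aut X)"
  then show "f \<otimes>\<^bsub>shift_aut X\<^esub> g \<in> carrier (shift_aut X)"
    using conjugacy_compose[OF X, of X g X f] by (simp add: shift_aut_mult)
  assume h: "h \<in> carrier (shift_aut X)"
  have m: "f \<in> X \<rightarrow> X" "g \<in> X \<rightarrow> X" "h \<in> X \<rightarrow> X"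
    using f g h conjugacyD(6) by (auto simp: Pi_def)
  show "f \<otimes>\<^bsub>shift_aut X\<^esub> g \<otimes>\<^bsub>shift_aut X\<^esub> h = f \<otimes>\<^bsub>shift_aut X\<^esub> (g \<otimes>\<^bsub>shift_aut X\<^esub> h)"
    using f g h conjugacy_compose[OF X, of X g X f] conjugacy_compose[OF X, of X h X g]
    by (simp add: shift_aut_mult compose_assoc[OF m(3)])
next
  fix f assume f: "f \<in> carrier (shift_aut X)"
  then have fm: "f \<in> X \<rightarrow> X" "f \<in> extensional X"
    using conjugacyD by (auto simp: Pi_def)
  show "\<one>\<^bsub>shift_aut X\<^esub> \<otimes>\<^bsub>shift_aut X\<^esub> f = f"
    using f Id_compose[OF fm] by (simp add: shift_aut_mult conjugacy_id[OF X])
  show "\<exists>g\<in>carrier (shift_aut X). g \<otimes>\<^bsub>shift_aut X\<^esub> f = \<one>\<^bsub>shift_aut X\<^esub>"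
    using f conjugacy_inv[OF X X] compose_conj_inv(1)
    by (intro bexI[of _ "conj_inv X X f"]) (simp_all add: shift_aut_mult)
qed (simp add: conjugacy_id[OF X])

section \<open>Galois factors\<close>

lemma rel_aut_iff:
  "\<phi> \<in> carrier (rel_aut Y \<pi>) \<longleftrightarrow> topological_conjugacy Y Y \<phi> \<and> (\<forall>y\<in>Y. \<pi> (\<phi> y) = \<pi> y)"
  by (simp add: rel_aut_def)

lemma rel_aut_mult:
  "\<phi> \<in> carrier (rel_aut Y \<pi>) \<Longrightarrow> \<psi> \<in> carrier (rel_aut Y \<pi>) \<Longrightarrow> \<phi> \<otimes>\<^bsub>rel_aut Y \<pi>\<^esub> \<psi> = compose Y \<phi> \<psi>"
  using shift_aut_mult by (fastforce simp: rel_aut_def)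

lemma factor_degree:
  assumes "unramified Y X \<pi>" "X \<noteq> {}"
  shows "x \<in> X \<Longrightarrow> card (fibre Y \<pi> x) = factor_degree Y X \<pi>"
proof -
  obtain d where d: "\<forall>x\<in>X. card (fibre Y \<pi> x) = d"
    using assms by (auto simp: unramified_def)
  then have "factor_degree Y X \<pi> = d"
    unfolding factor_degree_def using assms(2) by (intro the_equality) auto
  then show "x \<in> X \<Longrightarrow> card (fibre Y \<pi> x) = factor_degree Y X \<pi>"
    using d by simp
qed

text \<open>Both automorphisms are lifts of \<pi> through \<pi> itself, so uniqueness of lifts
  applies.\<close>

lemma rel_aut_eqI:
  assumes un: "unramified Y X \<pi>" and "\<phi> \<in> carrier (rel_aut Y \<pi>)" "\<psi> \<in> carrier (rel_aut Y \<pi>)"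
    and y: "y \<in> Y" "\<phi> y = \<psi> y"
  shows "\<phi> = \<psi>"
proof (rule extensionalityI)
  note u = unramifiedD[OF un]
  have \<phi>: "topological_conjugacy Y Y \<phi>" and \<psi>: "topological_conjugacy Y Y \<psi>"
    and o: "\<And>z. z \<in> Y \<Longrightarrow> \<pi> (\<phi> z) = \<pi> (\<psi> z)"
    using assms by (auto simp: rel_aut_iff)
  show "\<phi> \<in> extensional Y" "\<psi> \<in> extensional Y"
    using \<phi> \<psi> by (auto dest: conjugacyD)
  show "\<phi> z = \<psi> z" if "z \<in> Y" for z
    by (rule unique_lift[OF u(1) un conjugacyD(1)[OF \<phi>] conjugacyD(1)[OF \<psi>] o y that])
qed

text \<open>Evaluation at y maps the group injectively into the fibre that contains y, and the
  Galois condition gives both the same finite cardinality.\<close>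

lemma galois_torsor:
  assumes gal: "galois_factor Y X \<pi>" and y: "y \<in> Y" "y' \<in> Y" "\<pi> y = \<pi> y'"
  shows "\<exists>!\<phi>. \<phi> \<in> carrier (rel_aut Y \<pi>) \<and> \<phi> y = y'"
proof -
  have un: "unramified Y X \<pi>"
    using gal by (simp add: galois_factor_def)
  note u = unramifiedD[OF un]
  define x where "x = \<pi> y"
  have x: "x \<in> X"
    using u(6) y by (auto simp: x_def)
  let ?G = "carrier (rel_aut Y \<pi>)"
  have inj: "inj_on (\<lambda>\<phi>. \<phi> y) ?G"
    using rel_aut_eqI[OF un] y(1) by (auto simp: inj_on_def)
  have sub: "(\<lambda>\<phi>. \<phi> y) ` ?G \<subseteq> fibre Y \<pi> x"
    using y(1) by (auto simp: rel_aut_iff fibre_def x_def dest: conjugacyD)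
  have "card ?G = card (fibre Y \<pi> x)"
    using gal factor_degree[OF un, of x] x by (force simp: galois_factor_def)
  then have "(\<lambda>\<phi>. \<phi> y) ` ?G = fibre Y \<pi> x"
    using card_image[OF inj] sub u(7)[OF x] by (intro card_subset_eq) auto
  moreover have "y' \<in> fibre Y \<pi> x"
    using y by (simp add: fibre_def x_def)
  ultimately have "y' \<in> (\<lambda>\<phi>. \<phi> y) ` ?G"
    by simp
  then obtain \<phi> where \<phi>: "\<phi> \<in> ?G" "\<phi> y = y'"
    by (elim imageE) simp
  show ?thesis
  proof (rule ex1I[of _ \<phi>])
    show "\<phi> \<in> ?G \<and> \<phi> y = y'"
      using \<phi> by simp
    show "\<psi> = \<phi>" if "\<psi> \<in> ?G \<and> \<psi> y = y'" for \<psi>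
      using rel_aut_eqI[OF un _ \<phi>(1) y(1)] that \<phi>(2) by simp
  qed
qed

lemma unramified_compose_right:
  assumes un: "unramified Y X \<pi>" and Y': "irreducible_sft Y'" and \<psi>: "topological_conjugacy Y' Y \<psi>"
  shows "unramified Y' X (compose Y' \<pi> \<psi>)"
proof -
  note u = unramifiedD[OF un] and pD = conjugacyD[OF \<psi>]
  have "card (fibre Y' (compose Y' \<pi> \<psi>) x) = card (fibre Y \<pi> x)" for x
  proof (rule bij_betw_same_card)
    show "bij_betw \<psi> (fibre Y' (compose Y' \<pi> \<psi>) x) (fibre Y \<pi> x)"
      using pD by (auto simp: bij_betw_def fibre_def compose_def inj_on_def image_def)
  qed
  moreover have "sliding_block_code Y' X (compose Y' \<pi> \<psi>)"
    using sliding_block_code_compose[OF irreducible_subshift[OF Y'] pD(1) u(5)] .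
  moreover have "compose Y' \<pi> \<psi> ` Y' = X"
    using surj_compose[OF pD(4) u(6)] .
  ultimately show ?thesis
    using un Y' by (auto simp: unramified_def factor_map_def)
qed

lemma unramified_compose_left:
  assumes un: "unramified Y X \<pi>" and X': "irreducible_sft X'" and \<phi>: "topological_conjugacy X X' \<phi>"
  shows "unramified Y X' (compose Y \<phi> \<pi>)"
proof -
  note u = unramifiedD[OF un] and pD = conjugacyD[OF \<phi>] and inv = conj_inv_apply[OF \<phi>]
  have "fibre Y (compose Y \<phi> \<pi>) x' = fibre Y \<pi> (inv_into X \<phi> x')" if "x' \<in> X'" for x'
    using inv that u(6) by (auto simp: fibre_def compose_def)
  moreover have "sliding_block_code Y X' (compose Y \<phi> \<pi>)"
    using sliding_block_code_compose[OF u(3,5) pD(1)] .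
  moreover have "compose Y \<phi> \<pi> ` Y = X'"
    using surj_compose[OF u(6) pD(4)] .
  moreover obtain d where "d \<ge> 1" "\<forall>x\<in>X. card (fibre Y \<pi> x) = d"
    using un by (auto simp: unramified_def)
  ultimately show ?thesis
    using un X' inv(3) by (auto simp: unramified_def factor_map_def)
qed

text \<open>Composing with a bijection only relabels the fibres and leaves the deck transformations
  unchanged. With an automorphism of X or its inverse, this produces the twisted factors.\<close>

lemma galois_factor_compose_left:
  assumes gal: "galois_factor Y X \<pi>" and X': "irreducible_sft X'" and \<phi>: "topological_conjugacy X X' \<phi>" and ne: "X \<noteq> {}"
  shows "galois_factor Y X' (compose Y \<phi> \<pi>)"
proof -
  have un: "unramified Y X \<pi>"
    using gal by (simp add: galois_factor_def)
  note u = unramifiedD[OF un] and pD = conjugacyD[OF \<phi>] and inv = conj_inv_apply[OF \<phi>]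
  have un': "unramified Y X' (compose Y \<phi> \<pi>)"
    using unramified_compose_left[OF un X' \<phi>] .
  have "carrier (rel_aut Y (compose Y \<phi> \<pi>)) = carrier (rel_aut Y \<pi>)"
  proof -
    have "\<phi> (\<pi> (\<psi> y)) = \<phi> (\<pi> y) \<longleftrightarrow> \<pi> (\<psi> y) = \<pi> y" if "topological_conjugacy Y Y \<psi>" "y \<in> Y" for \<psi> y
    proof -
      have "\<pi> (\<psi> y) \<in> X" "\<pi> y \<in> X"
        using u(6) that(2) conjugacyD(6)[OF that] by blast+
      then show ?thesis
        using inj_onD[OF pD(5)] by auto
    qed
    then show ?thesis
      by (auto simp: rel_aut_iff compose_def conjugacyD(6))
  qed
  moreover have "factor_degree Y X' (compose Y \<phi> \<pi>) = factor_degree Y X \<pi>"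
  proof -
    obtain x where x: "x \<in> X"
      using ne by blast
    have "\<phi> (\<pi> y) = \<phi> x \<longleftrightarrow> \<pi> y = x" if "y \<in> Y" for y
      using inj_onD[OF pD(5)] x u(6) that by blast
    then have "fibre Y (compose Y \<phi> \<pi>) (\<phi> x) = fibre Y \<pi> x"
      by (auto simp: fibre_def compose_def)
    then show ?thesis
      using factor_degree[OF un ne x] factor_degree[OF un', of "\<phi> x"] pD(6)[OF x] by force
  qed
  ultimately show ?thesis
    using gal un' by (simp add: galois_factor_def)
qed

text \<open>The map u is arbitrary because \<theta> may lie over the identity of X, over an
  automorphism of X or over its inverse.\<close>

lemma rel_aut_conjugate:
  assumes Z: "subshift Z" and Y: "subshift Y" and \<theta>: "topological_conjugacy Z Y \<theta>"
    and over: "\<And>z. z \<in> Z \<Longrightarrow> \<pi> (\<theta> z) = u (\<rho> z)" and \<phi>: "\<phi> \<in> carrier (rel_aut Z \<rho>)"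
  shows "(\<lambda>y\<in>Y. \<theta> (\<phi> (inv_into Z \<theta> y))) \<in> carrier (rel_aut Y \<pi>)"
proof -
  note inv = conj_inv_apply[OF \<theta>]
  have \<phi>c: "topological_conjugacy Z Z \<phi>" and \<phi>q: "\<And>z. z \<in> Z \<Longrightarrow> \<rho> (\<phi> z) = \<rho> z"
    using \<phi> by (simp_all add: rel_aut_iff)
  have "topological_conjugacy Y Y (compose Y \<theta> (compose Y \<phi> (conj_inv Z Y \<theta>)))"
    using conjugacy_compose[OF Y conjugacy_compose[OF Y conjugacy_inv[OF Z Y \<theta>] \<phi>c] \<theta>] .
  moreover have "compose Y \<theta> (compose Y \<phi> (conj_inv Z Y \<theta>)) = (\<lambda>y\<in>Y. \<theta> (\<phi> (inv_into Z \<theta> y)))"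
    by (simp add: compose_def cong: restrict_cong)
  moreover have "\<pi> (\<theta> (\<phi> (inv_into Z \<theta> y))) = \<pi> y" if y: "y \<in> Y" for y
  proof -
    have "\<pi> (\<theta> (\<phi> (inv_into Z \<theta> y))) = u (\<rho> (inv_into Z \<theta> y))"
      using over conjugacyD(6)[OF \<phi>c] \<phi>q inv(3)[OF y] by simp
    also have "\<dots> = \<pi> (\<theta> (inv_into Z \<theta> y))"
      using over[OF inv(3)[OF y]] by simp
    finally show ?thesis
      using inv(2)[OF y] by simp
  qed
  ultimately show ?thesis
    by (simp add: rel_aut_iff)
qed

section \<open>Pointed Galois factors\<close>

lemma pgfD:
  assumes "P \<in> pointed_galois_factors X x0"
  shows "galois_factor (total_space P) X (projection P)" "basept P \<in> total_space P"
    "projection P (basept P) = x0" "unramified (total_space P) X (projection P)"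
    "irreducible_sft (total_space P)" "subshift (total_space P)"
proof -
  show *: "galois_factor (total_space P) X (projection P)" "basept P \<in> total_space P"
    "projection P (basept P) = x0"
    using assms by (simp_all add: pointed_galois_factors_def)
  then show un: "unramified (total_space P) X (projection P)"
    by (simp add: galois_factor_def)
  show "irreducible_sft (total_space P)" "subshift (total_space P)"
    using unramifiedD(1,3)[OF un] .
qed

lemma pointed_conjugacyD:
  assumes "pointed_conjugacy P Q \<gamma>"
  shows "topological_conjugacy (total_space P) (total_space Q) \<gamma>" "\<gamma> (basept P) = basept Q"
    "\<And>y. y \<in> total_space P \<Longrightarrow> projection Q (\<gamma> y) = projection P y"
  using assms by (simp_all add: pointed_conjugacy_def)

lemma pointed_conjugacy_refl:
  assumes "P \<in> pointed_galois_factors X x0"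
  shows "pointed_conjugacy P P (\<lambda>y\<in>total_space P. y)"
  using conjugacy_id[OF pgfD(6)[OF assms]] pgfD(2)[OF assms] by (simp add: pointed_conjugacy_def)

lemma pointed_conjugacy_sym:
  assumes P: "P \<in> pointed_galois_factors X x0" and Q: "Q \<in> pointed_galois_factors X x0"
    and \<gamma>: "pointed_conjugacy P Q \<gamma>"
  shows "pointed_conjugacy Q P (conj_inv (total_space P) (total_space Q) \<gamma>)"
proof -
  note g = pointed_conjugacyD[OF \<gamma>]
  note inv = conj_inv_apply[OF g(1)]
  have "projection Q z = projection P (inv_into (total_space P) \<gamma> z)" if "z \<in> total_space Q" for z
    using g(3)[OF inv(3)[OF that]] inv(2)[OF that] by simp
  moreover have "inv_into (total_space P) \<gamma> (basept Q) = basept P"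
    using inv(1)[OF pgfD(2)[OF P]] g(2) by simp
  ultimately show ?thesis
    using conjugacy_inv[OF pgfD(6)[OF P] pgfD(6)[OF Q] g(1)] pgfD(2)[OF Q]
    by (simp add: pointed_conjugacy_def)
qed

lemma pointed_conjugacy_trans:
  assumes P: "P \<in> pointed_galois_factors X x0"
    and \<gamma>: "pointed_conjugacy P Q \<gamma>" and \<delta>: "pointed_conjugacy Q S \<delta>"
  shows "pointed_conjugacy P S (compose (total_space P) \<delta> \<gamma>)"
proof -
  note g = pointed_conjugacyD[OF \<gamma>] and d = pointed_conjugacyD[OF \<delta>]
  show ?thesis
    using conjugacy_compose[OF pgfD(6)[OF P] g(1) d(1)] g(2,3) d(2,3) pgfD(2)[OF P] conjugacyD(6)[OF g(1)]
    by (simp add: pointed_conjugacy_def compose_def)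
qed

lemma equiv_pgf: "equiv (pointed_galois_factors X x0) (pgf_equiv X x0)"
proof (rule equivI)
  show "pgf_equiv X x0 \<subseteq> pointed_galois_factors X x0 \<times> pointed_galois_factors X x0"
    by (auto simp: pgf_equiv_def)
  show "refl_on (pointed_galois_factors X x0) (pgf_equiv X x0)"
    using pointed_conjugacy_refl by (fastforce simp: refl_on_def pgf_equiv_def)
  show "sym (pgf_equiv X x0)"
    using pointed_conjugacy_sym by (fastforce intro!: symI simp: pgf_equiv_def)
  show "trans (pgf_equiv X x0)"
    using pointed_conjugacy_trans by (fastforce intro!: transI simp: pgf_equiv_def)
qed

text \<open>Both are lifts of the projection of P through that of Q, and the base points make them
  agree at one point.\<close>

lemma pointed_conjugacy_unique:
  assumes P: "P \<in> pointed_galois_factors X x0" and Q: "Q \<in> pointed_galois_factors X x0"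
    and g: "pointed_conjugacy P Q \<gamma>" and d: "pointed_conjugacy P Q \<delta>"
  shows "\<gamma> = \<delta>"
proof (rule extensionalityI)
  note g = pointed_conjugacyD[OF g] and d = pointed_conjugacyD[OF d]
  show "\<gamma> \<in> extensional (total_space P)" "\<delta> \<in> extensional (total_space P)"
    using conjugacyD(3)[OF g(1)] conjugacyD(3)[OF d(1)] .
  show "\<gamma> y = \<delta> y" if "y \<in> total_space P" for y
    by (rule unique_lift[OF pgfD(5)[OF P] pgfD(4)[OF Q] conjugacyD(1)[OF g(1)] conjugacyD(1)[OF d(1)] _ pgfD(2)[OF P] _ that])
      (simp_all add: g d)
qed

section \<open>The absolute Galois group\<close>

locale absolute_galois =
  fixes X :: "'a point set" and x0 :: "'a point" and R :: "'a reps"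
  assumes irr: "irreducible_sft X" and x0: "x0 \<in> X"
    and reps: "\<And>i. i \<in> galois_classes X x0 \<Longrightarrow> R i \<in> i"
begin

abbreviation "I \<equiv> galois_classes X x0"
abbreviation "Y i \<equiv> total_space (R i)"
abbreviation "b i \<equiv> basept (R i)"
abbreviation "q i \<equiv> projection (R i)"
abbreviation "G \<equiv> abs_gal X x0 R"
abbreviation "\<alpha> \<equiv> connecting R"
abbreviation "F \<equiv> profinite_fibre X x0 R"
abbreviation "cls P \<equiv> pgf_equiv X x0 `` {P}"

lemma sub: "subshift X"
  using irr by (rule irreducible_subshift)

lemma rep_pgf: "i \<in> I \<Longrightarrow> R i \<in> pointed_galois_factors X x0"
  using subsetD[OF in_quotient_imp_subset[OF equiv_pgf] reps] by (simp add: galois_classes_def)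

lemmas rep = pgfD[OF rep_pgf]

lemma cls_mem: "P \<in> pointed_galois_factors X x0 \<Longrightarrow> cls P \<in> I"
  by (simp add: galois_classes_def quotientI)

lemma cls_rep:
  assumes i: "i \<in> I"
  shows "cls (R i) = i"
proof -
  obtain P where P: "i = cls P"
    using i unfolding galois_classes_def by (rule quotientE)
  then have "(P, R i) \<in> pgf_equiv X x0"
    using reps[OF i] by simp
  then show ?thesis
    unfolding P using equiv_class_eq[OF equiv_pgf] by metis
qed

text \<open>This justifies the description operator in \<open>gal_component\<close>.\<close>

lemma rep_conjugacy:
  assumes "P \<in> pointed_galois_factors X x0"
  shows "\<exists>!\<theta>. pointed_conjugacy (R (cls P)) P \<theta>"
proof -
  have "R (cls P) \<in> cls P"
    using reps cls_mem[OF assms] .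
  then have "(P, R (cls P)) \<in> pgf_equiv X x0"
    by simp
  then have "(R (cls P), P) \<in> pgf_equiv X x0"
    using equiv_pgf[of X x0] by (meson equivE symE)
  then obtain \<theta> where "pointed_conjugacy (R (cls P)) P \<theta>"
    by (auto simp: pgf_equiv_def)
  then show ?thesis
    using pointed_conjugacy_unique[OF rep_pgf[OF cls_mem[OF assms]] assms] by blast
qed

lemma pointed_conjugacy_imp_eq:
  assumes "i \<in> I" "j \<in> I" "pointed_conjugacy (R i) (R j) \<gamma>"
  shows "i = j"
proof -
  have "(R i, R j) \<in> pgf_equiv X x0"
    using assms rep_pgf by (auto simp: pgf_equiv_def)
  then have "cls (R i) = cls (R j)"
    using equiv_pgf equiv_class_eq by metis
  then show ?thesis
    using cls_rep assms by simp
qed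

lemma gal_iff:
  "\<phi> \<in> carrier (gal (R i)) \<longleftrightarrow> topological_conjugacy (Y i) (Y i) \<phi> \<and> (\<forall>y\<in>Y i. q i (\<phi> y) = q i y)"
  by (simp add: gal_def rel_aut_iff)

lemma gal_mem: "\<phi> \<in> carrier (gal (R i)) \<Longrightarrow> y \<in> Y i \<Longrightarrow> \<phi> y \<in> Y i"
  unfolding gal_iff by (blast intro: conjugacyD(6))

lemma gal_proj: "\<phi> \<in> carrier (gal (R i)) \<Longrightarrow> y \<in> Y i \<Longrightarrow> q i (\<phi> y) = q i y"
  by (auto simp: gal_iff)

lemma gal_mult:
  "\<phi> \<in> carrier (gal (R i)) \<Longrightarrow> \<psi> \<in> carrier (gal (R i)) \<Longrightarrow> \<phi> \<otimes>\<^bsub>gal (R i)\<^esub> \<psi> = compose (Y i) \<phi> \<psi>"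
  unfolding gal_def by (rule rel_aut_mult)

lemma gal_translate:
  "i \<in> I \<Longrightarrow> \<phi> \<in> carrier (gal (R i)) \<Longrightarrow> y \<in> Y i \<Longrightarrow> \<phi> (translate k y) = translate k (\<phi> y)"
  by (rule sliding_block_code_translate[where Y = "Y i", OF rep(6) conjugacyD(1)]) (simp_all add: gal_iff)

lemma gal_eqI:
  "i \<in> I \<Longrightarrow> \<phi> \<in> carrier (gal (R i)) \<Longrightarrow> \<psi> \<in> carrier (gal (R i)) \<Longrightarrow> y \<in> Y i \<Longrightarrow> \<phi> y = \<psi> y \<Longrightarrow> \<phi> = \<psi>"
  unfolding gal_def by (rule rel_aut_eqI[OF rep(4)])

lemma gal_torsor:
  "i \<in> I \<Longrightarrow> y \<in> Y i \<Longrightarrow> y' \<in> Y i \<Longrightarrow> q i y = q i y' \<Longrightarrow> \<exists>!\<phi>. \<phi> \<in> carrier (gal (R i)) \<and> \<phi> y = y'"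
  unfolding gal_def by (rule galois_torsor[OF rep(1)])

lemma pointed_unramified_unique:
  assumes i: "i \<in> I" and j: "j \<in> I" and a: "pointed_unramified (R j) (R i) a" and c: "pointed_unramified (R j) (R i) c"
  shows "a = c"
proof (rule extensionalityI)
  have u: "sliding_block_code (Y j) (Y i) a" "sliding_block_code (Y j) (Y i) c"
    using a c unramifiedD(5) by (auto simp: pointed_unramified_def)
  then show "a \<in> extensional (Y j)" "c \<in> extensional (Y j)"
    by (auto simp: sliding_block_code_def)
  show "a y = c y" if "y \<in> Y j" for y
    by (rule unique_lift[OF rep(5)[OF j] rep(4)[OF i] u _ rep(2)[OF j] _ that])
      (use a c in \<open>auto simp: pointed_unramified_def\<close>)
qed

lemma connecting_eq:
  assumes "i \<in> I" "j \<in> I" "pointed_unramified (R j) (R i) a"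
  shows "\<alpha> i j = a" "class_le R i j"
proof -
  show "\<alpha> i j = a"
    unfolding connecting_def
    by (rule the_equality[where P = "pointed_unramified (R j) (R i)", OF assms(3)])
      (rule pointed_unramified_unique[OF assms(1,2) _ assms(3)])
  show "class_le R i j"
    using assms(3) unfolding class_le_def by blast
qed

lemma connecting:
  assumes "i \<in> I" "j \<in> I" "class_le R i j"
  shows "pointed_unramified (R j) (R i) (\<alpha> i j)" "unramified (Y j) (Y i) (\<alpha> i j)"
    "sliding_block_code (Y j) (Y i) (\<alpha> i j)" "\<alpha> i j (b j) = b i"
    "\<And>y. y \<in> Y j \<Longrightarrow> \<alpha> i j y \<in> Y i" "\<And>y. y \<in> Y j \<Longrightarrow> q i (\<alpha> i j y) = q j y"
proof -
  obtain a where "pointed_unramified (R j) (R i) a"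
    using assms(3) by (auto simp: class_le_def)
  then show *: "pointed_unramified (R j) (R i) (\<alpha> i j)"
    using connecting_eq[OF assms(1,2)] by simp
  then show "unramified (Y j) (Y i) (\<alpha> i j)" "\<alpha> i j (b j) = b i" "\<And>y. y \<in> Y j \<Longrightarrow> q i (\<alpha> i j y) = q j y"
    by (simp_all add: pointed_unramified_def)
  then show sbc: "sliding_block_code (Y j) (Y i) (\<alpha> i j)"
    by (simp add: unramifiedD(5))
  show "\<And>y. y \<in> Y j \<Longrightarrow> \<alpha> i j y \<in> Y i"
    by (rule sliding_block_code_mem[OF sbc])
qed

lemma connecting_translate:
  "i \<in> I \<Longrightarrow> j \<in> I \<Longrightarrow> class_le R i j \<Longrightarrow> y \<in> Y j \<Longrightarrow> \<alpha> i j (translate k y) = translate k (\<alpha> i j y)"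
  by (rule sliding_block_code_translate[OF rep(6) connecting(3)])

text \<open>Both compositions are lifts of the projection of Y j through that of Y i, so one common
  value forces equality. Compatibility in the inverse limit can thus be tested at a single
  point.\<close>

lemma equivariant_everywhere:
  assumes i: "i \<in> I" and j: "j \<in> I" and le: "class_le R i j"
    and \<phi>: "\<phi> \<in> carrier (gal (R j))" and \<psi>: "\<psi> \<in> carrier (gal (R i))"
    and z: "z \<in> Y j" "\<psi> (\<alpha> i j z) = \<alpha> i j (\<phi> z)" and y: "y \<in> Y j"
  shows "\<psi> (\<alpha> i j y) = \<alpha> i j (\<phi> y)"
proof -
  note c = connecting[OF i j le]
  have \<phi>s: "sliding_block_code (Y j) (Y j) \<phi>" and \<psi>s: "sliding_block_code (Y i) (Y i) \<psi>"
    using \<phi> \<psi> conjugacyD(1) by (auto simp: gal_iff)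
  have "compose (Y j) \<psi> (\<alpha> i j) y = compose (Y j) (\<alpha> i j) \<phi> y"
    by (rule unique_lift[OF rep(5)[OF j] rep(4)[OF i] sliding_block_code_compose[OF rep(6)[OF j] c(3) \<psi>s]
          sliding_block_code_compose[OF rep(6)[OF j] \<phi>s c(3)] _ z(1) _ y])
      (use c z gal_proj[OF \<phi>] gal_proj[OF \<psi>] gal_mem[OF \<phi>] in \<open>auto simp: compose_def\<close>)
  then show ?thesis
    using y by (simp add: compose_def)
qed

text \<open>The torsor property at the image of the base point provides the transformation that
  \<open>gal_transition\<close> describes; afterwards the description operator can be replaced by
  its defining equation.\<close>

lemma transition_eq_iff:
  assumes i: "i \<in> I" and j: "j \<in> I" and le: "class_le R i j"
    and \<phi>: "\<phi> \<in> carrier (gal (R j))" and \<psi>: "\<psi> \<in> carrier (gal (R i))"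
  shows "gal_transition R i j \<phi> = \<psi> \<longleftrightarrow> (\<forall>y\<in>Y j. \<psi> (\<alpha> i j y) = \<alpha> i j (\<phi> y))"
proof -
  note c = connecting[OF i j le] and bj = rep(2)[OF j]
  let ?P = "\<lambda>\<psi>. \<psi> \<in> carrier (gal (R i)) \<and> (\<forall>y\<in>Y j. \<psi> (\<alpha> i j y) = \<alpha> i j (\<phi> y))"
  have "q i (\<alpha> i j (b j)) = q i (\<alpha> i j (\<phi> (b j)))"
    using c(6) bj gal_mem[OF \<phi> bj] gal_proj[OF \<phi> bj] by simp
  then obtain \<chi> where \<chi>: "\<chi> \<in> carrier (gal (R i))" "\<chi> (\<alpha> i j (b j)) = \<alpha> i j (\<phi> (b j))"
    using gal_torsor[OF i c(5)[OF bj] c(5)[OF gal_mem[OF \<phi> bj]]] by blast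
  have P: "?P \<chi>"
    using equivariant_everywhere[OF i j le \<phi> \<chi>(1) bj \<chi>(2)] \<chi>(1) by blast
  have uniq: "\<psi> = \<chi>" if "?P \<psi>" for \<psi>
    using gal_eqI[OF i _ \<chi>(1) c(5)[OF bj], of \<psi>] that bj \<chi>(2) by simp
  have "gal_transition R i j \<phi> = \<chi>"
    unfolding gal_transition_def by (rule the_equality[of ?P, OF P]) (rule uniq)
  then show ?thesis
    using uniq[of \<psi>] P \<psi> by metis
qed

lemma G_iff:
  "g \<in> carrier G \<longleftrightarrow> g \<in> (\<Pi>\<^sub>E i\<in>I. carrier (gal (R i))) \<and>
     (\<forall>i\<in>I. \<forall>j\<in>I. class_le R i j \<longrightarrow> (\<forall>y\<in>Y j. g i (\<alpha> i j y) = \<alpha> i j (g j y)))"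
proof -
  have "(\<forall>i\<in>I. \<forall>j\<in>I. class_le R i j \<longrightarrow> gal_transition R i j (g j) = g i) \<longleftrightarrow>
     (\<forall>i\<in>I. \<forall>j\<in>I. class_le R i j \<longrightarrow> (\<forall>y\<in>Y j. g i (\<alpha> i j y) = \<alpha> i j (g j y)))"
    if "g \<in> (\<Pi>\<^sub>E i\<in>I. carrier (gal (R i)))"
    using transition_eq_iff[OF _ _ _ PiE_mem[OF that] PiE_mem[OF that]] by metis
  then show ?thesis
    by (auto simp: abs_gal_def)
qed

lemma GD:
  assumes "g \<in> carrier G"
  shows "g \<in> extensional I" "\<And>i. i \<in> I \<Longrightarrow> g i \<in> carrier (gal (R i))"
    "\<And>i j y. i \<in> I \<Longrightarrow> j \<in> I \<Longrightarrow> class_le R i j \<Longrightarrow> y \<in> Y j \<Longrightarrow> g i (\<alpha> i j y) = \<alpha> i j (g j y)"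
    "\<And>i y. i \<in> I \<Longrightarrow> y \<in> Y i \<Longrightarrow> g i y \<in> Y i"
proof -
  show "g \<in> extensional I" "\<And>i j y. i \<in> I \<Longrightarrow> j \<in> I \<Longrightarrow> class_le R i j \<Longrightarrow> y \<in> Y j \<Longrightarrow> g i (\<alpha> i j y) = \<alpha> i j (g j y)"
    using assms unfolding G_iff PiE_def by blast+
  show gi: "g i \<in> carrier (gal (R i))" if "i \<in> I" for i
    using assms that unfolding G_iff by (auto dest: PiE_mem)
  show "\<And>i y. i \<in> I \<Longrightarrow> y \<in> Y i \<Longrightarrow> g i y \<in> Y i"
    by (rule gal_mem[OF gi])
qed

lemma G_intro:
  assumes "g \<in> extensional I" "\<And>i. i \<in> I \<Longrightarrow> g i \<in> carrier (gal (R i))"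
    and "\<And>i j. i \<in> I \<Longrightarrow> j \<in> I \<Longrightarrow> class_le R i j \<Longrightarrow> \<exists>z\<in>Y j. g i (\<alpha> i j z) = \<alpha> i j (g j z)"
  shows "g \<in> carrier G"
  unfolding G_iff
proof (intro conjI ballI impI)
  show "g \<in> (\<Pi>\<^sub>E i\<in>I. carrier (gal (R i)))"
    using assms(1,2) by (auto simp: PiE_def)
  fix i j y assume *: "i \<in> I" "j \<in> I" "class_le R i j" "y \<in> Y j"
  obtain z where z: "z \<in> Y j" "g i (\<alpha> i j z) = \<alpha> i j (g j z)"
    using assms(3)[OF *(1-3)] by blast
  show "g i (\<alpha> i j y) = \<alpha> i j (g j y)"
    by (rule equivariant_everywhere[OF *(1-3) assms(2)[OF *(2)] assms(2)[OF *(1)] z *(4)])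
qed

lemma G_mult:
  assumes "g \<in> carrier G" "h \<in> carrier G"
  shows "g \<otimes>\<^bsub>G\<^esub> h = (\<lambda>i\<in>I. compose (Y i) (g i) (h i))"
proof -
  have "g \<otimes>\<^bsub>G\<^esub> h = (\<lambda>i\<in>I. g i \<otimes>\<^bsub>gal (R i)\<^esub> h i)"
    by (simp add: abs_gal_def product_group_def)
  then show ?thesis
    using gal_mult[OF GD(2)[OF assms(1)] GD(2)[OF assms(2)]] by (simp cong: restrict_cong)
qed

lemma G_mult_apply:
  assumes "g \<in> carrier G" "h \<in> carrier G" "i \<in> I" "y \<in> Y i"
  shows "(g \<otimes>\<^bsub>G\<^esub> h) i y = g i (h i y)"
  using assms by (simp add: G_mult compose_def)

lemma G_mult_closed:
  assumes g: "g \<in> carrier G" and h: "h \<in> carrier G"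
  shows "g \<otimes>\<^bsub>G\<^esub> h \<in> carrier G"
proof (rule G_intro)
  show "g \<otimes>\<^bsub>G\<^esub> h \<in> extensional I"
    by (simp add: G_mult[OF g h])
  fix i assume i: "i \<in> I"
  have "topological_conjugacy (Y i) (Y i) (compose (Y i) (g i) (h i))"
    using conjugacy_compose[OF rep(6)[OF i], of "Y i" "h i" "Y i" "g i"] GD(2)[OF g i] GD(2)[OF h i] by (simp add: gal_iff)
  then show "(g \<otimes>\<^bsub>G\<^esub> h) i \<in> carrier (gal (R i))"
    using i gal_proj[OF GD(2)[OF g i]] gal_proj[OF GD(2)[OF h i]] GD(4)[OF h i]
    by (simp add: G_mult[OF g h] gal_iff compose_def)
  fix j assume j: "j \<in> I" and le: "class_le R i j"
  show "\<exists>z\<in>Y j. (g \<otimes>\<^bsub>G\<^esub> h) i (\<alpha> i j z) = \<alpha> i j ((g \<otimes>\<^bsub>G\<^esub> h) j z)"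
    using rep(2)[OF j] connecting(5)[OF i j le] GD(3,4)[OF g] GD(3,4)[OF h] i j le
    by (intro bexI[of _ "b j"]) (simp_all add: G_mult_apply[OF g h])
qed

section \<open>The fibre functor\<close>

lemma F_iff:
  "\<xi> \<in> F x \<longleftrightarrow> \<xi> \<in> extensional I \<and> (\<forall>i\<in>I. \<xi> i \<in> Y i \<and> q i (\<xi> i) = x) \<and>
     (\<forall>i\<in>I. \<forall>j\<in>I. class_le R i j \<longrightarrow> \<alpha> i j (\<xi> j) = \<xi> i)"
  by (auto simp: profinite_fibre_def PiE_def fibre_def)

text \<open>On each level there is one deck transformation moving the first point to the second;
  these are compatible because they already satisfy the required equation at
  \<open>\<xi> j\<close>.\<close>

lemma F_torsor:
  assumes \<xi>: "\<xi> \<in> F x" and \<xi>': "\<xi>' \<in> F x"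
  shows "\<exists>h\<in>carrier G. \<forall>i\<in>I. h i (\<xi> i) = \<xi>' i"
proof -
  have ex: "\<exists>\<phi>. \<phi> \<in> carrier (gal (R i)) \<and> \<phi> (\<xi> i) = \<xi>' i" if "i \<in> I" for i
  proof -
    have "\<xi> i \<in> Y i" "\<xi>' i \<in> Y i" "q i (\<xi> i) = q i (\<xi>' i)"
      using \<xi> \<xi>' that by (simp_all add: F_iff)
    then show ?thesis
      using gal_torsor[OF that] by blast
  qed
  define h where "h = (\<lambda>i\<in>I. SOME \<phi>. \<phi> \<in> carrier (gal (R i)) \<and> \<phi> (\<xi> i) = \<xi>' i)"
  have h: "h i \<in> carrier (gal (R i)) \<and> h i (\<xi> i) = \<xi>' i" if "i \<in> I" for i
    using someI_ex[OF ex[OF that]] that by (simp add: h_def)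
  have "h \<in> carrier G"
  proof (rule G_intro)
    show "h \<in> extensional I"
      by (simp add: h_def)
    fix i j assume ij: "i \<in> I" "j \<in> I" "class_le R i j"
    show "\<exists>z\<in>Y j. h i (\<alpha> i j z) = \<alpha> i j (h j z)"
      using \<xi> \<xi>' ij h by (intro bexI[of _ "\<xi> j"]) (auto simp: F_iff)
  qed (use h in blast)
  then show ?thesis
    using h by blast
qed

lemma F_unique:
  assumes "\<xi> \<in> F x" "g \<in> carrier G" "h \<in> carrier G" "\<And>i. i \<in> I \<Longrightarrow> g i (\<xi> i) = h i (\<xi> i)"
  shows "g = h"
proof (rule extensionalityI[OF GD(1)[OF assms(2)] GD(1)[OF assms(3)]])
  fix i assume i: "i \<in> I"
  show "g i = h i"
    using gal_eqI[OF i GD(2)[OF assms(2) i] GD(2)[OF assms(3) i] _ assms(4)[OF i]] assms(1) i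
    by (simp add: F_iff)
qed

text \<open>Asymptotic lifts are unique on each level, and connecting maps preserve being
  asymptotic; so the levelwise lifts form a compatible family by themselves.\<close>

lemma F_asymptotic:
  assumes s: "s = 1 \<or> s = - 1" and x: "x \<in> X" and z: "z \<in> X" and xz: "asymptotic s x z" and \<xi>: "\<xi> \<in> F x"
  shows "F z \<noteq> {}"
proof -
  have ex: "\<exists>!y'. y' \<in> fibre (Y i) (q i) z \<and> asymptotic s (\<xi> i) y'" if "i \<in> I" for i
    using asymptotic_lift[OF rep(4)[OF that] s x z xz, of "\<xi> i"] \<xi> that by (auto simp: F_iff fibre_def)
  define \<zeta> where "\<zeta> = (\<lambda>i\<in>I. THE y'. y' \<in> fibre (Y i) (q i) z \<and> asymptotic s (\<xi> i) y')"
  have \<zeta>: "\<zeta> i \<in> Y i" "q i (\<zeta> i) = z" "asymptotic s (\<xi> i) (\<zeta> i)" if "i \<in> I" for i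
    using theI'[OF ex[OF that]] that by (auto simp: \<zeta>_def fibre_def)
  have "\<alpha> i j (\<zeta> j) = \<zeta> i" if ij: "i \<in> I" "j \<in> I" "class_le R i j" for i j
  proof -
    note c = connecting[OF ij]
    obtain r where r: "r \<ge> 0" "local_map r (Y j) (\<alpha> i j)"
      using c(3) sliding_block_code_iff[OF rep(6)[OF ij(2)]] by blast
    have "\<xi> j \<in> Y j" "\<alpha> i j (\<xi> j) = \<xi> i"
      using \<xi> ij by (auto simp: F_iff)
    then have "asymptotic s (\<xi> i) (\<alpha> i j (\<zeta> j))"
      using asymptotic_map[OF r(2,1) s _ \<zeta>(1)[OF ij(2)] \<zeta>(3)[OF ij(2)]] by simp
    moreover have "\<alpha> i j (\<zeta> j) \<in> fibre (Y i) (q i) z"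
      using c(5,6) \<zeta>[OF ij(2)] by (simp add: fibre_def)
    moreover have "\<zeta> i \<in> fibre (Y i) (q i) z"
      using \<zeta>[OF ij(1)] by (simp add: fibre_def)
    ultimately show ?thesis
      using ex[OF ij(1)] \<zeta>(3)[OF ij(1)] by blast
  qed
  then have "\<zeta> \<in> F z"
    using \<zeta> by (auto simp: F_iff \<zeta>_def)
  then show ?thesis by blast
qed

lemma F_translate:
  assumes "\<xi> \<in> F x"
  shows "(\<lambda>i\<in>I. translate k (\<xi> i)) \<in> F (translate k x)"
proof -
  have "q i (translate k (\<xi> i)) = translate k x" if "i \<in> I" for i
    using sliding_block_code_translate[OF rep(6)[OF that] unramifiedD(5)[OF rep(4)[OF that]]] assms that
    by (simp add: F_iff)
  then show ?thesis
    using assms translate_mem[OF rep(6)] connecting_translate by (simp add: F_iff)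
qed

lemma F_nonempty:
  assumes x: "x \<in> X"
  shows "F x \<noteq> {}"
proof -
  \<comment> \<open>The base points form an element of the profinite fibre over x0, from which the
    zigzag starts.\<close>
  have base: "(\<lambda>i\<in>I. b i) \<in> F x0"
    using rep(2,3) connecting(4) by (simp add: F_iff)
  obtain z k where z: "z \<in> X" "asymptotic (- 1) x0 z" "asymptotic 1 z (translate k x)"
    using irreducible_zigzag[OF irr x0 x] by blast
  obtain \<zeta> where "\<zeta> \<in> F z"
    using F_asymptotic[OF _ x0 z(1,2) base] by auto
  then obtain \<eta> where "\<eta> \<in> F (translate k x)"
    using F_asymptotic[OF _ z(1) translate_mem[OF sub x] z(3)] by auto
  then have "(\<lambda>i\<in>I. translate (- k) (\<eta> i)) \<in> F x"
    using F_translate[of \<eta> "translate k x" "- k"] by simp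
  then show ?thesis by blast
qed

end

section \<open>Comparing factors without regard to base points\<close>

context absolute_galois
begin

text \<open>A deck transformation moves the image of the base point to the base point, so Galois
  factors conjugate over X are also conjugate as pointed factors.\<close>

lemma conjugacy_over_imp_eq:
  assumes i: "i \<in> I" and j: "j \<in> I" and \<delta>: "topological_conjugacy (Y i) (Y j) \<delta>"
    and over: "\<And>y. y \<in> Y i \<Longrightarrow> q j (\<delta> y) = q i y"
  shows "i = j"
proof -
  note dm = conjugacyD(6)[OF \<delta>] and bi = rep(2)[OF i]
  have "q j (\<delta> (b i)) = q j (b j)"
    using over[OF bi] rep(3) i j by simp
  then obtain \<phi> where \<phi>: "\<phi> \<in> carrier (gal (R j))" "\<phi> (\<delta> (b i)) = b j"
    using gal_torsor[OF j dm[OF bi] rep(2)[OF j]] by blast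
  have "topological_conjugacy (Y j) (Y j) \<phi>"
    using \<phi>(1) by (simp add: gal_iff)
  then have "pointed_conjugacy (R i) (R j) (compose (Y i) \<phi> \<delta>)"
    using conjugacy_compose[OF rep(6)[OF i] \<delta>] bi \<phi> dm over gal_proj[OF \<phi>(1)]
    by (simp add: pointed_conjugacy_def compose_def)
  then show ?thesis
    by (rule pointed_conjugacy_imp_eq[OF i j])
qed

text \<open>Any unramified map over X decides the order: a deck transformation of the smaller factor
  corrects the base point.\<close>

lemma class_leI:
  assumes i: "i \<in> I" and j: "j \<in> I" and \<gamma>: "unramified (Y j) (Y i) \<gamma>"
    and over: "\<And>y. y \<in> Y j \<Longrightarrow> q i (\<gamma> y) = q j y"
  shows "class_le R i j"
proof -
  note gm = sliding_block_code_mem[OF unramifiedD(5)[OF \<gamma>]] and bj = rep(2)[OF j]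
  have "q i (\<gamma> (b j)) = q i (b i)"
    using over[OF bj] rep(3) i j by simp
  then obtain \<phi> where \<phi>: "\<phi> \<in> carrier (gal (R i))" "\<phi> (\<gamma> (b j)) = b i"
    using gal_torsor[OF i gm[OF bj] rep(2)[OF i]] by blast
  have "topological_conjugacy (Y i) (Y i) \<phi>"
    using \<phi>(1) by (simp add: gal_iff)
  then have "pointed_unramified (R j) (R i) (compose (Y j) \<phi> \<gamma>)"
    using unramified_compose_left[OF \<gamma> rep(5)[OF i]] bj \<phi> gm over gal_proj[OF \<phi>(1)]
    by (simp add: pointed_unramified_def compose_def)
  then show ?thesis
    unfolding class_le_def by blast
qed

lemma gal_conjugate:
  assumes i: "i \<in> I" and k: "k \<in> I" and \<theta>: "topological_conjugacy (Y k) (Y i) \<theta>"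
    and over: "\<And>y. y \<in> Y k \<Longrightarrow> q i (\<theta> y) = u (q k y)" and \<phi>: "\<phi> \<in> carrier (gal (R k))"
  shows "(\<lambda>y\<in>Y i. \<theta> (\<phi> (inv_into (Y k) \<theta> y))) \<in> carrier (gal (R i))"
  using rel_aut_conjugate[OF rep(6)[OF k] rep(6)[OF i] \<theta>, where \<pi> = "q i" and \<rho> = "q k" and u = u] over \<phi>
  by (simp add: gal_def)

lemma topspace_abs_gal_top [simp]: "topspace (abs_gal_top X x0 R) = carrier G"
  by (auto simp: abs_gal_top_def G_iff)

lemma continuous_map_component:
  assumes "i \<in> I"
  shows "continuous_map (abs_gal_top X x0 R) (discrete_topology (carrier (gal (R i)))) (\<lambda>g. g i)"
  unfolding abs_gal_top_def
  by (intro continuous_map_from_subtopology continuous_map_product_projection assms)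

end

section \<open>Twisting by an automorphism\<close>

locale absolute_galois_twist = absolute_galois +
  fixes f \<xi>
  assumes f: "topological_conjugacy X X f" and \<xi>: "\<xi> \<in> F (f x0)"
begin

text \<open>The definition of \<open>beta\<close> in three pieces: component i of \<beta>(g) is the
  component of g at the class \<open>\<tau> i\<close> of \<open>twist i\<close>, transported to Y i
  by \<open>\<theta> i\<close>.\<close>

definition twist :: "'a pgf set \<Rightarrow> 'a pgf" where
  "twist i = (Y i, \<xi> i, \<lambda>y\<in>Y i. inv_into X f (q i y))"

definition \<tau> :: "'a pgf set \<Rightarrow> 'a pgf set" where
  "\<tau> i = cls (twist i)"

definition \<theta> :: "'a pgf set \<Rightarrow> nat point \<Rightarrow> nat point" where
  "\<theta> i = (THE \<theta>. pointed_conjugacy (R (\<tau> i)) (twist i) \<theta>)"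

abbreviation "\<beta> \<equiv> beta X x0 R f \<xi>"

lemmas f_inv = conj_inv_apply[OF f]

lemma q_mem: "i \<in> I \<Longrightarrow> y \<in> Y i \<Longrightarrow> q i y \<in> X"
  by (rule sliding_block_code_mem[OF unramifiedD(5)[OF rep(4)]])

lemma \<xi>D:
  "i \<in> I \<Longrightarrow> \<xi> i \<in> Y i" "i \<in> I \<Longrightarrow> q i (\<xi> i) = f x0"
  "i \<in> I \<Longrightarrow> j \<in> I \<Longrightarrow> class_le R i j \<Longrightarrow> \<alpha> i j (\<xi> j) = \<xi> i"
  using \<xi> by (simp_all add: F_iff)

lemma twist_pgf:
  assumes i: "i \<in> I"
  shows "twist i \<in> pointed_galois_factors X x0"
proof -
  have "galois_factor (Y i) X (compose (Y i) (conj_inv X X f) (q i))"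
    using galois_factor_compose_left[OF rep(1)[OF i] irr conjugacy_inv[OF sub sub f]] x0 by blast
  moreover have "compose (Y i) (conj_inv X X f) (q i) = (\<lambda>y\<in>Y i. inv_into X f (q i y))"
    using q_mem[OF i] by (simp add: compose_def cong: restrict_cong)
  ultimately show ?thesis
    using \<xi>D(1,2)[OF i] f_inv(1)[OF x0] by (simp add: pointed_galois_factors_def twist_def)
qed

lemma \<tau>_mem: "i \<in> I \<Longrightarrow> \<tau> i \<in> I"
  unfolding \<tau>_def by (rule cls_mem[OF twist_pgf])

text \<open>The target carries the projection \<open>q i\<close> followed by the inverse of f, so
  being over X for the twisted factor means covering f for the original one.\<close>

lemma \<theta>:
  assumes i: "i \<in> I"
  shows "topological_conjugacy (Y (\<tau> i)) (Y i) (\<theta> i)" "\<theta> i (b (\<tau> i)) = \<xi> i"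
    "\<And>y. y \<in> Y (\<tau> i) \<Longrightarrow> q i (\<theta> i y) = f (q (\<tau> i) y)"
    "\<And>y. y \<in> Y (\<tau> i) \<Longrightarrow> \<theta> i y \<in> Y i"
proof -
  have "pointed_conjugacy (R (\<tau> i)) (twist i) (\<theta> i)"
    unfolding \<theta>_def \<tau>_def by (rule theI'[OF rep_conjugacy[OF twist_pgf[OF i]]])
  note c = pointed_conjugacyD[OF this, unfolded twist_def, simplified]
  show *: "topological_conjugacy (Y (\<tau> i)) (Y i) (\<theta> i)" "\<theta> i (b (\<tau> i)) = \<xi> i"
    using c by simp_all
  show m: "\<theta> i y \<in> Y i" if "y \<in> Y (\<tau> i)" for y
    using conjugacyD(6)[OF *(1) that] .
  show "q i (\<theta> i y) = f (q (\<tau> i) y)" if y: "y \<in> Y (\<tau> i)" for y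
    using c(3)[OF y] m[OF y] f_inv(2)[OF q_mem[OF i m[OF y]]] by simp
qed

lemmas \<theta>_inv = conj_inv_apply[OF \<theta>(1)]

lemma \<theta>_inj: "i \<in> I \<Longrightarrow> y \<in> Y (\<tau> i) \<Longrightarrow> z \<in> Y (\<tau> i) \<Longrightarrow> \<theta> i y = \<theta> i z \<Longrightarrow> y = z"
  using \<theta>_inv(1) by metis

text \<open>If \<tau> identifies two indices, their transport maps combine to a conjugacy between Y
  i and Y j in which f cancels, so that it lies over X.\<close>

lemma \<tau>_inj: "inj_on \<tau> I"
proof (rule inj_onI)
  fix i j assume i: "i \<in> I" and j: "j \<in> I" and eq: "\<tau> i = \<tau> j"
  define \<delta> where "\<delta> = compose (Y i) (\<theta> j) (conj_inv (Y (\<tau> i)) (Y i) (\<theta> i))"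
  have "topological_conjugacy (Y i) (Y j) \<delta>"
    unfolding \<delta>_def
    using conjugacy_compose[OF rep(6)[OF i] conjugacy_inv[OF rep(6)[OF \<tau>_mem[OF i]] rep(6)[OF i] \<theta>(1)[OF i]], of "Y j" "\<theta> j"]
      \<theta>(1)[OF j] eq by simp
  moreover have "q j (\<delta> y) = q i y" if y: "y \<in> Y i" for y
    using \<theta>(3)[OF i] \<theta>(3)[OF j] \<theta>_inv(2,3)[OF i y] eq y by (simp add: \<delta>_def compose_def) metis
  ultimately show "i = j"
    by (rule conjugacy_over_imp_eq[OF i j])
qed

text \<open>Given k, the factor \<open>f \<circ> q k\<close> has some class i; twisting i composes
  with the inverse of f and leads back to the class k.\<close>

lemma \<tau>_surj: "\<tau> ` I = I"
proof
  show "\<tau> ` I \<subseteq> I"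
    using \<tau>_mem by blast
  show "I \<subseteq> \<tau> ` I"
  proof
    fix k assume k: "k \<in> I"
    note u = unramifiedD[OF rep(4)[OF k]]
    have gf: "galois_factor (Y k) X (compose (Y k) f (q k))"
      using galois_factor_compose_left[OF rep(1)[OF k] irr f] x0 by blast
    \<comment> \<open>The base point of the factor \<open>f \<circ> q k\<close> must lie over x0, so
      its image under \<open>q k\<close> has to be the preimage of x0 under f.\<close>
    obtain t where t: "t \<in> Y k" "q k t = inv_into X f x0"
      using u(6) f_inv(3)[OF x0] by (metis imageE)
    define P where "P = (Y k, t, compose (Y k) f (q k))"
    have P: "P \<in> pointed_galois_factors X x0"
      using gf t f_inv(2)[OF x0] by (simp add: pointed_galois_factors_def P_def compose_def)
    define i where "i = cls P"
    have i: "i \<in> I"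
      unfolding i_def by (rule cls_mem[OF P])
    obtain \<gamma> where "pointed_conjugacy (R i) P \<gamma>"
      using rep_conjugacy[OF P] unfolding i_def by blast
    note \<gamma> = pointed_conjugacyD[OF this, unfolded P_def, simplified]
    note inv = conj_inv_apply[OF \<gamma>(1)]
    define \<delta> where "\<delta> = conj_inv (Y i) (Y k) \<gamma>"
    have \<delta>: "topological_conjugacy (Y k) (Y i) \<delta>"
      unfolding \<delta>_def by (rule conjugacy_inv[OF rep(6)[OF i] rep(6)[OF k] \<gamma>(1)])
    note dm = conjugacyD(6)[OF \<delta>] and bk = rep(2)[OF k]
    have \<delta>q: "q i (\<delta> y) = f (q k y)" if y: "y \<in> Y k" for y
      using \<gamma>(3)[OF inv(3)[OF y]] inv(2)[OF y] y by (simp add: \<delta>_def compose_def)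
    \<comment> \<open>The conjugacy may miss the base point of the twist; both points lie over f x0,
      so a deck transformation corrects this.\<close>
    have "q i (\<delta> (b k)) = q i (\<xi> i)"
      using \<delta>q[OF bk] rep(3)[OF k] \<xi>D(2)[OF i] by simp
    then obtain \<phi> where \<phi>: "\<phi> \<in> carrier (gal (R i))" "\<phi> (\<delta> (b k)) = \<xi> i"
      using gal_torsor[OF i dm[OF bk] \<xi>D(1)[OF i]] by blast
    have "topological_conjugacy (Y i) (Y i) \<phi>"
      using \<phi>(1) by (simp add: gal_iff)
    then have "pointed_conjugacy (R k) (twist i) (compose (Y k) \<phi> \<delta>)"
      using conjugacy_compose[OF rep(6)[OF k] \<delta>, of "Y i" \<phi>] bk \<phi>(2) gal_proj[OF \<phi>(1) dm] gal_mem[OF \<phi>(1) dm] \<delta>q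
        f_inv(1)[OF q_mem[OF k]]
      by (simp add: pointed_conjugacy_def twist_def compose_def)
    then have "(R k, twist i) \<in> pgf_equiv X x0"
      using rep_pgf[OF k] twist_pgf[OF i] by (auto simp: pgf_equiv_def)
    then have "cls (R k) = cls (twist i)"
      by (rule equiv_class_eq[OF equiv_pgf])
    then show "k \<in> \<tau> ` I"
      using i cls_rep[OF k] by (auto simp: \<tau>_def)
  qed
qed

text \<open>Conjugating \<open>\<alpha> i j\<close> by the transport maps gives a pointed unramified
  map; by uniqueness it is the connecting map of the twisted indices.\<close>

lemma le_twist:
  assumes i: "i \<in> I" and j: "j \<in> I" and le: "class_le R i j"
  shows "class_le R (\<tau> i) (\<tau> j)"
    and "y \<in> Y (\<tau> j) \<Longrightarrow> \<theta> i (\<alpha> (\<tau> i) (\<tau> j) y) = \<alpha> i j (\<theta> j y)"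
proof -
  note c = connecting[OF i j le] and ti = \<tau>_mem[OF i] and tj = \<tau>_mem[OF j]
  define a where "a = compose (Y (\<tau> j)) (conj_inv (Y (\<tau> i)) (Y i) (\<theta> i)) (compose (Y (\<tau> j)) (\<alpha> i j) (\<theta> j))"
  have un: "unramified (Y (\<tau> j)) (Y (\<tau> i)) a"
    unfolding a_def
    by (rule unramified_compose_left[OF unramified_compose_right[OF c(2) rep(5)[OF tj] \<theta>(1)[OF j]] rep(5)[OF ti]
          conjugacy_inv[OF rep(6)[OF ti] rep(6)[OF i] \<theta>(1)[OF i]]])
  have a: "a y = inv_into (Y (\<tau> i)) (\<theta> i) (\<alpha> i j (\<theta> j y))" if "y \<in> Y (\<tau> j)" for y
    using that c(5) \<theta>(4)[OF j] by (simp add: a_def compose_def)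
  have \<theta>a: "\<theta> i (a y) = \<alpha> i j (\<theta> j y)" "a y \<in> Y (\<tau> i)" if y: "y \<in> Y (\<tau> j)" for y
    using a[OF y] \<theta>_inv(2,3)[OF i c(5)[OF \<theta>(4)[OF j y]]] by simp_all
  have "q (\<tau> j) y = q (\<tau> i) (a y)" if y: "y \<in> Y (\<tau> j)" for y
  proof -
    have "f (q (\<tau> i) (a y)) = f (q (\<tau> j) y)"
      using \<theta>(3)[OF i \<theta>a(2)[OF y]] \<theta>a(1)[OF y] c(6)[OF \<theta>(4)[OF j y]] \<theta>(3)[OF j y] by simp
    then show ?thesis
      using inj_onD[OF conjugacyD(5)[OF f] _ q_mem[OF ti \<theta>a(2)[OF y]] q_mem[OF tj y]] by metis
  qed
  moreover have "a (b (\<tau> j)) = b (\<tau> i)"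
    using a[OF rep(2)[OF tj]] \<theta>(2)[OF j] \<xi>D(3)[OF i j le] \<theta>(2)[OF i] \<theta>_inv(1)[OF i rep(2)[OF ti]] by simp
  ultimately have "pointed_unramified (R (\<tau> j)) (R (\<tau> i)) a"
    using un by (simp add: pointed_unramified_def)
  note e = connecting_eq[OF ti tj this]
  show "class_le R (\<tau> i) (\<tau> j)"
    by (rule e(2))
  show "y \<in> Y (\<tau> j) \<Longrightarrow> \<theta> i (\<alpha> (\<tau> i) (\<tau> j) y) = \<alpha> i j (\<theta> j y)"
    unfolding e(1) by (rule \<theta>a(1))
qed

text \<open>Needed to invert \<beta>: the connecting map of the twisted indices is carried back to
  an unramified map over X, and such a map decides the order.\<close>

lemma le_twistD:
  assumes i: "i \<in> I" and j: "j \<in> I" and le: "class_le R (\<tau> i) (\<tau> j)"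
  shows "class_le R i j"
proof (rule class_leI[OF i j])
  note ti = \<tau>_mem[OF i] and tj = \<tau>_mem[OF j]
  note c = connecting[OF ti tj le]
  let ?\<gamma> = "compose (Y j) (\<theta> i) (compose (Y j) (\<alpha> (\<tau> i) (\<tau> j)) (conj_inv (Y (\<tau> j)) (Y j) (\<theta> j)))"
  show "unramified (Y j) (Y i) ?\<gamma>"
    by (rule unramified_compose_left[OF unramified_compose_right[OF c(2) rep(5)[OF j]
          conjugacy_inv[OF rep(6)[OF tj] rep(6)[OF j] \<theta>(1)[OF j]]] rep(5)[OF i] \<theta>(1)[OF i]])
  show "q i (?\<gamma> y) = q j y" if y: "y \<in> Y j" for y
    using y \<theta>(3)[OF i c(5)[OF \<theta>_inv(3)[OF j y]]] c(6)[OF \<theta>_inv(3)[OF j y]] \<theta>(3)[OF j \<theta>_inv(3)[OF j y]] \<theta>_inv(2)[OF j y]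
    by (simp add: compose_def)
qed

lemma beta_eq:
  assumes "g \<in> carrier G" "i \<in> I"
  shows "\<beta> g i = (\<lambda>y\<in>Y i. \<theta> i (g (\<tau> i) (inv_into (Y (\<tau> i)) (\<theta> i) y)))"
  using assms by (simp add: beta_def gal_component_def Let_def \<theta>_def \<tau>_def twist_def)

text \<open>Points of the form \<open>\<theta> i y\<close> exhaust Y i, and at these the inverse
  disappears from the formula for \<beta>.\<close>

lemma beta_apply:
  assumes "g \<in> carrier G" "i \<in> I" "y \<in> Y (\<tau> i)"
  shows "\<beta> g i (\<theta> i y) = \<theta> i (g (\<tau> i) y)"
  using assms \<theta>_inv(1) \<theta>(4) by (simp add: beta_eq)

lemma beta_closed:
  assumes g: "g \<in> carrier G"
  shows "\<beta> g \<in> carrier G"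
proof (rule G_intro)
  show "\<beta> g \<in> extensional I"
    using g by (simp add: beta_def)
  show "\<beta> g i \<in> carrier (gal (R i))" if i: "i \<in> I" for i
    unfolding beta_eq[OF g i] by (rule gal_conjugate[OF i \<tau>_mem[OF i] \<theta>(1,3)[OF i] GD(2)[OF g \<tau>_mem[OF i]]])
  fix i j assume i: "i \<in> I" and j: "j \<in> I" and le: "class_le R i j"
  note ti = \<tau>_mem[OF i] and tj = \<tau>_mem[OF j]
  note t = le_twist[OF i j le]
  let ?b = "b (\<tau> j)"
  have bm: "?b \<in> Y (\<tau> j)"
    by (rule rep(2)[OF tj])
  have "\<beta> g i (\<alpha> i j (\<theta> j ?b)) = \<beta> g i (\<theta> i (\<alpha> (\<tau> i) (\<tau> j) ?b))"
    using t(2)[OF bm] by simp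
  also have "\<dots> = \<theta> i (g (\<tau> i) (\<alpha> (\<tau> i) (\<tau> j) ?b))"
    by (rule beta_apply[OF g i connecting(5)[OF ti tj t(1) bm]])
  also have "\<dots> = \<theta> i (\<alpha> (\<tau> i) (\<tau> j) (g (\<tau> j) ?b))"
    using GD(3)[OF g ti tj t(1) bm] by simp
  also have "\<dots> = \<alpha> i j (\<theta> j (g (\<tau> j) ?b))"
    by (rule t(2)[OF GD(4)[OF g tj bm]])
  also have "\<dots> = \<alpha> i j (\<beta> g j (\<theta> j ?b))"
    using beta_apply[OF g j bm] by simp
  finally show "\<exists>z\<in>Y j. \<beta> g i (\<alpha> i j z) = \<alpha> i j (\<beta> g j z)"
    using \<theta>(4)[OF j bm] by blast
qed

lemma beta_mult:
  assumes g: "g \<in> carrier G" and h: "h \<in> carrier G"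
  shows "\<beta> (g \<otimes>\<^bsub>G\<^esub> h) = \<beta> g \<otimes>\<^bsub>G\<^esub> \<beta> h"
proof (rule extensionalityI)
  note gh = G_mult_closed[OF g h]
  show "\<beta> (g \<otimes>\<^bsub>G\<^esub> h) \<in> extensional I" "\<beta> g \<otimes>\<^bsub>G\<^esub> \<beta> h \<in> extensional I"
    using GD(1) beta_closed G_mult_closed g h by blast+
  fix i assume i: "i \<in> I"
  show "\<beta> (g \<otimes>\<^bsub>G\<^esub> h) i = (\<beta> g \<otimes>\<^bsub>G\<^esub> \<beta> h) i"
  proof (rule gal_eqI[OF i GD(2)[OF beta_closed[OF gh] i] GD(2)[OF G_mult_closed[OF beta_closed[OF g] beta_closed[OF h]] i]])
    let ?b = "b (\<tau> i)"
    have bm: "?b \<in> Y (\<tau> i)"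
      by (rule rep(2)[OF \<tau>_mem[OF i]])
    show "\<theta> i ?b \<in> Y i"
      by (rule \<theta>(4)[OF i bm])
    show "\<beta> (g \<otimes>\<^bsub>G\<^esub> h) i (\<theta> i ?b) = (\<beta> g \<otimes>\<^bsub>G\<^esub> \<beta> h) i (\<theta> i ?b)"
      using beta_apply[OF gh i bm] beta_apply[OF h i bm] beta_apply[OF g i GD(4)[OF h \<tau>_mem[OF i] bm]]
        G_mult_apply[OF g h \<tau>_mem[OF i] bm] G_mult_apply[OF beta_closed[OF g] beta_closed[OF h] i \<theta>(4)[OF i bm]]
      by simp
  qed
qed

lemma beta_inj: "inj_on \<beta> (carrier G)"
proof (rule inj_onI)
  fix g h assume g: "g \<in> carrier G" and h: "h \<in> carrier G" and eq: "\<beta> g = \<beta> h"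
  show "g = h"
  proof (rule extensionalityI[OF GD(1)[OF g] GD(1)[OF h]])
    fix k assume "k \<in> I"
    \<comment> \<open>Every index has the form \<tau> i, so every component of g is visible in
      \<beta> g.\<close>
    then obtain i where i: "i \<in> I" "k = \<tau> i"
      using \<tau>_surj by blast
    note ti = \<tau>_mem[OF i(1)]
    note bm = rep(2)[OF ti]
    have "\<theta> i (g k (b k)) = \<theta> i (h k (b k))"
      using beta_apply[OF g i(1) bm] beta_apply[OF h i(1) bm] eq i(2) by simp
    then have "g k (b k) = h k (b k)"
      unfolding i(2) by (rule \<theta>_inj[OF i(1) GD(4)[OF g ti bm] GD(4)[OF h ti bm]])
    then show "g k = h k"
      unfolding i(2) by (rule gal_eqI[OF ti GD(2)[OF g ti] GD(2)[OF h ti] bm])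
  qed
qed

text \<open>A formula for the inverse of \<beta>, from which closure and continuity can be read off
  component by component.\<close>

definition beta_inv :: "'a gal_elem \<Rightarrow> 'a gal_elem" where
  "beta_inv h = (\<lambda>k\<in>I. \<lambda>y\<in>Y k. inv_into (Y k) (\<theta> (inv_into I \<tau> k)) (h (inv_into I \<tau> k) (\<theta> (inv_into I \<tau> k) y)))"

lemma \<tau>_inv: "k \<in> I \<Longrightarrow> inv_into I \<tau> k \<in> I" "k \<in> I \<Longrightarrow> \<tau> (inv_into I \<tau> k) = k"
  using \<tau>_surj by (simp_all add: inv_into_into f_inv_into_f)

lemma beta_inv_apply:
  assumes h: "h \<in> carrier G" and i: "i \<in> I" and y: "y \<in> Y (\<tau> i)"
  shows "\<theta> i (beta_inv h (\<tau> i) y) = h i (\<theta> i y)"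
  using \<tau>_mem[OF i] inv_into_f_f[OF \<tau>_inj i] y \<theta>_inv(2)[OF i GD(4)[OF h i \<theta>(4)[OF i y]]]
  by (simp add: beta_inv_def)

text \<open>On each level h is conjugated by the inverse transport map, which covers the inverse of
  f. For compatibility, both indices are written as values of \<tau>; the relation then follows from
  the one that h satisfies at the untwisted indices.\<close>

lemma beta_inv_closed:
  assumes h: "h \<in> carrier G"
  shows "beta_inv h \<in> carrier G"
proof (rule G_intro)
  show "beta_inv h \<in> extensional I"
    by (simp add: beta_inv_def)
  show gal: "beta_inv h k \<in> carrier (gal (R k))" if "k \<in> I" for k
  proof -
    define i where "i = inv_into I \<tau> k"
    have i: "i \<in> I" "\<tau> i = k"
      using \<tau>_inv[OF that] by (auto simp: i_def)
    have \<theta>i: "topological_conjugacy (Y k) (Y i) (\<theta> i)"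
      using \<theta>(1)[OF i(1)] i(2) by simp
    let ?\<theta>' = "conj_inv (Y k) (Y i) (\<theta> i)"
    have c: "topological_conjugacy (Y i) (Y k) ?\<theta>'"
      by (rule conjugacy_inv[OF rep(6)[OF that] rep(6)[OF i(1)] \<theta>i])
    note inv = conj_inv_apply[OF \<theta>i]
    have "q k (?\<theta>' y) = inv_into X f (q i y)" if y: "y \<in> Y i" for y
      using \<theta>(3)[OF i(1), of "?\<theta>' y"] inv(2,3)[OF y] y i f_inv(1)[OF q_mem[OF \<open>k \<in> I\<close> inv(3)[OF y]]] by simp
    from gal_conjugate[OF that i(1) c this GD(2)[OF h i(1)]]
    have "(\<lambda>y\<in>Y k. ?\<theta>' (h i (inv_into (Y i) ?\<theta>' y))) \<in> carrier (gal (R k))" .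
    moreover have "(\<lambda>y\<in>Y k. ?\<theta>' (h i (inv_into (Y i) ?\<theta>' y))) = beta_inv h k"
    proof -
      have "?\<theta>' (h i (inv_into (Y i) ?\<theta>' y)) = inv_into (Y k) (\<theta> i) (h i (\<theta> i y))" if y: "y \<in> Y k" for y
      proof -
        have m: "\<theta> i y \<in> Y i"
          using conjugacyD(6)[OF \<theta>i y] .
        have "inv_into (Y i) ?\<theta>' (?\<theta>' (\<theta> i y)) = \<theta> i y"
          by (rule conj_inv_apply(1)[OF c m])
        then have "inv_into (Y i) ?\<theta>' y = \<theta> i y"
          using m inv(1)[OF y] by simp
        then show ?thesis
          using GD(4)[OF h i(1) m] by simp
      qed
      then show ?thesis
        using \<open>k \<in> I\<close> by (simp add: beta_inv_def i_def[symmetric] cong: restrict_cong)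
    qed
    ultimately show ?thesis by simp
  qed
  fix k l assume k: "k \<in> I" and l: "l \<in> I" and le: "class_le R k l"
  obtain i where i: "i \<in> I" "k = \<tau> i"
    using \<tau>_inv[OF k] by metis
  obtain j where j: "j \<in> I" "l = \<tau> j"
    using \<tau>_inv[OF l] by metis
  note le' = le_twistD[OF i(1) j(1) le[unfolded i(2) j(2)]]
  note t = le_twist(2)[OF i(1) j(1) le', folded i(2) j(2)]
  note c = connecting[OF k l le] and bl = rep(2)[OF l]
  have bt: "beta_inv h l (b l) \<in> Y l"
    using gal_mem[OF gal[OF l] bl] .
  have "\<theta> i (beta_inv h k (\<alpha> k l (b l))) = h i (\<theta> i (\<alpha> k l (b l)))"
    using beta_inv_apply[OF h i(1)] c(5)[OF bl] i(2) by simp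
  also have "\<dots> = h i (\<alpha> i j (\<theta> j (b l)))"
    using t[OF bl] by simp
  also have "\<dots> = \<alpha> i j (h j (\<theta> j (b l)))"
    using GD(3)[OF h i(1) j(1) le'] \<theta>(4)[OF j(1)] bl j(2) by simp
  also have "\<dots> = \<alpha> i j (\<theta> j (beta_inv h l (b l)))"
    using beta_inv_apply[OF h j(1)] bl j(2) by simp
  also have "\<dots> = \<theta> i (\<alpha> k l (beta_inv h l (b l)))"
    using t[OF bt] by simp
  finally have "beta_inv h k (\<alpha> k l (b l)) = \<alpha> k l (beta_inv h l (b l))"
    using \<theta>_inj[OF i(1)] gal_mem[OF gal[OF k] c(5)[OF bl]] c(5)[OF bt] i(2) by simp
  then show "\<exists>z\<in>Y l. beta_inv h k (\<alpha> k l z) = \<alpha> k l (beta_inv h l z)"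
    using bl by blast
qed

lemma beta_beta_inv:
  assumes h: "h \<in> carrier G"
  shows "\<beta> (beta_inv h) = h"
proof (rule extensionalityI[OF GD(1)[OF beta_closed[OF beta_inv_closed[OF h]]] GD(1)[OF h]])
  fix i assume i: "i \<in> I"
  note bm = rep(2)[OF \<tau>_mem[OF i]]
  show "\<beta> (beta_inv h) i = h i"
  proof (rule gal_eqI[OF i GD(2)[OF beta_closed[OF beta_inv_closed[OF h]] i] GD(2)[OF h i] \<theta>(4)[OF i bm]])
    show "\<beta> (beta_inv h) i (\<theta> i (b (\<tau> i))) = h i (\<theta> i (b (\<tau> i)))"
      using beta_apply[OF beta_inv_closed[OF h] i bm] beta_inv_apply[OF h i bm] by simp
  qed
qed

lemma inv_into_beta: "h \<in> carrier G \<Longrightarrow> inv_into (carrier G) \<beta> h = beta_inv h"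
  using inv_into_f_f[OF beta_inj beta_inv_closed] beta_beta_inv by metis

lemma beta_inv_beta: "g \<in> carrier G \<Longrightarrow> beta_inv (\<beta> g) = g"
  using inv_into_beta[OF beta_closed] inv_into_f_f[OF beta_inj] by metis

lemma beta_inv_mult:
  assumes "g \<in> carrier G" "h \<in> carrier G"
  shows "beta_inv (g \<otimes>\<^bsub>G\<^esub> h) = beta_inv g \<otimes>\<^bsub>G\<^esub> beta_inv h"
proof -
  have "\<beta> (beta_inv g \<otimes>\<^bsub>G\<^esub> beta_inv h) = g \<otimes>\<^bsub>G\<^esub> h"
    using beta_mult[OF beta_inv_closed beta_inv_closed] beta_beta_inv assms by simp
  then show ?thesis
    using beta_inv_beta[OF G_mult_closed[OF beta_inv_closed beta_inv_closed]] assms by metis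
qed

text \<open>Each component of the image depends on a single component of h, and functions on a
  discrete group are continuous.\<close>

lemma beta_inv_continuous: "continuous_map (abs_gal_top X x0 R) (abs_gal_top X x0 R) beta_inv"
proof -
  let ?D = "\<lambda>i. discrete_topology (carrier (gal (R i)))"
  have "continuous_map (abs_gal_top X x0 R) (?D k) (\<lambda>h. beta_inv h k)" if k: "k \<in> I" for k
  proof -
    define i where "i = inv_into I \<tau> k"
    have i: "i \<in> I"
      using \<tau>_inv[OF k] by (simp add: i_def)
    define u where "u = (\<lambda>h. \<lambda>y\<in>Y k. inv_into (Y k) (\<theta> i) (h (\<theta> i y)))"
    have "continuous_map (abs_gal_top X x0 R) (discrete_topology UNIV) (u \<circ> (\<lambda>h. h i))"
      by (rule continuous_map_compose[OF continuous_map_component[OF i]]) simp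
    then have "continuous_map (abs_gal_top X x0 R) (discrete_topology UNIV) (\<lambda>h. beta_inv h k)"
      by (rule continuous_map_eq) (simp add: k u_def beta_inv_def i_def)
    moreover have "beta_inv h k \<in> carrier (gal (R k))" if "h \<in> carrier G" for h
      using GD(2)[OF beta_inv_closed[OF that] k] .
    ultimately have "continuous_map (abs_gal_top X x0 R)
        (subtopology (discrete_topology UNIV) (carrier (gal (R k)))) (\<lambda>h. beta_inv h k)"
      unfolding continuous_map_in_subtopology by auto
    then show ?thesis
      by simp
  qed
  then show ?thesis
    using beta_inv_closed unfolding abs_gal_top_def[of X x0 R] continuous_map_in_subtopology continuous_map_componentwise
    by (auto simp flip: abs_gal_top_def simp: beta_inv_def)
qed

text \<open>Each \<open>\<theta> i\<close> covers f, and the transport maps commute with the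
  connecting maps; so a compatible family over x goes to one over f x, with its index moved by
  \<tau>.\<close>

lemma F_twist:
  assumes \<eta>: "\<eta> \<in> F x"
  shows "(\<lambda>i\<in>I. \<theta> i (\<eta> (\<tau> i))) \<in> F (f x)"
proof -
  have e: "\<eta> (\<tau> i) \<in> Y (\<tau> i)" "q (\<tau> i) (\<eta> (\<tau> i)) = x" if "i \<in> I" for i
    using \<eta> \<tau>_mem[OF that] by (simp_all add: F_iff)
  have "\<alpha> i j (\<theta> j (\<eta> (\<tau> j))) = \<theta> i (\<eta> (\<tau> i))" if "i \<in> I" "j \<in> I" "class_le R i j" for i j
    using le_twist[OF that] e[OF that(2)] \<eta> \<tau>_mem[OF that(1)] \<tau>_mem[OF that(2)] by (simp add: F_iff flip: le_twist(2)[OF that])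
  then show ?thesis
    using e \<theta>(3,4) by (simp add: F_iff)
qed

text \<open>Conjugacies commute with translation, so the relation that defines a Frobenius element
  at \<eta> passes to the transported family.\<close>

lemma beta_frobenius:
  assumes g: "g \<in> carrier G" and \<eta>: "\<eta> \<in> F x" and frob: "\<And>i. i \<in> I \<Longrightarrow> g i (\<eta> i) = translate m (\<eta> i)"
    and i: "i \<in> I"
  shows "\<beta> g i (\<theta> i (\<eta> (\<tau> i))) = translate m (\<theta> i (\<eta> (\<tau> i)))"
proof -
  have e: "\<eta> (\<tau> i) \<in> Y (\<tau> i)"
    using \<eta> \<tau>_mem[OF i] by (simp add: F_iff)
  show ?thesis
    using beta_apply[OF g i e] frob[OF \<tau>_mem[OF i]]
      sliding_block_code_translate[OF rep(6)[OF \<tau>_mem[OF i]] conjugacyD(1)[OF \<theta>(1)[OF i]] e]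
    by simp
qed

end

section \<open>First cohomology\<close>

lemma continuous_map_into_discrete:
  "continuous_map T (discrete_topology UNIV) h \<longleftrightarrow> (\<forall>c. openin T {x \<in> topspace T. h x = c})"
proof
  assume h: "continuous_map T (discrete_topology UNIV) h"
  have "openin T {x \<in> topspace T. h x \<in> {c}}" for c
    using h by (rule openin_continuous_map_preimage) simp
  then show "\<forall>c. openin T {x \<in> topspace T. h x = c}"
    by simp
next
  assume *: "\<forall>c. openin T {x \<in> topspace T. h x = c}"
  have "openin T {x \<in> topspace T. h x \<in> U}" for U
  proof -
    have "{x \<in> topspace T. h x \<in> U} = (\<Union>c\<in>U. {x \<in> topspace T. h x = c})"
      by blast
    also have "openin T \<dots>"
      by (rule openin_Union) (use * in auto)
    finally show ?thesis .
  qed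
  then show "continuous_map T (discrete_topology UNIV) h"
    by (simp add: continuous_map_def)
qed

text \<open>Every operation on discrete values is continuous; this serves sums and scalar multiples
  of characters.\<close>

lemma continuous_map_discrete_binary:
  assumes "continuous_map T (discrete_topology UNIV) h" "continuous_map T (discrete_topology UNIV) k"
  shows "continuous_map T (discrete_topology UNIV) (\<lambda>x. F (h x) (k x))"
  unfolding continuous_map_into_discrete
proof
  fix c
  have "{x \<in> topspace T. F (h x) (k x) = c} =
      (\<Union>(a, b)\<in>{(a, b). F a b = c}. {x \<in> topspace T. h x = a} \<inter> {x \<in> topspace T. k x = b})"
    by auto
  also have "openin T \<dots>"
    using assms unfolding continuous_map_into_discrete by (intro openin_Union) (auto intro!: openin_Int)
  finally show "openin T {x \<in> topspace T. F (h x) (k x) = c}" .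
qed

context absolute_galois
begin

lemma H1_simps [simp]:
  "\<zero>\<^bsub>H1 X x0 R\<^esub> = (\<lambda>g\<in>carrier G. 0)"
  "\<chi> \<oplus>\<^bsub>H1 X x0 R\<^esub> \<psi> = (\<lambda>g\<in>carrier G. \<chi> g + \<psi> g)"
  "a \<odot>\<^bsub>H1 X x0 R\<^esub> \<chi> = (\<lambda>g\<in>carrier G. a * \<chi> g)"
  by (simp_all add: H1_def Let_def)

lemma H1_carrier:
  fixes \<chi> :: "'a gal_elem \<Rightarrow> 'p::prime_card mod_ring"
  shows "\<chi> \<in> carrier (H1 X x0 R) \<longleftrightarrow> \<chi> \<in> extensional (carrier G) \<and>
     (\<forall>g\<in>carrier G. \<forall>h\<in>carrier G. \<chi> (g \<otimes>\<^bsub>G\<^esub> h) = \<chi> g + \<chi> h) \<and>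
     continuous_map (abs_gal_top X x0 R) (discrete_topology UNIV) \<chi>"
  by (auto simp: H1_def Let_def hom_def)

lemma H1_intro:
  fixes \<chi> :: "'a gal_elem \<Rightarrow> 'p::prime_card mod_ring"
  assumes "\<And>g h. g \<in> carrier G \<Longrightarrow> h \<in> carrier G \<Longrightarrow> \<chi> (g \<otimes>\<^bsub>G\<^esub> h) = \<chi> g + \<chi> h"
    and "continuous_map (abs_gal_top X x0 R) (discrete_topology UNIV) \<chi>"
  shows "(\<lambda>g\<in>carrier G. \<chi> g) \<in> carrier (H1 X x0 R)"
  unfolding H1_carrier
proof (intro conjI ballI)
  show "continuous_map (abs_gal_top X x0 R) (discrete_topology UNIV) (\<lambda>g\<in>carrier G. \<chi> g)"
    using assms(2) by (rule continuous_map_eq) simp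
qed (use assms(1) G_mult_closed in auto)

lemma H1D:
  assumes "\<chi> \<in> carrier (H1 X x0 R)"
  shows "\<chi> \<in> extensional (carrier G)" "\<And>g h. g \<in> carrier G \<Longrightarrow> h \<in> carrier G \<Longrightarrow> \<chi> (g \<otimes>\<^bsub>G\<^esub> h) = \<chi> g + \<chi> h"
    "continuous_map (abs_gal_top X x0 R) (discrete_topology UNIV) \<chi>"
  using assms by (simp_all add: H1_carrier)

lemma H1_vectorspace: "vectorspace class_ring (H1 X x0 R :: ('p::prime_card mod_ring, _) module)"
proof (rule vs_criteria)
  let ?V = "H1 X x0 R :: ('p mod_ring, _) module"
  show "field (class_ring :: 'p mod_ring ring)"
    by (rule class_field)
  have smult: "c \<odot>\<^bsub>?V\<^esub> v \<in> carrier ?V" if v: "v \<in> carrier ?V" for c v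
    unfolding H1_simps
  proof (rule H1_intro)
    show "continuous_map (abs_gal_top X x0 R) (discrete_topology UNIV) (\<lambda>g. c * v g)"
      by (rule continuous_map_discrete_binary[OF H1D(3)[OF v] H1D(3)[OF v], of "\<lambda>a _. c * a"])
  qed (simp add: H1D(2)[OF v] distrib_left)
  then show "\<forall>c v. c \<in> carrier class_ring \<and> v \<in> carrier ?V \<longrightarrow> c \<odot>\<^bsub>?V\<^esub> v \<in> carrier ?V"
    by blast
  show "\<forall>v w. v \<in> carrier ?V \<and> w \<in> carrier ?V \<longrightarrow> v \<oplus>\<^bsub>?V\<^esub> w \<in> carrier ?V"
  proof (intro allI impI, elim conjE)
    fix v w assume v: "v \<in> carrier ?V" and w: "w \<in> carrier ?V"
    show "v \<oplus>\<^bsub>?V\<^esub> w \<in> carrier ?V"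
      unfolding H1_simps
      by (rule H1_intro) (simp_all add: H1D(2)[OF v] H1D(2)[OF w] continuous_map_discrete_binary[OF H1D(3)[OF v] H1D(3)[OF w]])
  qed
  show "\<zero>\<^bsub>?V\<^esub> \<in> carrier ?V"
    unfolding H1_simps by (rule H1_intro) simp_all
  show "\<forall>v\<in>carrier ?V. \<exists>w\<in>carrier ?V. v \<oplus>\<^bsub>?V\<^esub> w = \<zero>\<^bsub>?V\<^esub>"
  proof
    fix v assume "v \<in> carrier ?V"
    then show "\<exists>w\<in>carrier ?V. v \<oplus>\<^bsub>?V\<^esub> w = \<zero>\<^bsub>?V\<^esub>"
      using smult[of v "- 1"] by (intro bexI[of _ "- 1 \<odot>\<^bsub>?V\<^esub> v"]) (simp_all cong: restrict_cong)
  qed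
qed (auto simp: algebra_simps H1_carrier extensional_restrict restrict_def fun_eq_iff extensional_def)

text \<open>The point chosen in \<open>upsilon\<close> exists because profinite fibres are nonempty;
  what is proved for an arbitrary such point then applies to it.\<close>

lemma upsilon_eq:
  assumes f: "topological_conjugacy X X f"
  obtains \<xi> where "absolute_galois_twist X x0 R f \<xi>"
    "\<And>\<chi> :: 'a gal_elem \<Rightarrow> 'p::prime_card mod_ring.
       upsilon X x0 R f \<chi> = (\<lambda>g\<in>carrier G. \<chi> (absolute_galois_twist.beta_inv X x0 R f \<xi> g))"
proof -
  define \<xi> where "\<xi> = (SOME \<xi>. \<xi> \<in> F (f x0))"
  have "\<xi> \<in> F (f x0)"
    unfolding \<xi>_def using F_nonempty[OF conjugacyD(6)[OF f x0]] by (metis ex_in_conv someI)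
  then interpret t: absolute_galois_twist X x0 R f \<xi>
    using f by unfold_locales
  show thesis
  proof (rule that)
    show "absolute_galois_twist X x0 R f \<xi>" ..
    show "upsilon X x0 R f \<chi> = (\<lambda>g\<in>carrier G. \<chi> (t.beta_inv g))" for \<chi> :: "'a gal_elem \<Rightarrow> 'p mod_ring"
      by (simp add: upsilon_def Let_def t.inv_into_beta flip: \<xi>_def cong: restrict_cong)
  qed
qed

lemma upsilon_closed:
  fixes \<chi> :: "'a gal_elem \<Rightarrow> 'p::prime_card mod_ring"
  assumes f: "topological_conjugacy X X f" and \<chi>: "\<chi> \<in> carrier (H1 X x0 R)"
  shows "upsilon X x0 R f \<chi> \<in> carrier (H1 X x0 R)"
proof -
  obtain \<xi> where t: "absolute_galois_twist X x0 R f \<xi>"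
    and u: "upsilon X x0 R f \<chi> = (\<lambda>g\<in>carrier G. \<chi> (absolute_galois_twist.beta_inv X x0 R f \<xi> g))"
    using upsilon_eq[OF f] by metis
  interpret t: absolute_galois_twist X x0 R f \<xi>
    by (rule t)
  show ?thesis
    unfolding u
  proof (rule H1_intro)
    have "continuous_map (abs_gal_top X x0 R) (discrete_topology UNIV) (\<chi> \<circ> t.beta_inv)"
      by (rule continuous_map_compose[OF t.beta_inv_continuous H1D(3)[OF \<chi>]])
    then show "continuous_map (abs_gal_top X x0 R) (discrete_topology UNIV) (\<lambda>g. \<chi> (t.beta_inv g))"
      by (simp add: comp_def)
  qed (simp add: t.beta_inv_mult t.beta_inv_closed H1D(2)[OF \<chi>])
qed

section \<open>Frobenius elements of periodic points\<close>

text \<open>The analogue of the Frobenius class of a prime: the family \<eta> stays existentially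
  quantified, so the set gathers the elements for all choices of it.\<close>

definition frobenius :: "int \<Rightarrow> 'a point \<Rightarrow> 'a gal_elem set" where
  "frobenius m x = {g \<in> carrier G. \<exists>\<eta>\<in>F x. \<forall>i\<in>I. g i (\<eta> i) = translate m (\<eta> i)}"

definition frob_eval :: "int \<Rightarrow> 'a point \<Rightarrow> ('a gal_elem \<Rightarrow> 'k) \<Rightarrow> 'k" where
  "frob_eval m x \<chi> = \<chi> (SOME g. g \<in> frobenius m x)"

lemma frobenius_nonempty:
  assumes x: "x \<in> X" "translate m x = x"
  shows "frobenius m x \<noteq> {}"
proof -
  obtain \<eta> where \<eta>: "\<eta> \<in> F x"
    using F_nonempty[OF x(1)] by blast
  have "(\<lambda>i\<in>I. translate m (\<eta> i)) \<in> F x"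
    using F_translate[OF \<eta>, of m] x(2) by simp
  then obtain h where "h \<in> carrier G" "\<forall>i\<in>I. h i (\<eta> i) = (\<lambda>i\<in>I. translate m (\<eta> i)) i"
    using F_torsor[OF \<eta>] by blast
  then show ?thesis
    using \<eta> by (auto simp: frobenius_def)
qed

text \<open>Frobenius elements for different points of the profinite fibre are conjugate.\<close>

lemma frobenius_value:
  fixes \<chi> :: "'a gal_elem \<Rightarrow> 'p::prime_card mod_ring"
  assumes g: "g \<in> frobenius m x" and g': "g' \<in> frobenius m x" and \<chi>: "\<chi> \<in> carrier (H1 X x0 R)"
  shows "\<chi> g = \<chi> g'"
proof -
  obtain \<eta> where \<eta>: "\<eta> \<in> F x" "\<And>i. i \<in> I \<Longrightarrow> g i (\<eta> i) = translate m (\<eta> i)" and gG: "g \<in> carrier G"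
    using g by (auto simp: frobenius_def)
  obtain \<eta>' where \<eta>': "\<eta>' \<in> F x" "\<And>i. i \<in> I \<Longrightarrow> g' i (\<eta>' i) = translate m (\<eta>' i)" and g'G: "g' \<in> carrier G"
    using g' by (auto simp: frobenius_def)
  obtain h where h: "h \<in> carrier G" "\<And>i. i \<in> I \<Longrightarrow> h i (\<eta> i) = \<eta>' i"
    using F_torsor[OF \<eta>(1) \<eta>'(1)] by blast
  have "g' \<otimes>\<^bsub>G\<^esub> h = h \<otimes>\<^bsub>G\<^esub> g"
  proof (rule F_unique[OF \<eta>(1) G_mult_closed[OF g'G h(1)] G_mult_closed[OF h(1) gG]])
    fix i assume i: "i \<in> I"
    have "\<eta> i \<in> Y i"
      using \<eta>(1) i by (simp add: F_iff)
    then show "(g' \<otimes>\<^bsub>G\<^esub> h) i (\<eta> i) = (h \<otimes>\<^bsub>G\<^esub> g) i (\<eta> i)"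
      using i \<eta>(2) \<eta>'(2) h(2) gal_translate[OF i GD(2)[OF h(1) i]]
      by (simp add: G_mult_apply g'G h(1) gG)
  qed
  then have "\<chi> g' + \<chi> h = \<chi> h + \<chi> g"
    using H1D(2)[OF \<chi> g'G h(1)] H1D(2)[OF \<chi> h(1) gG] by simp
  then show ?thesis
    by (simp add: add.commute)
qed

lemma frob_eval_eq:
  fixes \<chi> :: "'a gal_elem \<Rightarrow> 'p::prime_card mod_ring"
  assumes g: "g \<in> frobenius m x" and \<chi>: "\<chi> \<in> carrier (H1 X x0 R)"
  shows "frob_eval m x \<chi> = \<chi> g"
  unfolding frob_eval_def by (rule frobenius_value[OF someI[of "\<lambda>g. g \<in> frobenius m x", OF g] g \<chi>])

lemma frob_eval_linear:
  fixes \<chi> \<psi> :: "'a gal_elem \<Rightarrow> 'p::prime_card mod_ring"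
  assumes "x \<in> X" "translate m x = x"
  shows "frob_eval m x (\<chi> \<oplus>\<^bsub>H1 X x0 R\<^esub> \<psi>) = frob_eval m x \<chi> + frob_eval m x \<psi>"
    and "frob_eval m x (a \<odot>\<^bsub>H1 X x0 R\<^esub> \<chi>) = a * frob_eval m x \<chi>"
proof -
  have "(SOME g. g \<in> frobenius m x) \<in> carrier G"
    using frobenius_nonempty[OF assms] by (metis (mono_tags, lifting) all_not_in_conv frobenius_def mem_Collect_eq someI)
  then show "frob_eval m x (\<chi> \<oplus>\<^bsub>H1 X x0 R\<^esub> \<psi>) = frob_eval m x \<chi> + frob_eval m x \<psi>"
    "frob_eval m x (a \<odot>\<^bsub>H1 X x0 R\<^esub> \<chi>) = a * frob_eval m x \<chi>"
    by (simp_all add: frob_eval_def)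
qed

text \<open>Deck transformations commute with the shift, so the same element works for the
  translated family.\<close>

lemma frobenius_translate:
  assumes g: "g \<in> frobenius m x"
  shows "g \<in> frobenius m (translate k x)"
proof -
  obtain \<eta> where \<eta>: "\<eta> \<in> F x" "\<And>i. i \<in> I \<Longrightarrow> g i (\<eta> i) = translate m (\<eta> i)" and gG: "g \<in> carrier G"
    using g by (auto simp: frobenius_def)
  have "g i (translate k (\<eta> i)) = translate m (translate k (\<eta> i))" if i: "i \<in> I" for i
    using gal_translate[OF i GD(2)[OF gG i], of "\<eta> i" k] \<eta> i by (simp add: F_iff add.commute)
  then show ?thesis
    using F_translate[OF \<eta>(1), of k] gG by (auto simp: frobenius_def intro!: bexI[of _ "\<lambda>i\<in>I. translate k (\<eta> i)"])
qed

lemma frob_eval_translate: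
  fixes \<chi> :: "'a gal_elem \<Rightarrow> 'p::prime_card mod_ring"
  assumes "x \<in> X" "translate m x = x" "\<chi> \<in> carrier (H1 X x0 R)"
  shows "frob_eval m (translate k x) \<chi> = frob_eval m x \<chi>"
proof -
  obtain g where "g \<in> frobenius m x"
    using frobenius_nonempty[OF assms(1,2)] by blast
  then show ?thesis
    using frob_eval_eq[OF _ assms(3)] frobenius_translate by metis
qed

text \<open>\<beta> maps Frobenius elements at x to Frobenius elements at f x, and
  \<open>upsilon\<close> composes with the inverse of \<beta>.\<close>

lemma frob_eval_upsilon:
  fixes \<chi> :: "'a gal_elem \<Rightarrow> 'p::prime_card mod_ring"
  assumes f: "topological_conjugacy X X f" and x: "x \<in> X" "translate m x = x" and \<chi>: "\<chi> \<in> carrier (H1 X x0 R)"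
  shows "frob_eval m (f x) (upsilon X x0 R f \<chi>) = frob_eval m x \<chi>"
proof -
  obtain \<xi> where t: "absolute_galois_twist X x0 R f \<xi>"
    and u: "upsilon X x0 R f \<chi> = (\<lambda>g\<in>carrier G. \<chi> (absolute_galois_twist.beta_inv X x0 R f \<xi> g))"
    using upsilon_eq[OF f] by metis
  interpret t: absolute_galois_twist X x0 R f \<xi>
    by (rule t)
  obtain g where g: "g \<in> frobenius m x"
    using frobenius_nonempty[OF x] by blast
  then obtain \<eta> where \<eta>: "\<eta> \<in> F x" "\<And>i. i \<in> I \<Longrightarrow> g i (\<eta> i) = translate m (\<eta> i)" and gG: "g \<in> carrier G"
    by (auto simp: frobenius_def)
  have "t.\<beta> g \<in> frobenius m (f x)"
    using t.F_twist[OF \<eta>(1)] t.beta_frobenius[OF gG \<eta>] t.beta_closed[OF gG]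
    by (auto simp: frobenius_def intro!: bexI[of _ "\<lambda>i\<in>I. t.\<theta> i (\<eta> (t.\<tau> i))"])
  then have "frob_eval m (f x) (upsilon X x0 R f \<chi>) = upsilon X x0 R f \<chi> (t.\<beta> g)"
    by (rule frob_eval_eq[OF _ upsilon_closed[OF f \<chi>]])
  also have "\<dots> = \<chi> g"
    by (simp add: u t.beta_closed gG t.beta_inv_beta)
  also have "\<dots> = frob_eval m x \<chi>"
    by (rule frob_eval_eq[OF g \<chi>, symmetric])
  finally show ?thesis .
qed

end

section \<open>Skew products\<close>

text \<open>The letters of the skew product are pairs; \<open>enc\<close> numbers them because
  pointed Galois factors have natural numbers as letters.\<close>

locale skew_product =
  fixes X :: "'a point set" and c :: "'a point \<Rightarrow> 'p::prime_card mod_ring" and A :: "'a set"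
    and enc :: "'a \<times> 'p mod_ring \<Rightarrow> nat" and m :: int
  assumes irr: "irreducible_sft X" and A: "shift_space A X"
    and enc: "inj_on enc (A \<times> UNIV)" and m: "0 \<le> m"
    and c_local: "\<And>x z. agree {0..m} x z \<Longrightarrow> c x = c z"
begin

text \<open>g is a discrete antiderivative of c along the orbit of x; the constant of integration is
  the group coordinate on which rotations act.\<close>

definition cocycle :: "'a point \<Rightarrow> (int \<Rightarrow> 'p mod_ring) \<Rightarrow> bool" where
  "cocycle x g \<longleftrightarrow> (\<forall>i. g (i + 1) = g i + c (translate i x))"

definition pair :: "'a point \<Rightarrow> (int \<Rightarrow> 'p mod_ring) \<Rightarrow> nat point" where
  "pair x g = (\<lambda>i. enc (x i, g i))"

definition Y :: "nat point set" where
  "Y = {pair x g | x g. x \<in> X \<and> cocycle x g}"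

abbreviation "dec \<equiv> inv_into (A \<times> UNIV) enc"

definition base :: "nat point \<Rightarrow> 'a point" where
  "base y = (\<lambda>i. fst (dec (y i)))"

definition coord :: "nat point \<Rightarrow> int \<Rightarrow> 'p mod_ring" where
  "coord y = (\<lambda>i. snd (dec (y i)))"

definition \<pi> :: "nat point \<Rightarrow> 'a point" where
  "\<pi> = restrict base Y"

definition rot :: "'p mod_ring \<Rightarrow> nat point \<Rightarrow> nat point" where
  "rot t = (\<lambda>y\<in>Y. pair (base y) (\<lambda>i. coord y i + t))"

lemma sub: "subshift X"
  using irr by (rule irreducible_subshift)

lemma letters: "x \<in> X \<Longrightarrow> x i \<in> A"
  using A by (auto simp: shift_space_def)

lemma pair_decode: "x \<in> X \<Longrightarrow> base (pair x g) = x" "x \<in> X \<Longrightarrow> coord (pair x g) = g"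
  using letters enc by (simp_all add: base_def coord_def pair_def)

lemma pair_mem: "x \<in> X \<Longrightarrow> cocycle x g \<Longrightarrow> pair x g \<in> Y"
  unfolding Y_def by blast

lemma Y_cases:
  assumes "y \<in> Y"
  obtains x g where "x \<in> X" "cocycle x g" "y = pair x g"
  using assms unfolding Y_def by blast

lemma translate_pair: "translate k (pair x g) = pair (translate k x) (\<lambda>i. g (i + k))"
  by (simp add: translate_def pair_def)

lemma cocycle_translate: "cocycle x g \<Longrightarrow> cocycle (translate k x) (\<lambda>i. g (i + k))"
  by (simp add: cocycle_def) (metis add.assoc add.commute)

lemma cocycle_shift: "cocycle x g \<Longrightarrow> cocycle x (\<lambda>i. g i + t)"
  by (simp add: cocycle_def)

lemma cocycle_exists: "\<exists>g. cocycle x g \<and> g i0 = a"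
proof -
  \<comment> \<open>The sum forwards from 0 minus the sum backwards to 0; for each i at least one of
    the index sets is empty.\<close>
  define g where "g = (\<lambda>i. (\<Sum>j\<in>{0..<i}. c (translate j x)) - (\<Sum>j\<in>{i..<0}. c (translate j x)))"
  have "g (i + 1) = g i + c (translate i x)" for i
  proof (cases "0 \<le> i")
    case True
    then have "{0..<i + 1} = insert i {0..<i}"
      by auto
    with True show ?thesis
      by (simp add: g_def)
  next
    case False
    then have "{i..<0} = insert i {i + 1..<0}"
      by auto
    with False show ?thesis
      by (simp add: g_def)
  qed
  then have "cocycle x g"
    by (simp add: cocycle_def)
  then have "cocycle x (\<lambda>i. g i + (a - g i0))"
    by (rule cocycle_shift)
  then show ?thesis
    by (intro exI[of _ "\<lambda>i. g i + (a - g i0)"]) simp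
qed

lemma cocycle_forward:
  assumes g: "cocycle x g" "cocycle x' g'" and ag: "\<And>j. j \<ge> a \<Longrightarrow> x j = x' j" and i: "i \<ge> a"
  shows "g i - g' i = g a - g' a"
  using i
proof (induction i rule: int_ge_induct)
  case (step i)
  have "c (translate i x) = c (translate i x')"
    by (rule c_local) (use ag step in \<open>auto simp: agree_def translate_def\<close>)
  then show ?case
    using g step by (simp add: cocycle_def)
qed simp

text \<open>The function c reads up to m letters to the right. Going backwards from a, agreement is
  therefore demanded up to a + m, in contrast to the forward direction.\<close>

lemma cocycle_backward:
  assumes g: "cocycle x g" "cocycle x' g'" and ag: "\<And>j. j \<le> a + m \<Longrightarrow> x j = x' j" and i: "i \<le> a"
  shows "g i - g' i = g a - g' a"
  using i
proof (induction i rule: int_le_induct)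
  case (step i)
  have "c (translate (i - 1) x) = c (translate (i - 1) x')"
    by (rule c_local) (use ag step in \<open>auto simp: agree_def translate_def\<close>)
  moreover have "g i = g (i - 1) + c (translate (i - 1) x)" "g' i = g' (i - 1) + c (translate (i - 1) x')"
    using g unfolding cocycle_def by (metis diff_add_cancel)+
  ultimately show ?case
    using step by simp
qed simp

lemma cocycle_unique:
  assumes "cocycle x g" "cocycle x g'"
  shows "g i = g' i + (g a - g' a)"
proof (cases "i \<ge> a")
  case True
  then show ?thesis
    using cocycle_forward[OF assms, of a i] by (simp add: algebra_simps)
next
  case False
  then show ?thesis
    using cocycle_backward[OF assms, of a i] by (simp add: algebra_simps)
qed

lemma Y_sft: "sft Y"
proof -
  have tr: "translate k y \<in> Y" if "y \<in> Y" for k y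
    using that
  proof (rule Y_cases)
    fix x g assume "x \<in> X" "cocycle x g" "y = pair x g"
    then show ?thesis
      using translate_mem[OF sub] cocycle_translate pair_mem by (simp add: translate_pair)
  qed
  have "shift ` Y = Y"
  proof
    show "shift ` Y \<subseteq> Y"
      using tr by (auto simp: shift_eq_translate)
    show "Y \<subseteq> shift ` Y"
    proof
      fix y assume "y \<in> Y"
      then have "y = shift (translate (- 1) y)" "translate (- 1) y \<in> Y"
        using tr by (simp_all add: shift_eq_translate)
      then show "y \<in> shift ` Y"
        by blast
    qed
  qed
  moreover have "finite (enc ` (A \<times> UNIV))"
    using A by (simp add: shift_space_def)
  moreover have "Y \<subseteq> {y. range y \<subseteq> enc ` (A \<times> UNIV)}"
    using letters by (auto simp: Y_def pair_def)
  moreover have "Y \<noteq> {}"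
  proof -
    obtain x where "x \<in> X"
      using A by (auto simp: shift_space_def)
    then show ?thesis
      using cocycle_exists[of x] pair_mem by blast
  qed
  moreover obtain L where L: "0 \<le> L" "step L X"
    using irreducible_step[OF irr] by blast
  \<comment> \<open>A window must contain a test window of X, the letters that c reads at i, and
    position i + 1, since the cocycle equation links i and i + 1.\<close>
  define K where "K = max L m + 1"
  have st: "step K Y"
    unfolding step_def
  proof (intro allI impI)
    fix y assume *: "\<forall>i. \<exists>y'\<in>Y. agree {i..i + K} y y'"
    have loc: "\<exists>x g. x \<in> X \<and> cocycle x g \<and> (\<forall>j\<in>{i..i + K}. y j = enc (x j, g j) \<and> base y j = x j \<and> coord y j = g j)" for i
    proof -
      obtain y' where y': "y' \<in> Y" "agree {i..i + K} y y'"
        using * by blast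
      obtain x g where xg: "x \<in> X" "cocycle x g" "y' = pair x g"
        using Y_cases[OF y'(1)] .
      have "y j = y' j" if "j \<in> {i..i + K}" for j
        using agreeD[OF y'(2) that] .
      then have "\<forall>j\<in>{i..i + K}. y j = enc (x j, g j) \<and> base y j = x j \<and> coord y j = g j"
        using pair_decode[OF xg(1), of g] unfolding xg(3) by (simp add: pair_def base_def coord_def fun_eq_iff)
      with xg(1,2) show ?thesis by blast
    qed
    have "step K X"
      using L(2) by (rule step_mono) (simp add: K_def)
    moreover have "\<exists>x\<in>X. agree {i..i + K} (base y) x" for i
      using loc[of i] by (auto simp: agree_def)
    ultimately have bX: "base y \<in> X"
      unfolding step_def by blast
    have "cocycle (base y) (coord y)"
      unfolding cocycle_def
    proof
      fix i
      obtain x g where xg: "x \<in> X" "cocycle x g" "\<And>j. j \<in> {i..i + K} \<Longrightarrow> base y j = x j \<and> coord y j = g j"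
        using loc[of i] by blast
      have "c (translate i (base y)) = c (translate i x)"
        by (rule c_local) (use xg(3) in \<open>auto simp: agree_def translate_def K_def\<close>)
      moreover have "coord y i = g i" "coord y (i + 1) = g (i + 1)"
        using xg(3) L(1) by (auto simp: K_def)
      ultimately show "coord y (i + 1) = coord y i + c (translate i (base y))"
        using xg(2) by (simp add: cocycle_def)
    qed
    moreover have "y = pair (base y) (coord y)"
    proof
      fix i
      show "y i = pair (base y) (coord y) i"
        using loc[of i] L(1) by (auto simp: pair_def K_def)
    qed
    ultimately show "y \<in> Y"
      using bX pair_mem by metis
  qed
  ultimately have "shift_space (enc ` (A \<times> UNIV)) Y"
    by (intro step_shift_space)
  moreover have "0 \<le> K"
    using L(1) by (simp add: K_def)
  ultimately show ?thesis
    using sft_intro st by blast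
qed

lemma Y_sub: "subshift Y"
  using Y_sft by (rule sft_subshift)

lemma rot_pair: "x \<in> X \<Longrightarrow> cocycle x g \<Longrightarrow> rot t (pair x g) = pair x (\<lambda>i. g i + t)"
  by (simp add: rot_def pair_mem pair_decode)

lemma \<pi>_pair: "x \<in> X \<Longrightarrow> cocycle x g \<Longrightarrow> \<pi> (pair x g) = x"
  by (simp add: \<pi>_def pair_mem pair_decode)

lemma letterwise_sliding_block_code:
  assumes "h \<in> extensional Y" "h \<in> Y \<rightarrow> Z" "\<And>y i. y \<in> Y \<Longrightarrow> h y i = u (y i)"
  shows "sliding_block_code Y Z h"
  unfolding sliding_block_code_iff[OF Y_sub]
proof (intro conjI assms(1,2) exI[of _ 0] ballI)
  show "local_map 0 Y h"
    unfolding local_map_def using assms(3) by (simp add: agree_def)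
  show "h (shift y) = shift (h y)" if "y \<in> Y" for y
    using assms(3)[OF that] assms(3)[OF translate_mem[OF Y_sub that, of 1]]
    by (simp add: shift_eq_translate fun_eq_iff translate_def)
qed simp

lemma \<pi>_sbc: "sliding_block_code Y X \<pi>"
proof (rule letterwise_sliding_block_code)
  show "\<pi> \<in> Y \<rightarrow> X"
    using \<pi>_pair by (auto elim!: Y_cases)
qed (auto simp: \<pi>_def base_def)

lemma \<pi>_surj: "\<pi> ` Y = X"
proof
  show "\<pi> ` Y \<subseteq> X"
    using \<pi>_pair by (auto elim!: Y_cases)
  show "X \<subseteq> \<pi> ` Y"
  proof
    fix x assume x: "x \<in> X"
    obtain g where "cocycle x g"
      using cocycle_exists[of x] by blast
    then have "x = \<pi> (pair x g)" "pair x g \<in> Y"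
      using x \<pi>_pair pair_mem by simp_all
    then show "x \<in> \<pi> ` Y"
      by blast
  qed
qed

text \<open>Two cocycles over x differ by a constant, so the fibre is a single orbit under the
  addition of elements of F_p.\<close>

lemma fibre_card:
  assumes x: "x \<in> X"
  shows "card (fibre Y \<pi> x) = CARD('p mod_ring)"
proof -
  obtain g where g: "cocycle x g"
    using cocycle_exists[of x] by blast
  have "fibre Y \<pi> x = (\<lambda>t. pair x (\<lambda>i. g i + t)) ` UNIV"
  proof
    show "(\<lambda>t. pair x (\<lambda>i. g i + t)) ` UNIV \<subseteq> fibre Y \<pi> x"
      using x pair_mem \<pi>_pair cocycle_shift[OF g] by (auto simp: fibre_def)
    show "fibre Y \<pi> x \<subseteq> (\<lambda>t. pair x (\<lambda>i. g i + t)) ` UNIV"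
    proof
      fix y assume "y \<in> fibre Y \<pi> x"
      then have "y \<in> Y" "\<pi> y = x"
        by (auto simp: fibre_def)
      then obtain g' where g': "cocycle x g'" "y = pair x g'"
        using \<pi>_pair by (metis Y_cases)
      have "g' = (\<lambda>i. g i + (g' 0 - g 0))"
        using cocycle_unique[OF g'(1) g, of _ 0] by blast
      then have "y = pair x (\<lambda>i. g i + (g' 0 - g 0))"
        unfolding g'(2) by (rule arg_cong)
      then show "y \<in> (\<lambda>t. pair x (\<lambda>i. g i + t)) ` UNIV"
        by (rule range_eqI)
    qed
  qed
  moreover have "inj (\<lambda>t. pair x (\<lambda>i. g i + t))"
  proof (rule injI)
    fix s t assume "pair x (\<lambda>i. g i + s) = pair x (\<lambda>i. g i + t)"
    then have "coord (pair x (\<lambda>i. g i + s)) 0 = coord (pair x (\<lambda>i. g i + t)) 0"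
      by simp
    then show "s = t"
      by (simp add: pair_decode[OF x])
  qed
  ultimately show ?thesis
    by (simp add: card_image)
qed

lemma rot_mem: "y \<in> Y \<Longrightarrow> rot t y \<in> Y"
  by (erule Y_cases) (simp add: rot_pair pair_mem cocycle_shift)

lemma rot_rot: "y \<in> Y \<Longrightarrow> rot s (rot t y) = rot (s + t) y"
  by (auto elim!: Y_cases simp: rot_pair cocycle_shift add.assoc add.commute[of s t])

lemma rot_0: "y \<in> Y \<Longrightarrow> rot 0 y = y"
  by (auto elim!: Y_cases simp: rot_pair)

lemma rot_sbc: "sliding_block_code Y Y (rot t)"
proof (rule letterwise_sliding_block_code)
  show "rot t y i = enc (fst (dec (y i)), snd (dec (y i)) + t)" if "y \<in> Y" for y i
    using that by (simp add: rot_def pair_def base_def coord_def)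
  show "rot t \<in> extensional Y"
    by (simp add: rot_def)
  show "rot t \<in> Y \<rightarrow> Y"
    using rot_mem by blast
qed

lemma rot_rel_aut: "rot t \<in> carrier (rel_aut Y \<pi>)"
proof -
  have "bij_betw (rot t) Y Y"
    by (rule bij_betwI[of _ _ _ "rot (- t)"]) (auto simp: rot_mem rot_rot rot_0)
  moreover have "\<pi> (rot t y) = \<pi> y" if "y \<in> Y" for y
    using that by (auto elim!: Y_cases simp: rot_pair \<pi>_pair cocycle_shift)
  ultimately show ?thesis
    using rot_sbc by (simp add: rel_aut_iff topological_conjugacy_def)
qed

section \<open>Irreducibility of the skew product\<close>

lemma rot_translate: "y \<in> Y \<Longrightarrow> rot t (translate k y) = translate k (rot t y)"
  by (rule sliding_block_code_translate[OF Y_sub rot_sbc])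

lemma rot_apply: "y \<in> Y \<Longrightarrow> rot t y i = enc (fst (dec (y i)), snd (dec (y i)) + t)"
  by (simp add: rot_def pair_def base_def coord_def)

text \<open>The first connecting point shows y' from position 0 on and the second one shows it up to
  L: an overlap of L + 1 letters, as gluing requires.\<close>

lemma reach_trans:
  assumes L: "step L Y" and 1: "reach Y n 0 y y'" and 2: "reach Y L n' y' y''" and L0: "0 \<le> L"
  shows "reach Y n n' y y''"
proof -
  obtain z1 l1 where z1: "z1 \<in> Y" "n + 1 < l1" "\<And>i. i \<le> n \<Longrightarrow> z1 i = y i" "\<And>i. i \<ge> 0 \<Longrightarrow> z1 (i + l1) = y' i"
    using 1 unfolding reach_def by auto
  obtain z2 l2 where z2: "z2 \<in> Y" "L + 1 < n' + l2" "\<And>i. i \<le> L \<Longrightarrow> z2 i = y' i" "\<And>i. i \<ge> n' \<Longrightarrow> z2 (i + l2) = y'' i"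
    using 2 unfolding reach_def by auto
  define z where "z = glue l1 z1 (translate (- l1) z2)"
  have "agree {l1..l1 + L} z1 (translate (- l1) z2)"
    unfolding agree_def
  proof
    fix i assume i: "i \<in> {l1..l1 + L}"
    then show "z1 i = translate (- l1) z2 i"
      using z1(4)[of "i - l1"] z2(3)[of "i - l1"] by (simp add: translate_def)
  qed
  then have "z \<in> Y"
    unfolding z_def by (rule glue_mem[OF L z1(1) translate_mem[OF Y_sub z2(1)]])
  moreover have "z i = y i" if "i \<le> n" for i
    using that z1(2,3) by (simp add: z_def glue_def)
  moreover have "z (i + (l1 + l2)) = y'' i" if i: "i \<ge> n'" for i
  proof -
    have "\<not> i + (l1 + l2) < l1"
      using i z2(2) L0 by simp
    then show ?thesis
      using z2(4)[OF i] by (simp add: z_def glue_def translate_def algebra_simps)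
  qed
  moreover have "n + 1 < n' + (l1 + l2)"
    using z1(2) z2(2) L0 by simp
  ultimately show ?thesis
    unfolding reach_def by blast
qed

lemma reach_rot:
  assumes "reach Y n n' y y'" and y: "y \<in> Y" "y' \<in> Y"
  shows "reach Y n n' (rot t y) (rot t y')"
proof -
  obtain z l where z: "z \<in> Y" "n + 1 < n' + l" "\<And>i. i \<le> n \<Longrightarrow> z i = y i" "\<And>i. i \<ge> n' \<Longrightarrow> z (i + l) = y' i"
    using assms(1) unfolding reach_def by blast
  have "rot t z i = rot t y i" if "i \<le> n" for i
    using z(1,3) y that by (simp add: rot_apply)
  moreover have "rot t z (i + l) = rot t y' i" if "i \<ge> n'" for i
    using z(1,4) y that by (simp add: rot_apply)
  ultimately show ?thesis
    using z(2) rot_mem[OF z(1)] unfolding reach_def by blast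
qed

text \<open>A connecting point of X carries a cocycle that is correct at the start; at the arrival
  it differs from g' by a constant, which a rotation of y' absorbs.\<close>

lemma reach_some_rot:
  assumes y: "y \<in> Y" and y': "y' \<in> Y"
  shows "\<exists>t. reach Y n n' y (rot t y')"
proof -
  obtain x g where x: "x \<in> X" "cocycle x g" "y = pair x g"
    using Y_cases[OF y] .
  obtain x' g' where x': "x' \<in> X" "cocycle x' g'" "y' = pair x' g'"
    using Y_cases[OF y'] .
  \<comment> \<open>The point z follows x for m letters beyond n, because the cocycle up to n
    depends on these letters.\<close>
  obtain z l where z: "z \<in> X" "n + m + 1 < n' + l" "\<And>i. i \<le> n + m \<Longrightarrow> z i = x i" "\<And>i. i \<ge> n' \<Longrightarrow> z (i + l) = x' i"
    using irreducible_reach[OF irr x(1) x'(1), of "n + m" n'] unfolding reach_def by blast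
  obtain h where h: "cocycle z h" "h n = g n"
    using cocycle_exists[of z n "g n"] by blast
  define t where "t = h (n' + l) - g' n'"
  have "pair z h i = y i" if "i \<le> n" for i
    using cocycle_backward[OF h(1) x(2), of n i] z(3) that h(2) m by (simp add: x(3) pair_def)
  moreover have "pair z h (i + l) = rot t y' i" if i: "i \<ge> n'" for i
  proof -
    have "h (i + l) - g' i = h (n' + l) - g' n'"
      using cocycle_forward[OF cocycle_translate[OF h(1), of l] x'(2), of n' i] z(4) i by (simp add: translate_def)
    then have "h (i + l) = g' i + t"
      by (simp add: t_def algebra_simps)
    then show ?thesis
      using z(4)[OF i] unfolding x'(3) rot_pair[OF x'(1,2)] by (simp add: pair_def)
  qed
  moreover have "n + 1 < n' + l"
    using z(2) m by simp
  ultimately show ?thesis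
    using pair_mem[OF z(1) h(1)] unfolding reach_def by blast
qed

text \<open>One period along x rotates \<open>pair x g\<close> by 1, and 1 generates the additive
  group of F_p. A path through this point can therefore make as many rounds as are needed to correct
  the rotation by which it would miss its end.\<close>

lemma irreducible_Y:
  assumes x: "x \<in> X" "translate P x = x" "P > 0" and g: "cocycle x g" and gP: "g P = g 0 + 1"
  shows "irreducible_sft Y"
proof (rule irreducible_intro[OF Y_sft])
  fix y y' n n' assume y: "y \<in> Y" and y': "y' \<in> Y"
  obtain L where L: "0 \<le> L" "step L Y"
    using sft_step[OF Y_sft] by blast
  let ?w = "pair x g"
  have w: "?w \<in> Y"
    by (rule pair_mem[OF x(1) g])
  have trw: "translate P ?w = rot 1 ?w"
  proof -
    have "g (i + P) = g i + 1" for i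
      using cocycle_unique[OF cocycle_translate[OF g, of P, unfolded x(2)] g, of i 0] gP by simp
    then show ?thesis
      by (simp add: translate_pair x(2) rot_pair[OF x(1) g])
  qed
  have iter: "translate (int k * P) ?w = rot (of_nat k) ?w" for k
  proof (induction k)
    case 0
    then show ?case
      using w by (simp add: rot_0)
  next
    case (Suc k)
    have "translate (int (Suc k) * P) ?w = translate (int k * P) (translate P ?w)"
      by (simp add: algebra_simps)
    also have "\<dots> = rot 1 (translate (int k * P) ?w)"
      unfolding trw using rot_translate[OF w] by simp
    also have "\<dots> = rot (of_nat (Suc k)) ?w"
      unfolding Suc.IH using rot_rot[OF w] by simp
    finally show ?case .
  qed
  have loop: "reach Y n0 n1 ?w (rot t ?w)" for n0 n1 t
  proof -
    define p where "p = CARD('p)"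
    have "0 \<le> to_int_mod_ring t"
      using range_to_int_mod_ring[where 'a = 'p] by (metis atLeastLessThan_iff rangeI)
    then obtain k0 :: nat where k0: "of_nat k0 = t"
      using of_nat_of_int_mod_ring[where 'a = 'p] of_int_mod_ring_to_int_mod_ring[of t] by (metis comp_apply nonneg_int_cases)
    \<comment> \<open>k0 rounds rotate by t; the added multiple of p leaves the rotation unchanged
      and makes the path long enough for the required gap.\<close>
    define k where "k = k0 + p * nat (\<bar>n0\<bar> + \<bar>n1\<bar> + 2)"
    have "(of_nat p :: 'p mod_ring) = 0"
      unfolding p_def by (rule of_nat_card_eq_0)
    then have "of_nat k = t"
      by (simp add: k_def k0)
    then have tr: "translate (int k * P) ?w = rot t ?w"
      using iter[of k] by simp
    have "p > 0"
      by (simp add: p_def)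
    then have "nat (\<bar>n0\<bar> + \<bar>n1\<bar> + 2) \<le> p * nat (\<bar>n0\<bar> + \<bar>n1\<bar> + 2)"
      by simp
    then have "\<bar>n0\<bar> + \<bar>n1\<bar> + 2 \<le> int k"
      unfolding k_def by linarith
    also have "int k \<le> int k * P"
      using x(3) by (simp add: mult_le_cancel_left1)
    finally have "n0 + 1 < n1 + int k * P"
      by linarith
    moreover have "?w (i + int k * P) = rot t ?w i" for i
      using tr by (metis translate_apply)
    ultimately show ?thesis
      unfolding reach_def using w by blast
  qed
  obtain s where s: "reach Y n 0 y (rot s ?w)"
    using reach_some_rot[OF y w] by blast
  obtain t where t: "reach Y L n' ?w (rot t y')"
    using reach_some_rot[OF w y'] by blast
  have "reach Y L n' (rot (- t) ?w) (rot (- t) (rot t y'))"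
    by (rule reach_rot[OF t w rot_mem[OF y']])
  then have t': "reach Y L n' (rot (- t) ?w) y'"
    by (simp add: rot_rot[OF y'] rot_0[OF y'])
  have "reach Y L 0 (rot s ?w) (rot s (rot (- t - s) ?w))"
    by (rule reach_rot[OF loop w rot_mem[OF w]])
  then have "reach Y L 0 (rot s ?w) (rot (- t) ?w)"
    by (simp add: rot_rot[OF w])
  then have "reach Y n 0 y (rot (- t) ?w)"
    using reach_trans[OF L(2) s _ L(1)] by blast
  then show "reach Y n n' y y'"
    using reach_trans[OF L(2) _ t' L(1)] by blast
qed

text \<open>The rotations act simply transitively on each fibre. A deck transformation agrees with
  one of them at a point, hence everywhere, so there are as many as the degree.\<close>

lemma galois:
  assumes Y: "irreducible_sft Y"
  shows "galois_factor Y X \<pi>"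
    and "\<phi> \<in> carrier (rel_aut Y \<pi>) \<Longrightarrow> \<exists>t. \<phi> = rot t"
proof -
  have un: "unramified Y X \<pi>"
    unfolding unramified_def factor_map_def using Y irr \<pi>_sbc \<pi>_surj fibre_card
    by (auto intro!: exI[of _ "CARD('p mod_ring)"] simp: Suc_le_eq card_gt_0_iff)
  have X: "X \<noteq> {}"
    using A by (simp add: shift_space_def)
  then obtain x where x: "x \<in> X"
    by blast
  obtain g where g: "cocycle x g"
    using cocycle_exists[of x] by blast
  note yx = pair_mem[OF x g]
  show rot: "\<exists>t. \<phi> = rot t" if \<phi>: "\<phi> \<in> carrier (rel_aut Y \<pi>)" for \<phi>
  proof -
    have "\<phi> (pair x g) \<in> Y" "\<pi> (\<phi> (pair x g)) = x"
      using \<phi> yx \<pi>_pair[OF x g] by (auto simp: rel_aut_iff dest: conjugacyD(6))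
    then obtain g' where g': "cocycle x g'" "\<phi> (pair x g) = pair x g'"
      using \<pi>_pair by (metis Y_cases)
    have "g' = (\<lambda>i. g i + (g' 0 - g 0))"
      using cocycle_unique[OF g'(1) g, of _ 0] by blast
    then have "\<phi> (pair x g) = rot (g' 0 - g 0) (pair x g)"
      using g'(2) by (simp add: rot_pair[OF x g])
    then show ?thesis
      using rel_aut_eqI[OF un \<phi> rot_rel_aut yx] by blast
  qed
  have "carrier (rel_aut Y \<pi>) = range rot"
    using rot rot_rel_aut by blast
  moreover have "inj rot"
  proof (rule injI)
    fix s t assume "rot s = rot t"
    then have "coord (rot s (pair x g)) 0 = coord (rot t (pair x g)) 0"
      by simp
    then show "s = t"
      by (simp add: rot_pair[OF x g] pair_decode[OF x])
  qed
  ultimately have "card (carrier (rel_aut Y \<pi>)) = CARD('p mod_ring)"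
    by (simp add: card_image)
  then show "galois_factor Y X \<pi>"
    using un factor_degree[OF un X x] fibre_card[OF x] by (simp add: galois_factor_def)
qed

end

context absolute_galois
begin

text \<open>The character sends an element of the absolute Galois group to the amount by which it translates
  the group coordinate of the skew product.\<close>

lemma skew_product_character:
  fixes c :: "'a point \<Rightarrow> 'p::prime_card mod_ring"
  assumes m: "0 \<le> m" and c_local: "\<And>x z. agree {0..m} x z \<Longrightarrow> c x = c z"
    and w: "w \<in> X" "translate P w = w" "P > 0" and cw: "(\<Sum>j\<in>{0..<P}. c (translate j w)) = 1"
  shows "\<exists>\<chi>\<in>carrier (H1 X x0 R). \<forall>x\<in>X. \<forall>n\<ge>0. translate n x = x \<longrightarrow>
           frob_eval n x \<chi> = (\<Sum>j\<in>{0..<n}. c (translate j x))"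
proof -
  obtain A where A: "shift_space A X"
    using sub by (auto simp: subshift_def)
  then have "countable (A \<times> (UNIV :: 'p mod_ring set))"
    by (simp add: shift_space_def countable_finite)
  then obtain enc :: "'a \<times> 'p mod_ring \<Rightarrow> nat" where enc: "inj_on enc (A \<times> UNIV)"
    by (rule countableE)
  interpret s: skew_product X c A enc m
    using irr A enc m c_local by unfold_locales
  have incr: "g n = g 0 + (\<Sum>j\<in>{0..<n}. c (translate j x))" if g: "s.cocycle x g" and n: "n \<ge> 0" for g n x
    using n
  proof (induction n rule: int_ge_induct)
    case (step i)
    then have "{0..<i + 1} = insert i {0..<i}"
      by auto
    with step g show ?case
      by (simp add: s.cocycle_def)
  qed simp
  obtain gw where gw: "s.cocycle w gw"
    using s.cocycle_exists[of w] by blast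
  have Yirr: "irreducible_sft s.Y"
    using s.irreducible_Y[OF w gw] incr[OF gw, of P] w(3) cw by simp
  note gal = s.galois(1)[OF Yirr]
  obtain y0 where y0: "y0 \<in> s.Y" "s.\<pi> y0 = x0"
    using s.\<pi>_surj x0 by (metis imageE)
  define P where "P = (s.Y, y0, s.\<pi>)"
  have P: "P \<in> pointed_galois_factors X x0"
    using gal y0 by (simp add: pointed_galois_factors_def P_def)
  define i where "i = cls P"
  have i: "i \<in> I"
    unfolding i_def by (rule cls_mem[OF P])
  obtain \<theta> where "pointed_conjugacy (R i) P \<theta>"
    using rep_conjugacy[OF P] unfolding i_def by blast
  note \<theta> = pointed_conjugacyD[OF this, unfolded P_def, simplified]
  note inv = conj_inv_apply[OF \<theta>(1)] and \<theta>m = conjugacyD(6)[OF \<theta>(1)]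
  have D: "\<exists>t. \<forall>y\<in>Y i. \<theta> (g i y) = s.rot t (\<theta> y)" if g: "g \<in> carrier G" for g
  proof -
    have "(\<lambda>y\<in>s.Y. \<theta> (g i (inv_into (Y i) \<theta> y))) \<in> carrier (rel_aut s.Y s.\<pi>)"
      by (rule rel_aut_conjugate[OF rep(6)[OF i] s.Y_sub \<theta>(1), where u = "\<lambda>x. x" and \<rho> = "q i"])
        (use \<theta>(3) GD(2)[OF g i] in \<open>simp_all add: gal_def\<close>)
    then obtain t where t: "(\<lambda>y\<in>s.Y. \<theta> (g i (inv_into (Y i) \<theta> y))) = s.rot t"
      using s.galois(2)[OF Yirr] by blast
    have "\<theta> (g i y) = s.rot t (\<theta> y)" if y: "y \<in> Y i" for y
      using fun_cong[OF t, of "\<theta> y"] \<theta>m[OF y] inv(1)[OF y] by simp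
    then show ?thesis by blast
  qed
  \<comment> \<open>The amount of rotation is the same at all points, so it is read off at the base
    point and at coordinate 0.\<close>
  define \<chi> where "\<chi> = (\<lambda>g. s.coord (\<theta> (g i (b i))) 0 - s.coord (\<theta> (b i)) 0)"
  have coord_rot: "s.coord (s.rot t y) 0 = s.coord y 0 + t" if "y \<in> s.Y" for t y
    using that by (auto elim!: s.Y_cases simp: s.rot_pair s.pair_decode)
  have \<chi>: "\<theta> (g i y) = s.rot (\<chi> g) (\<theta> y)" if g: "g \<in> carrier G" and y: "y \<in> Y i" for g y
  proof -
    obtain t where t: "\<forall>y\<in>Y i. \<theta> (g i y) = s.rot t (\<theta> y)"
      using D[OF g] by blast
    then have "\<chi> g = t"
      using rep(2)[OF i] coord_rot[OF \<theta>m[OF rep(2)[OF i]]] by (simp add: \<chi>_def)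
    then show ?thesis
      using t y by simp
  qed
  have "(\<lambda>g\<in>carrier G. \<chi> g) \<in> carrier (H1 X x0 R)"
  proof (rule H1_intro)
    fix g h assume g: "g \<in> carrier G" and h: "h \<in> carrier G"
    note bi = rep(2)[OF i]
    have "\<theta> ((g \<otimes>\<^bsub>G\<^esub> h) i (b i)) = s.rot (\<chi> g + \<chi> h) (\<theta> (b i))"
      using \<chi>[OF g GD(4)[OF h i bi]] \<chi>[OF h bi] s.rot_rot[OF \<theta>m[OF bi]]
      by (simp add: G_mult_apply[OF g h i bi])
    then show "\<chi> (g \<otimes>\<^bsub>G\<^esub> h) = \<chi> g + \<chi> h"
      using coord_rot[OF \<theta>m[OF bi]] by (simp add: \<chi>_def)
  next
    have "continuous_map (abs_gal_top X x0 R) (discrete_topology UNIV)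
        ((\<lambda>\<phi>. s.coord (\<theta> (\<phi> (b i))) 0 - s.coord (\<theta> (b i)) 0) \<circ> (\<lambda>g. g i))"
      by (rule continuous_map_compose[OF continuous_map_component[OF i]]) simp
    then show "continuous_map (abs_gal_top X x0 R) (discrete_topology UNIV) \<chi>"
      by (simp add: comp_def \<chi>_def)
  qed
  moreover have "frob_eval n x (\<lambda>g\<in>carrier G. \<chi> g) = (\<Sum>j\<in>{0..<n}. c (translate j x))"
    if x: "x \<in> X" and n: "n \<ge> 0" and per: "translate n x = x" for x n
  proof -
    obtain g where g: "g \<in> frobenius n x"
      using frobenius_nonempty[OF x per] by blast
    then obtain \<eta> where \<eta>: "\<eta> \<in> F x" "\<And>i. i \<in> I \<Longrightarrow> g i (\<eta> i) = translate n (\<eta> i)" and gG: "g \<in> carrier G"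
      by (auto simp: frobenius_def)
    have \<eta>i: "\<eta> i \<in> Y i" "q i (\<eta> i) = x"
      using \<eta>(1) i by (simp_all add: F_iff)
    define y where "y = \<theta> (\<eta> i)"
    have y: "y \<in> s.Y" "s.\<pi> y = x"
      using \<theta>m[OF \<eta>i(1)] \<theta>(3)[OF \<eta>i(1)] \<eta>i(2) by (simp_all add: y_def)
    obtain h where h: "s.cocycle x h" "y = s.pair x h"
      using y s.\<pi>_pair by (metis s.Y_cases)
    \<comment> \<open>The Frobenius element acts on this point both as a rotation and as translation
      by n; comparing group coordinates at 0 yields the increment of the cocycle over n
      steps.\<close>
    have "s.rot (\<chi> g) y = translate n y"
      using \<chi>[OF gG \<eta>i(1)] \<eta>(2)[OF i] sliding_block_code_translate[OF rep(6)[OF i] conjugacyD(1)[OF \<theta>(1)] \<eta>i(1)]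
      by (simp add: y_def)
    then have "s.coord y 0 + \<chi> g = s.coord (translate n y) 0"
      using coord_rot[OF y(1)] by metis
    also have "s.coord (translate n y) 0 = h n"
      using per x by (simp add: h(2) s.translate_pair s.pair_decode)
    finally have "h 0 + \<chi> g = h n"
      using x by (simp add: h(2) s.pair_decode)
    then have "\<chi> g = (\<Sum>j\<in>{0..<n}. c (translate j x))"
      using incr[OF h(1) n] by simp
    then show ?thesis
      using frob_eval_eq[OF g \<open>(\<lambda>g\<in>carrier G. \<chi> g) \<in> carrier (H1 X x0 R)\<close>] gG by simp
  qed
  ultimately show ?thesis
    by blast
qed

end

section \<open>Endomorphisms in coordinates\<close>

locale class_vectorspace =
  fixes V :: "('k::field, 'v) module" (structure)
  assumes vs: "vectorspace class_ring V"

sublocale class_vectorspace \<subseteq> vectorspace class_ring V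
  by (rule vs)

context class_vectorspace
begin

text \<open>Coefficients are indexed by positions in the list rather than by vectors, to match the
  columns in \<open>matrix_wrt\<close>.\<close>

definition lin :: "'v list \<Rightarrow> (nat \<Rightarrow> 'k) \<Rightarrow> 'v" where
  "lin bs a = (\<Oplus>\<^bsub>V\<^esub>i\<in>{..<length bs}. a i \<odot>\<^bsub>V\<^esub> (bs ! i))"

lemma smult_mem: "x \<in> carrier V \<Longrightarrow> a \<odot> x \<in> carrier V"
  by (rule smult_closed) simp_all

lemma smult_add_left: "x \<in> carrier V \<Longrightarrow> (a + b) \<odot> x = a \<odot> x \<oplus> b \<odot> x"
  using smult_l_distr[of a b x] by simp

lemma smult_add_right: "x \<in> carrier V \<Longrightarrow> y \<in> carrier V \<Longrightarrow> a \<odot> (x \<oplus> y) = a \<odot> x \<oplus> a \<odot> y"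
  using smult_r_distr[of a x y] by simp

lemma smult_mult: "x \<in> carrier V \<Longrightarrow> (a * b) \<odot> x = a \<odot> (b \<odot> x)"
  using smult_assoc1[of a b x] by simp

lemma smult_1: "x \<in> carrier V \<Longrightarrow> 1 \<odot> x = x"
  using smult_one[of x] by simp

lemma nth_carrier [simp]: "set bs \<subseteq> carrier V \<Longrightarrow> i < length bs \<Longrightarrow> bs ! i \<in> carrier V"
  by (meson nth_mem subsetD)

lemma lin_closed: "set bs \<subseteq> carrier V \<Longrightarrow> lin bs a \<in> carrier V"
  unfolding lin_def by (intro M.finsum_closed) (auto intro!: smult_mem)

lemma lin_cong: "(\<And>i. i < length bs \<Longrightarrow> a i = a' i) \<Longrightarrow> set bs \<subseteq> carrier V \<Longrightarrow> lin bs a = lin bs a'"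
  unfolding lin_def by (intro M.finsum_cong') (auto intro!: smult_mem)

lemma lin_add:
  assumes "set bs \<subseteq> carrier V"
  shows "lin bs (\<lambda>i. a i + a' i) = lin bs a \<oplus> lin bs a'"
proof -
  have "lin bs (\<lambda>i. a i + a' i) = (\<Oplus>\<^bsub>V\<^esub>i\<in>{..<length bs}. a i \<odot>\<^bsub>V\<^esub> (bs ! i) \<oplus> a' i \<odot>\<^bsub>V\<^esub> (bs ! i))"
    unfolding lin_def using assms smult_l_distr
    by (intro M.finsum_cong') (auto intro!: smult_mem M.add.m_closed simp: subset_iff)
  also have "\<dots> = lin bs a \<oplus> lin bs a'"
    unfolding lin_def using assms by (intro M.finsum_addf) (auto intro!: smult_mem)
  finally show ?thesis .
qed

lemma lin_smult:
  assumes "set bs \<subseteq> carrier V"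
  shows "lin bs (\<lambda>i. c * a i) = c \<odot> lin bs a"
proof -
  have "lin bs (\<lambda>i. c * a i) = (\<Oplus>\<^bsub>V\<^esub>i\<in>{..<length bs}. c \<odot> (a i \<odot>\<^bsub>V\<^esub> (bs ! i)))"
    unfolding lin_def using assms smult_assoc1
    by (intro M.finsum_cong') (auto intro!: smult_mem simp: subset_iff)
  also have "\<dots> = c \<odot> lin bs a"
    unfolding lin_def using assms by (intro finsum_smult_ldistr[symmetric]) (auto intro!: smult_mem)
  finally show ?thesis .
qed

lemma smult_zero_left: "x \<in> carrier V \<Longrightarrow> 0 \<odot> x = \<zero>"
  using smult_l_null[of x] by simp

lemma lin_zero: "set bs \<subseteq> carrier V \<Longrightarrow> lin bs (\<lambda>i. 0) = \<zero>"
  unfolding lin_def by (rule M.add.finprod_one_eqI) (auto simp: smult_zero_left)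

lemma lin_sum:
  assumes bs: "set bs \<subseteq> carrier V"
  shows "(\<Oplus>\<^bsub>V\<^esub>i\<in>{..<m::nat}. a i \<odot> lin bs (P i)) = lin bs (\<lambda>k. \<Sum>i<m. P i k * a i)"
proof (induction m)
  case 0
  then show ?case
    by (simp add: lin_zero[OF bs])
next
  case (Suc m)
  have "(\<Oplus>\<^bsub>V\<^esub>i\<in>{..<Suc m}. a i \<odot> lin bs (P i)) = a m \<odot> lin bs (P m) \<oplus> (\<Oplus>\<^bsub>V\<^esub>i\<in>{..<m}. a i \<odot> lin bs (P i))"
    unfolding lessThan_Suc using bs by (intro M.finsum_insert) (auto intro!: smult_mem lin_closed)
  also have "\<dots> = lin bs (\<lambda>k. a m * P m k) \<oplus> lin bs (\<lambda>k. \<Sum>i<m. P i k * a i)"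
    using lin_smult[OF bs] Suc by simp
  also have "\<dots> = lin bs (\<lambda>k. a m * P m k + (\<Sum>i<m. P i k * a i))"
    by (rule lin_add[OF bs, symmetric])
  also have "(\<lambda>k. a m * P m k + (\<Sum>i<m. P i k * a i)) = (\<lambda>k. \<Sum>i<Suc m. P i k * a i)"
    by (simp add: fun_eq_iff ac_simps)
  finally show ?case .
qed

text \<open>The criterion for \<open>basis\<close> speaks of coefficient functions on the set of
  basis vectors; a distinct list identifies them with coefficients indexed by position, and the
  criterion becomes existence and uniqueness of coordinates.\<close>

lemma ordered_basis_iff:
  "ordered_basis V bs \<longleftrightarrow> distinct bs \<and> set bs \<subseteq> carrier V \<and>
     (\<forall>v\<in>carrier V. \<exists>a. lin bs a = v) \<and>
     (\<forall>a a'. lin bs a = lin bs a' \<longrightarrow> (\<forall>i<length bs. a i = a' i))"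
proof (cases "distinct bs \<and> set bs \<subseteq> carrier V")
  case True
  then have d: "distinct bs" and bs: "set bs \<subseteq> carrier V"
    by auto
  have lc: "lincomb a (set bs) = lin bs (\<lambda>i. a (bs ! i))" for a
  proof -
    have "set bs = (\<lambda>i. bs ! i) ` {..<length bs}"
      by (auto simp: set_conv_nth)
    then show ?thesis
      unfolding lincomb_def lin_def using bs d
      by (subst (1) \<open>set bs = _\<close>, intro M.finsum_reindex) (auto intro!: smult_mem simp: inj_on_nth)
  qed
  have ext: "\<exists>b. b \<in> set bs \<rightarrow>\<^sub>E UNIV \<and> (\<forall>i<length bs. b (bs ! i) = a i)" for a :: "nat \<Rightarrow> 'k"
  proof -
    define b where "b = (\<lambda>v\<in>set bs. a (inv_into {..<length bs} ((!) bs) v))"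
    have "inv_into {..<length bs} ((!) bs) (bs ! i) = i" if "i < length bs" for i
      using that d by (intro inv_into_f_f) (auto simp: inj_on_nth)
    then show ?thesis
      by (intro exI[of _ b]) (auto simp: b_def)
  qed
  have "basis (set bs) \<longleftrightarrow> (\<forall>v\<in>carrier V. \<exists>!b. b \<in> set bs \<rightarrow>\<^sub>E UNIV \<and> lincomb b (set bs) = v)"
    unfolding basis_criterion[OF finite_set bs] by (simp add: Ball_def)
  also have "\<dots> \<longleftrightarrow> (\<forall>v\<in>carrier V. \<exists>a. lin bs a = v) \<and>
     (\<forall>a a'. lin bs a = lin bs a' \<longrightarrow> (\<forall>i<length bs. a i = a' i))" (is "?L \<longleftrightarrow> ?R")
  proof
    assume L: ?L
    show ?R
    proof (intro conjI ballI allI impI)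
      show "\<exists>a. lin bs a = v" if "v \<in> carrier V" for v
        using L that lc by metis
      fix a a' i assume eq: "lin bs a = lin bs a'" and i: "i < length bs"
      obtain b where b: "b \<in> set bs \<rightarrow>\<^sub>E UNIV" "\<forall>i<length bs. b (bs ! i) = a i"
        using ext by blast
      obtain b' where b': "b' \<in> set bs \<rightarrow>\<^sub>E UNIV" "\<forall>i<length bs. b' (bs ! i) = a' i"
        using ext by blast
      have "lincomb b (set bs) = lin bs a"
        unfolding lc using b(2) by (intro lin_cong[OF _ bs]) auto
      moreover have "lincomb b' (set bs) = lin bs a"
        unfolding lc eq using b'(2) by (intro lin_cong[OF _ bs]) auto
      ultimately have "b = b'"
        using L lin_closed[OF bs, of a] b(1) b'(1) by metis
      then show "a i = a' i"
        using b(2) b'(2) i by metis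
    qed
  next
    assume R: ?R
    show ?L
    proof
      fix v assume "v \<in> carrier V"
      then obtain a where a: "lin bs a = v"
        using R by blast
      obtain b where b: "b \<in> set bs \<rightarrow>\<^sub>E UNIV" "\<forall>i<length bs. b (bs ! i) = a i"
        using ext by blast
      have "lincomb b (set bs) = v"
        unfolding lc a[symmetric] using b(2) by (intro lin_cong[OF _ bs]) auto
      moreover have "b' = b" if b': "b' \<in> set bs \<rightarrow>\<^sub>E UNIV" "lincomb b' (set bs) = v" for b'
      proof (rule PiE_ext[OF b'(1) b(1)])
        fix w assume "w \<in> set bs"
        then obtain i where "i < length bs" "w = bs ! i"
          by (metis in_set_conv_nth)
        then show "b' w = b w"
          using R b'(2) \<open>lincomb b (set bs) = v\<close> unfolding lc by metis
      qed
      ultimately show "\<exists>!b. b \<in> set bs \<rightarrow>\<^sub>E UNIV \<and> lincomb b (set bs) = v"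
        using b(1) by blast
    qed
  qed
  finally show ?thesis
    using True vs by (simp add: ordered_basis_def)
next
  case False
  then show ?thesis
    by (auto simp: ordered_basis_def basis_def)
qed

lemma ordered_basisD:
  assumes "ordered_basis V bs"
  shows "distinct bs" "set bs \<subseteq> carrier V" "\<And>v. v \<in> carrier V \<Longrightarrow> \<exists>a. lin bs a = v"
    "\<And>a a' i. lin bs a = lin bs a' \<Longrightarrow> i < length bs \<Longrightarrow> a i = a' i"
  using assms unfolding ordered_basis_iff by blast+

lemma matrix_wrt_eqI:
  assumes bs: "ordered_basis V bs" and A: "A \<in> carrier_mat (length bs) (length bs)"
    and T: "\<And>j. j < length bs \<Longrightarrow> T (bs ! j) = lin bs (\<lambda>i. A $$ (i, j))"
  shows "matrix_wrt V bs T = A"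
  unfolding matrix_wrt_def
proof (rule the_equality)
  show "A \<in> carrier_mat (length bs) (length bs) \<and>
     (\<forall>j<length bs. T (bs ! j) = (\<Oplus>\<^bsub>V\<^esub>i\<in>{..<length bs}. A $$ (i, j) \<odot>\<^bsub>V\<^esub> (bs ! i)))"
    using A T by (simp add: lin_def)
  fix B assume B: "B \<in> carrier_mat (length bs) (length bs) \<and>
     (\<forall>j<length bs. T (bs ! j) = (\<Oplus>\<^bsub>V\<^esub>i\<in>{..<length bs}. B $$ (i, j) \<odot>\<^bsub>V\<^esub> (bs ! i)))"
  show "B = A"
  proof (rule eq_matI)
    fix i j assume "i < dim_row A" "j < dim_col A"
    then have ij: "i < length bs" "j < length bs"
      using A by auto
    have "lin bs (\<lambda>i. B $$ (i, j)) = lin bs (\<lambda>i. A $$ (i, j))"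
      using B T[OF ij(2)] ij(2) by (simp add: lin_def)
    then show "B $$ (i, j) = A $$ (i, j)"
      by (rule ordered_basisD(4)[OF bs _ ij(1)])
  qed (use A B in auto)
qed

lemma matrix_of_family:
  assumes bs: "ordered_basis V bs" and y: "\<And>j. j < m \<Longrightarrow> y j \<in> carrier V"
  obtains A where "A \<in> carrier_mat (length bs) m" "\<And>j. j < m \<Longrightarrow> y j = lin bs (\<lambda>i. A $$ (i, j))"
proof -
  obtain a where a: "\<And>j. j < m \<Longrightarrow> lin bs (a j) = y j"
    using ordered_basisD(3)[OF bs y] by metis
  define A where "A = mat (length bs) m (\<lambda>(i, j). a j i)"
  have "y j = lin bs (\<lambda>i. A $$ (i, j))" if "j < m" for j
    unfolding a[OF that, symmetric] using ordered_basisD(2)[OF bs] that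
    by (intro lin_cong) (auto simp: A_def)
  then show thesis
    using that[of A] by (simp add: A_def)
qed

lemma lin_subst:
  assumes bs: "set bs \<subseteq> carrier V" and P: "P \<in> carrier_mat (length bs) (length ys)" and A: "A \<in> carrier_mat (length ys) m"
    and ys: "\<And>i. i < length ys \<Longrightarrow> ys ! i = lin bs (\<lambda>k. P $$ (k, i))" and j: "j < m"
  shows "lin ys (\<lambda>i. A $$ (i, j)) = lin bs (\<lambda>k. (P * A) $$ (k, j))"
proof -
  have "lin ys (\<lambda>i. A $$ (i, j)) = (\<Oplus>\<^bsub>V\<^esub>i\<in>{..<length ys}. A $$ (i, j) \<odot> lin bs (\<lambda>k. P $$ (k, i)))"
    unfolding lin_def[of ys] using ys by (intro M.finsum_cong') (auto intro!: smult_mem lin_closed[OF bs])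
  also have "\<dots> = lin bs (\<lambda>k. \<Sum>i<length ys. P $$ (k, i) * A $$ (i, j))"
    by (rule lin_sum[OF bs])
  also have "\<dots> = lin bs (\<lambda>k. (P * A) $$ (k, j))"
    using P A j by (intro lin_cong[OF _ bs]) (simp add: scalar_prod_def atLeast0LessThan)
  finally show ?thesis .
qed

lemma ordered_basis_length:
  assumes "ordered_basis V bs" "ordered_basis V bs'"
  shows "length bs = length bs'"
  using assms dim_basis[of "set bs"] dim_basis[of "set bs'"]
  by (simp add: ordered_basis_def distinct_card)

text \<open>P holds the coordinates of the second basis in the first. Column j of P * B and of A * P
  both hold the coordinates, in the first basis, of T applied to the j-th vector of the second; so
  the products are equal, and P is invertible since each basis expresses the other.\<close>

lemma change_of_basis:
  assumes bs: "ordered_basis V bs" and bs': "ordered_basis V bs'"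
    and Tm: "\<And>v. v \<in> carrier V \<Longrightarrow> T v \<in> carrier V"
    and Tadd: "\<And>v w. v \<in> carrier V \<Longrightarrow> w \<in> carrier V \<Longrightarrow> T (v \<oplus> w) = T v \<oplus> T w"
    and Tsmult: "\<And>c v. v \<in> carrier V \<Longrightarrow> T (c \<odot> v) = c \<odot> T v"
  shows "similar_mat (matrix_wrt V bs T) (matrix_wrt V bs' T)"
proof -
  note b = ordered_basisD[OF bs] and b' = ordered_basisD[OF bs']
  define n where "n = length bs"
  have n: "length bs = n" "length bs' = n"
    using ordered_basis_length[OF bs bs'] by (simp_all add: n_def)
  obtain P where P: "P \<in> carrier_mat n n" "\<And>j. j < n \<Longrightarrow> bs' ! j = lin bs (\<lambda>i. P $$ (i, j))"
    by (rule matrix_of_family[OF bs, of n "\<lambda>j. bs' ! j"]) (use b'(2) n in auto)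
  obtain Q where Q: "Q \<in> carrier_mat n n" "\<And>j. j < n \<Longrightarrow> bs ! j = lin bs' (\<lambda>i. Q $$ (i, j))"
    by (rule matrix_of_family[OF bs', of n "\<lambda>j. bs ! j"]) (use b(2) n in auto)
  obtain A where A: "A \<in> carrier_mat n n" "\<And>j. j < n \<Longrightarrow> T (bs ! j) = lin bs (\<lambda>i. A $$ (i, j))"
    by (rule matrix_of_family[OF bs, of n "\<lambda>j. T (bs ! j)"]) (use b(2) n Tm in auto)
  obtain B where B: "B \<in> carrier_mat n n" "\<And>j. j < n \<Longrightarrow> T (bs' ! j) = lin bs' (\<lambda>i. B $$ (i, j))"
    by (rule matrix_of_family[OF bs', of n "\<lambda>j. T (bs' ! j)"]) (use b'(2) n Tm in auto)
  have unit: "bs ! j = lin bs (\<lambda>i. 1\<^sub>m n $$ (i, j))" if j: "j < n" for j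
  proof -
    have "lin bs (\<lambda>i. 1\<^sub>m n $$ (i, j)) = (\<Oplus>\<^bsub>V\<^esub>i\<in>{..<n}. if j = i then bs ! i else \<zero>)"
      unfolding lin_def n using b(2) n j smult_zero_left smult_one
      by (intro M.finsum_cong') (auto simp: subset_iff)
    also have "\<dots> = bs ! j"
      using j b(2) n by (intro M.finsum_singleton) auto
    finally show ?thesis ..
  qed
  have PQ: "P * Q = 1\<^sub>m n"
  proof (rule eq_matI)
    fix i j assume "i < dim_row (1\<^sub>m n :: 'k mat)" "j < dim_col (1\<^sub>m n :: 'k mat)"
    then have ij: "i < n" "j < n"
      by auto
    have "lin bs (\<lambda>i. (P * Q) $$ (i, j)) = lin bs (\<lambda>i. 1\<^sub>m n $$ (i, j))"
      using lin_subst[OF b(2), of P bs' Q n j] P Q ij n unit[OF ij(2)] by simp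
    then show "(P * Q) $$ (i, j) = 1\<^sub>m n $$ (i, j)"
      using b(4) ij n by blast
  qed (use P Q in auto)
  have T_lin: "T (lin xs a) = (\<Oplus>\<^bsub>V\<^esub>i\<in>{..<length xs}. a i \<odot> T (xs ! i))" if xs: "set xs \<subseteq> carrier V" for xs a
  proof -
    have "T (\<Oplus>\<^bsub>V\<^esub>i\<in>{..<k}. a i \<odot> (xs ! i)) = (\<Oplus>\<^bsub>V\<^esub>i\<in>{..<k}. a i \<odot> T (xs ! i))" if "k \<le> length xs" for k
      using that
    proof (induction k)
      case 0
      have "T \<zero> = T (0 \<odot> \<zero>)"
        by (simp add: smult_zero_left)
      also have "\<dots> = \<zero>"
        using Tsmult[of \<zero> 0] Tm[of \<zero>] by (simp add: smult_zero_left)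
      finally show ?case
        by simp
    next
      case (Suc k)
      have m: "xs ! i \<in> carrier V" if "i < Suc k" for i
        using xs that Suc.prems by auto
      have "T (\<Oplus>\<^bsub>V\<^esub>i\<in>{..<Suc k}. a i \<odot> (xs ! i)) = T (a k \<odot> (xs ! k) \<oplus> (\<Oplus>\<^bsub>V\<^esub>i\<in>{..<k}. a i \<odot> (xs ! i)))"
        unfolding lessThan_Suc using m by (subst M.finsum_insert) (auto intro!: smult_mem)
      also have "\<dots> = a k \<odot> T (xs ! k) \<oplus> (\<Oplus>\<^bsub>V\<^esub>i\<in>{..<k}. a i \<odot> T (xs ! i))"
        using m Suc by (subst Tadd) (auto intro!: smult_mem M.finsum_closed simp: Tsmult)
      also have "\<dots> = (\<Oplus>\<^bsub>V\<^esub>i\<in>{..<Suc k}. a i \<odot> T (xs ! i))"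
        unfolding lessThan_Suc using m Tm by (subst M.finsum_insert) (auto intro!: smult_mem)
      finally show ?case .
    qed
    then show ?thesis
      unfolding lin_def by blast
  qed
  have PB: "P * B = A * P"
  proof (rule eq_matI)
    fix i j assume "i < dim_row (A * P)" "j < dim_col (A * P)"
    then have ij: "i < n" "j < n"
      using A P by auto
    have "lin bs (\<lambda>i. (P * B) $$ (i, j)) = T (bs' ! j)"
      using lin_subst[OF b(2), of P bs' B n j] P B ij n by simp
    also have "\<dots> = (\<Oplus>\<^bsub>V\<^esub>i\<in>{..<n}. P $$ (i, j) \<odot> T (bs ! i))"
      using P(2)[OF ij(2)] T_lin[OF b(2)] n by simp
    also have "\<dots> = (\<Oplus>\<^bsub>V\<^esub>i\<in>{..<n}. P $$ (i, j) \<odot> lin bs (\<lambda>k. A $$ (k, i)))"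
      using A(2) by (intro M.finsum_cong') (auto intro!: smult_mem lin_closed[OF b(2)])
    also have "\<dots> = lin bs (\<lambda>k. \<Sum>i<n. A $$ (k, i) * P $$ (i, j))"
      by (rule lin_sum[OF b(2)])
    also have "\<dots> = lin bs (\<lambda>k. (A * P) $$ (k, j))"
      using A P ij n by (intro lin_cong[OF _ b(2)]) (simp add: scalar_prod_def atLeast0LessThan)
    finally show "(P * B) $$ (i, j) = (A * P) $$ (i, j)"
      using b(4) ij n by blast
  qed (use A B P in auto)
  have QP: "Q * P = 1\<^sub>m n"
    using mat_mult_left_right_inverse[OF P(1) Q(1) PQ] .
  have "A = A * (P * Q)"
    using A PQ by simp
  also have "\<dots> = A * P * Q"
    using A P Q by (simp add: assoc_mult_mat)
  also have "\<dots> = P * B * Q"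
    by (simp add: PB)
  finally have "similar_mat A B"
    unfolding similar_mat_def similar_mat_wit_def using A P Q B PQ QP
    by (intro exI[of _ P] exI[of _ Q]) (auto simp: Let_def)
  moreover have "matrix_wrt V bs T = A" "matrix_wrt V bs' T = B"
    using A B n by (auto intro!: matrix_wrt_eqI bs bs')
  ultimately show ?thesis by simp
qed

text \<open>\<open>endo_matrix\<close> uses an unspecified basis; similarity lets its invariants be
  computed in a basis of choice.\<close>

lemma endo_matrix_similar:
  assumes bs: "ordered_basis V bs"
    and "\<And>v. v \<in> carrier V \<Longrightarrow> T v \<in> carrier V"
    and "\<And>v w. v \<in> carrier V \<Longrightarrow> w \<in> carrier V \<Longrightarrow> T (v \<oplus> w) = T v \<oplus> T w"
    and "\<And>c v. v \<in> carrier V \<Longrightarrow> T (c \<odot> v) = c \<odot> T v"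
  shows "similar_mat (endo_matrix V T) (matrix_wrt V bs T)"
  unfolding endo_matrix_def by (rule change_of_basis[OF someI[of "ordered_basis V", OF bs] bs assms(2-4)])

end

text \<open>The trace of a product is invariant under exchanging two factors, so P * B * Q has the
  trace of Q * P * B.\<close>

lemma trace_similar:
  fixes A B :: "'k::comm_ring_1 mat"
  assumes "similar_mat A B"
  shows "(\<Sum>i<dim_row A. A $$ (i, i)) = (\<Sum>i<dim_row B. B $$ (i, i))"
proof -
  obtain n P Q where c: "{A, B, P, Q} \<subseteq> carrier_mat n n" and QP: "Q * P = 1\<^sub>m n" and A: "A = P * B * Q"
    using similar_matD[OF assms] by blast
  have comm: "(\<Sum>i<n. (M * N) $$ (i, i)) = (\<Sum>i<n. (N * M) $$ (i, i))"
    if "M \<in> carrier_mat n n" "N \<in> carrier_mat n n" for M N :: "'k mat"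
  proof -
    have "(\<Sum>i<n. (M * N) $$ (i, i)) = (\<Sum>i<n. \<Sum>k<n. M $$ (i, k) * N $$ (k, i))"
      using that by (simp add: scalar_prod_def atLeast0LessThan)
    also have "\<dots> = (\<Sum>k<n. \<Sum>i<n. N $$ (k, i) * M $$ (i, k))"
      by (subst sum.swap) (simp add: mult.commute)
    also have "\<dots> = (\<Sum>i<n. (N * M) $$ (i, i))"
      using that by (simp add: scalar_prod_def atLeast0LessThan)
    finally show ?thesis .
  qed
  have "(\<Sum>i<n. A $$ (i, i)) = (\<Sum>i<n. (Q * (P * B)) $$ (i, i))"
    unfolding A using c by (intro comm) auto
  also have "Q * (P * B) = Q * P * B"
    using c by (intro assoc_mult_mat[symmetric]) auto
  also have "\<dots> = B"
    using c QP left_mult_one_mat[of B n n] by simp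
  finally show ?thesis
    using c by auto
qed

section \<open>Permutation matrices\<close>

lemma permutation_matrix_carrier: "permutation_matrix os \<pi> \<in> carrier_mat (length os) (length os)"
  by (simp add: permutation_matrix_def)

lemma permutation_matrix_mult:
  assumes d: "distinct os" and \<pi>: "\<And>o'. o' \<in> set os \<Longrightarrow> \<pi>' o' \<in> set os"
  shows "permutation_matrix os \<pi> * permutation_matrix os \<pi>' = (permutation_matrix os (\<lambda>o'. \<pi> (\<pi>' o')) :: 'k::field mat)"
proof (rule eq_matI)
  let ?n = "length os"
  fix i j assume "i < dim_row (permutation_matrix os (\<lambda>o'. \<pi> (\<pi>' o')) :: 'k mat)"
    "j < dim_col (permutation_matrix os (\<lambda>o'. \<pi> (\<pi>' o')) :: 'k mat)"
  then have ij: "i < ?n" "j < ?n"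
    by (simp_all add: permutation_matrix_def)
  obtain k where k: "k < ?n" "os ! k = \<pi>' (os ! j)"
    using \<pi>[of "os ! j"] ij(2) by (metis in_set_conv_nth nth_mem)
  have "(permutation_matrix os \<pi> * permutation_matrix os \<pi>' :: 'k mat) $$ (i, j) =
      (\<Sum>l<?n. (if os ! i = \<pi> (os ! l) then 1 else 0) * (if os ! l = \<pi>' (os ! j) then 1 else 0))"
    using ij by (simp add: permutation_matrix_def scalar_prod_def atLeast0LessThan)
  also have "\<dots> = (\<Sum>l<?n. if l = k then (if os ! i = \<pi> (os ! l) then 1 else 0) else 0)"
    unfolding k(2)[symmetric] using k(1) by (intro sum.cong) (auto simp: nth_eq_iff_index_eq[OF d])
  also have "\<dots> = (if os ! i = \<pi> (\<pi>' (os ! j)) then 1 else 0)"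
    using k by simp
  finally show "(permutation_matrix os \<pi> * permutation_matrix os \<pi>' :: 'k mat) $$ (i, j) =
      permutation_matrix os (\<lambda>o'. \<pi> (\<pi>' o')) $$ (i, j)"
    using ij by (simp add: permutation_matrix_def)
qed (simp_all add: permutation_matrix_def)

lemma permutation_matrix_id:
  assumes d: "distinct os" and \<pi>: "\<And>o'. o' \<in> set os \<Longrightarrow> \<pi> o' = o'"
  shows "permutation_matrix os \<pi> = 1\<^sub>m (length os)"
  by (rule eq_matI) (auto simp: permutation_matrix_def \<pi> nth_eq_iff_index_eq[OF d])

lemma permutation_matrix_cong:
  "(\<And>o'. o' \<in> set os \<Longrightarrow> \<pi> o' = \<pi>' o') \<Longrightarrow> permutation_matrix os \<pi> = permutation_matrix os \<pi>'"
  unfolding permutation_matrix_def by (rule cong_mat) auto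

text \<open>Carried over to the positions in the list, the permutation acts on the rows of the
  identity matrix. The determinant is then a sign, and signs are unchanged under inversion and
  relabelling.\<close>

lemma det_permutation_matrix:
  assumes d: "distinct os" and \<pi>: "bij_betw \<pi> (set os) (set os)"
  shows "det (permutation_matrix os \<pi> :: 'k::field mat) = of_int (sign_on (set os) \<pi>)"
proof -
  let ?n = "length os"
  have nth: "bij_betw ((!) os) {0..<?n} (set os)"
    using bij_betw_nth[OF d] by (simp add: atLeast0LessThan)
  define r where "r = restrict_id (inv_into {0..<?n} ((!) os) \<circ> \<pi> \<circ> (!) os) {0..<?n}"
  have "bij_betw (inv_into {0..<?n} ((!) os) \<circ> \<pi> \<circ> (!) os) {0..<?n} {0..<?n}"
    using bij_betw_trans[OF bij_betw_trans[OF nth \<pi>] bij_betw_inv_into[OF nth]] by (simp add: o_assoc)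
  then have r: "r permutes {0..<?n}"
    unfolding r_def by (rule permutes_restrict_id)
  have os_r: "os ! r i = \<pi> (os ! i)" if "i < ?n" for i
  proof -
    have "\<pi> (os ! i) \<in> set os"
      using \<pi> that by (auto simp: bij_betw_def)
    then show ?thesis
      using that bij_betw_inv_into_right[OF nth] by (simp add: r_def restrict_id_def)
  qed
  \<comment> \<open>Row i has its entry 1 in the column that r sends to i; hence the inverse of
    r.\<close>
  have "permutation_matrix os \<pi> = mat ?n ?n (\<lambda>(i, j). (1\<^sub>m ?n :: 'k mat) $$ (inv_into UNIV r i, j))"
  proof (rule eq_matI)
    fix i j assume "i < dim_row (mat ?n ?n (\<lambda>(i, j). (1\<^sub>m ?n :: 'k mat) $$ (inv_into UNIV r i, j)))"
      "j < dim_col (mat ?n ?n (\<lambda>(i, j). (1\<^sub>m ?n :: 'k mat) $$ (inv_into UNIV r i, j)))"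
    then have ij: "i < ?n" "j < ?n"
      by simp_all
    have "inv_into UNIV r i < ?n" "r j < ?n"
      using permutes_in_image[OF permutes_inv[OF r]] permutes_in_image[OF r] ij by auto
    moreover have "os ! i = \<pi> (os ! j) \<longleftrightarrow> inv_into UNIV r i = j"
      using os_r[OF ij(2)] nth_eq_iff_index_eq[OF d ij(1) \<open>r j < ?n\<close>] permutes_inverses[OF r] by metis
    ultimately show "permutation_matrix os \<pi> $$ (i, j) = mat ?n ?n (\<lambda>(i, j). (1\<^sub>m ?n :: 'k mat) $$ (inv_into UNIV r i, j)) $$ (i, j)"
      using ij by (simp add: permutation_matrix_def)
  qed (simp_all add: permutation_matrix_def)
  then have "det (permutation_matrix os \<pi> :: 'k mat) = signof (inv_into UNIV r)"
    using det_permute_rows[OF one_carrier_mat permutes_inv[OF r], where ?'a = 'k] by simp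
  also have "sign (inv_into UNIV r) = sign r"
    using r by (intro sign_inverse) (auto simp: permutation_permutes)
  also have "sign r = sign (map_permutation {0..<?n} ((!) os) r)"
    using nth r by (intro sign_map_permutation[symmetric]) (auto simp: bij_betw_def)
  \<comment> \<open>\<open>sign_on\<close> refers to the map extended by the identity outside the
    set, and the relabelled permutation is this extension.\<close>
  also have "map_permutation {0..<?n} ((!) os) r = restrict_id \<pi> (set os)"
  proof
    fix o'
    show "map_permutation {0..<?n} ((!) os) r o' = restrict_id \<pi> (set os) o'"
    proof (cases "o' \<in> set os")
      case True
      then have "inv_into {0..<?n} ((!) os) o' < ?n" "os ! inv_into {0..<?n} ((!) os) o' = o'"
        using bij_betw_inv_into_right[OF nth True] inv_into_into[of o' "(!) os" "{0..<?n}"] nth by (auto simp: bij_betw_def)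
      then show ?thesis
        using True nth os_r by (simp add: map_permutation_def restrict_id_def bij_betw_def)
    next
      case False
      then show ?thesis
        using nth by (simp add: map_permutation_def restrict_id_def bij_betw_def)
    qed
  qed
  finally show ?thesis
    by (simp add: sign_on_def)
qed

section \<open>Quotients with a dual basis\<close>

text \<open>The forms and their dual vectors pin down a quotient of dimension
  \<open>length os\<close>, whatever the dimension of V.\<close>

locale dual_system = class_vectorspace V for V :: "('k::field, 'v) module" (structure) +
  fixes os :: "'z list" and E :: "'z \<Rightarrow> 'v \<Rightarrow> 'k" and e :: "'z \<Rightarrow> 'v"
  assumes os: "distinct os"
    and E_add: "\<And>z v w. z \<in> set os \<Longrightarrow> v \<in> carrier V \<Longrightarrow> w \<in> carrier V \<Longrightarrow> E z (v \<oplus> w) = E z v + E z w"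
    and E_smult: "\<And>z c v. z \<in> set os \<Longrightarrow> v \<in> carrier V \<Longrightarrow> E z (c \<odot> v) = c * E z v"
    and e_mem: "\<And>z. z \<in> set os \<Longrightarrow> e z \<in> carrier V"
    and E_e: "\<And>z z'. z \<in> set os \<Longrightarrow> z' \<in> set os \<Longrightarrow> E z (e z') = (if z = z' then 1 else 0)"
begin

definition W :: "'v set" where
  "W = {v \<in> carrier V. \<forall>z\<in>set os. E z v = 0}"

text \<open>These sets are the cosets of W. Describing them by values of the forms turns
  computations in the quotient into computations in the field.\<close>

definition level :: "'v \<Rightarrow> 'v set" where
  "level v = {u \<in> carrier V. \<forall>z\<in>set os. E z u = E z v}"

abbreviation "Q \<equiv> quotient_space V W"

abbreviation "qs \<equiv> map (\<lambda>z. level (e z)) os"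

lemma E_zero: "z \<in> set os \<Longrightarrow> E z \<zero> = 0"
  using E_smult[of z \<zero> 0] by (simp add: smult_zero_left)

lemma E_minus:
  assumes "z \<in> set os" "v \<in> carrier V"
  shows "E z (\<ominus> v) = - E z v"
proof -
  have "E z v + E z (\<ominus> v) = 0"
    using E_add[OF assms(1,2), of "\<ominus> v"] assms E_zero by (simp add: M.r_neg)
  then show ?thesis
    by (simp add: add_eq_0_iff)
qed

lemma subspace_W: "VectorSpace.subspace class_ring W V"
proof -
  have "submodule class_ring W V"
    unfolding submodule_def using E_add E_smult E_zero module_axioms
    by (auto simp: W_def intro!: smult_mem)
  then show ?thesis
    using vs by (simp add: VectorSpace.subspace_def)
qed

text \<open>Subtracting v turns equality of values into membership in W.\<close>

lemma coset_eq:
  assumes v: "v \<in> carrier V"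
  shows "W +> v = level v"
proof
  show "W +> v \<subseteq> level v"
    using v E_add by (auto simp: a_r_coset_def' W_def level_def)
  show "level v \<subseteq> W +> v"
  proof
    fix u assume u: "u \<in> level v"
    then have uV: "u \<in> carrier V"
      by (simp add: level_def)
    have "E z (u \<oplus> \<ominus> v) = 0" if "z \<in> set os" for z
      using E_add[OF that uV, of "\<ominus> v"] E_minus[OF that v] u that v by (simp add: level_def)
    then have "u \<oplus> \<ominus> v \<in> W"
      using uV v by (simp add: W_def)
    moreover have "u = u \<oplus> \<ominus> v \<oplus> v"
      using uV v by (simp add: M.a_assoc M.l_neg)
    ultimately show "u \<in> W +> v"
      by (auto simp: a_r_coset_def')
  qed
qed

lemma level_self: "v \<in> carrier V \<Longrightarrow> v \<in> level v"
  by (simp add: level_def)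

lemma level_eq_iff:
  assumes v: "v \<in> carrier V"
  shows "level u = level v \<longleftrightarrow> (\<forall>z\<in>set os. E z u = E z v)"
proof
  assume "level u = level v"
  then have "v \<in> level u"
    using level_self[OF v] by simp
  then show "\<forall>z\<in>set os. E z u = E z v"
    by (simp add: level_def)
qed (auto simp: level_def)

lemma Q_carrier: "carrier Q = level ` carrier V"
  using coset_eq by (auto simp: quotient_space_def A_RCOSETS_def' image_def)

lemma Q_zero: "\<zero>\<^bsub>Q\<^esub> = level \<zero>"
  using E_zero by (auto simp: quotient_space_def W_def level_def)

lemma Q_add:
  assumes v: "v \<in> carrier V" and w: "w \<in> carrier V"
  shows "level v \<oplus>\<^bsub>Q\<^esub> level w = level (v \<oplus> w)"
proof -
  have "set_add V (level v) (level w) = level (v \<oplus> w)"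
  proof
    show "set_add V (level v) (level w) \<subseteq> level (v \<oplus> w)"
      using v w E_add by (auto simp: set_add_def' level_def)
    show "level (v \<oplus> w) \<subseteq> set_add V (level v) (level w)"
    proof
      fix u assume u: "u \<in> level (v \<oplus> w)"
      then have uV: "u \<in> carrier V"
        by (simp add: level_def)
      have "E z (u \<oplus> \<ominus> w) = E z v" if "z \<in> set os" for z
        using E_add[OF that uV, of "\<ominus> w"] E_minus[OF that w] E_add[OF that v w] u that w by (simp add: level_def)
      then have "u \<oplus> \<ominus> w \<in> level v"
        using uV w by (simp add: level_def)
      moreover have "u = u \<oplus> \<ominus> w \<oplus> w"
        using uV w by (simp add: M.a_assoc M.l_neg)
      ultimately show "u \<in> set_add V (level v) (level w)"
        using level_self[OF w] by (auto simp: set_add_def')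
    qed
  qed
  then show ?thesis
    by (simp add: quotient_space_def)
qed

lemma Q_smult:
  assumes v: "v \<in> carrier V"
  shows "c \<odot>\<^bsub>Q\<^esub> level v = level (c \<odot> v)"
proof -
  have "W +> (c \<odot> u) = level (c \<odot> v)" if u: "u \<in> level v" for u
  proof -
    have uV: "u \<in> carrier V"
      using u by (simp add: level_def)
    have "level (c \<odot> u) = level (c \<odot> v)"
      using u v uV by (subst level_eq_iff) (auto intro!: smult_mem simp: E_smult level_def)
    then show ?thesis
      using coset_eq[OF smult_mem[OF uV]] by simp
  qed
  then have "(\<Union>u\<in>level v. W +> (c \<odot> u)) = level (c \<odot> v)"
    using level_self[OF v] by blast
  then show ?thesis
    by (simp add: quotient_space_def)
qed

lemma Q_vectorspace: "class_vectorspace Q"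
proof (rule class_vectorspace.intro, rule vs_criteria)
  show "field (class_ring :: 'k ring)"
    by (rule class_field)
  show "\<forall>v\<in>carrier Q. \<exists>w\<in>carrier Q. v \<oplus>\<^bsub>Q\<^esub> w = \<zero>\<^bsub>Q\<^esub>"
  proof
    fix C assume "C \<in> carrier Q"
    then obtain v where v: "v \<in> carrier V" "C = level v"
      unfolding Q_carrier by blast
    then have "C \<oplus>\<^bsub>Q\<^esub> level (\<ominus> v) = \<zero>\<^bsub>Q\<^esub>"
      by (simp add: Q_add Q_zero M.r_neg)
    then show "\<exists>w\<in>carrier Q. C \<oplus>\<^bsub>Q\<^esub> w = \<zero>\<^bsub>Q\<^esub>"
      using v unfolding Q_carrier by blast
  qed
  show "\<forall>v w. v \<in> carrier Q \<and> w \<in> carrier Q \<longrightarrow> v \<oplus>\<^bsub>Q\<^esub> w = w \<oplus>\<^bsub>Q\<^esub> v"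
  proof (intro allI impI, elim conjE)
    fix C D assume "C \<in> carrier Q" "D \<in> carrier Q"
    then obtain v w where "v \<in> carrier V" "C = level v" "w \<in> carrier V" "D = level w"
      unfolding Q_carrier by blast
    then show "C \<oplus>\<^bsub>Q\<^esub> D = D \<oplus>\<^bsub>Q\<^esub> C"
      using M.a_comm[of v w] by (simp add: Q_add)
  qed
qed (auto simp: Q_carrier Q_add Q_smult Q_zero smult_mem M.a_assoc smult_add_left smult_add_right smult_mult smult_1)

sublocale Q: class_vectorspace Q
  by (rule Q_vectorspace)

lemma Q_lin: "Q.lin qs a = level (lin (map e os) a)"
proof -
  have *: "(\<Oplus>\<^bsub>Q\<^esub>i\<in>{..<k}. a i \<odot>\<^bsub>Q\<^esub> level (e (os ! i))) = level (\<Oplus>\<^bsub>V\<^esub>i\<in>{..<k}. a i \<odot> e (os ! i))"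
    if "k \<le> length os" for k
    using that
  proof (induction k)
    case 0
    then show ?case
      by (simp add: Q_zero)
  next
    case (Suc k)
    then have m: "e (os ! i) \<in> carrier V" if "i < Suc k" for i
      using e_mem that by simp
    have mQ: "level (e (os ! i)) \<in> carrier Q" if "i < Suc k" for i
      using m[OF that] by (simp add: Q_carrier)
    have "(\<Oplus>\<^bsub>Q\<^esub>i\<in>{..<Suc k}. a i \<odot>\<^bsub>Q\<^esub> level (e (os ! i))) =
        a k \<odot>\<^bsub>Q\<^esub> level (e (os ! k)) \<oplus>\<^bsub>Q\<^esub> (\<Oplus>\<^bsub>Q\<^esub>i\<in>{..<k}. a i \<odot>\<^bsub>Q\<^esub> level (e (os ! i)))"
      unfolding lessThan_Suc using mQ by (intro Q.M.finsum_insert) (auto intro!: Q.smult_mem)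
    also have "\<dots> = level (a k \<odot> e (os ! k)) \<oplus>\<^bsub>Q\<^esub> level (\<Oplus>\<^bsub>V\<^esub>i\<in>{..<k}. a i \<odot> e (os ! i))"
      using Suc m by (simp add: Q_smult)
    also have "\<dots> = level (a k \<odot> e (os ! k) \<oplus> (\<Oplus>\<^bsub>V\<^esub>i\<in>{..<k}. a i \<odot> e (os ! i)))"
      using m by (intro Q_add) (auto intro!: smult_mem M.finsum_closed)
    also have "a k \<odot> e (os ! k) \<oplus> (\<Oplus>\<^bsub>V\<^esub>i\<in>{..<k}. a i \<odot> e (os ! i)) = (\<Oplus>\<^bsub>V\<^esub>i\<in>{..<Suc k}. a i \<odot> e (os ! i))"
      unfolding lessThan_Suc using m by (intro M.finsum_insert[symmetric]) (auto intro!: smult_mem)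
    finally show ?case .
  qed
  have mQ: "level (e (os ! i)) \<in> carrier Q" if "i < length os" for i
    unfolding Q_carrier using e_mem that by simp
  have "Q.lin qs a = (\<Oplus>\<^bsub>Q\<^esub>i\<in>{..<length os}. a i \<odot>\<^bsub>Q\<^esub> level (e (os ! i)))"
    unfolding Q.lin_def length_map
    using mQ by (intro Q.M.finsum_cong') (auto intro!: Q.smult_mem)
  also have "\<dots> = level (\<Oplus>\<^bsub>V\<^esub>i\<in>{..<length os}. a i \<odot> e (os ! i))"
    by (rule *) simp
  also have "(\<Oplus>\<^bsub>V\<^esub>i\<in>{..<length os}. a i \<odot> e (os ! i)) = lin (map e os) a"
    unfolding lin_def length_map
    using e_mem by (intro M.finsum_cong') (auto intro!: smult_mem)
  finally show ?thesis .
qed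

lemma lin_mem: "lin (map e os) a \<in> carrier V"
  using e_mem by (intro lin_closed) auto

lemma E_lin:
  assumes j: "j < length os"
  shows "E (os ! j) (lin (map e os) a) = a j"
proof -
  have z: "os ! j \<in> set os"
    using j by simp
  have "E (os ! j) (\<Oplus>\<^bsub>V\<^esub>i\<in>{..<k}. a i \<odot> (map e os ! i)) = (\<Sum>i<k. if i = j then a i else 0)" if "k \<le> length os" for k
    using that
  proof (induction k)
    case 0
    then show ?case
      by (simp add: E_zero[OF z])
  next
    case (Suc k)
    then have m: "map e os ! i \<in> carrier V" if "i < Suc k" for i
      using e_mem that by simp
    have "(\<Oplus>\<^bsub>V\<^esub>i\<in>{..<Suc k}. a i \<odot> (map e os ! i)) = a k \<odot> (map e os ! k) \<oplus> (\<Oplus>\<^bsub>V\<^esub>i\<in>{..<k}. a i \<odot> (map e os ! i))"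
      unfolding lessThan_Suc using m by (intro M.finsum_insert) (auto intro!: smult_mem)
    then have "E (os ! j) (\<Oplus>\<^bsub>V\<^esub>i\<in>{..<Suc k}. a i \<odot> (map e os ! i)) =
        a k * E (os ! j) (map e os ! k) + E (os ! j) (\<Oplus>\<^bsub>V\<^esub>i\<in>{..<k}. a i \<odot> (map e os ! i))"
      using E_add[OF z, of "a k \<odot> (map e os ! k)" "\<Oplus>\<^bsub>V\<^esub>i\<in>{..<k}. a i \<odot> (map e os ! i)"] m[of k] E_smult[OF z, of "map e os ! k" "a k"]
      by (simp add: smult_mem M.finsum_closed m Pi_def)
    also have "\<dots> = (\<Sum>i<Suc k. if i = j then a i else 0)"
      using Suc j by (simp add: E_e nth_eq_iff_index_eq[OF os])
    finally show ?case .
  qed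
  then show ?thesis
    unfolding lin_def using j by simp
qed

lemma level_eq_lin:
  assumes "v \<in> carrier V" "\<And>j. j < length os \<Longrightarrow> E (os ! j) v = a j"
  shows "level v = Q.lin qs a"
  unfolding Q_lin level_eq_iff[OF lin_mem]
proof
  fix z assume "z \<in> set os"
  then obtain j where "j < length os" "z = os ! j"
    by (metis in_set_conv_nth)
  then show "E z v = E z (lin (map e os) a)"
    using assms(2) E_lin by simp
qed

text \<open>The values of the forms determine a coset, and by duality they are its coordinates with
  respect to the classes of the dual vectors.\<close>

lemma ordered_basis_qs: "ordered_basis Q qs"
  unfolding Q.ordered_basis_iff
proof (intro conjI ballI allI impI)
  have "inj_on (\<lambda>z. level (e z)) (set os)"
  proof (rule inj_onI)
    fix z z' assume z: "z \<in> set os" "z' \<in> set os" and "level (e z) = level (e z')"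
    then have "E z (e z) = E z (e z')"
      using level_eq_iff[OF e_mem[OF z(2)]] by blast
    then show "z = z'"
      using E_e[OF z] E_e[OF z(1) z(1)] by (simp split: if_splits)
  qed
  then show "distinct qs"
    using os by (simp add: distinct_map)
  show "set qs \<subseteq> carrier Q"
    using e_mem by (auto simp: Q_carrier)
  show "\<exists>a. Q.lin qs a = C" if C: "C \<in> carrier Q" for C
  proof -
    obtain v where v: "v \<in> carrier V" "C = level v"
      using C unfolding Q_carrier by blast
    have "level v = Q.lin qs (\<lambda>j. E (os ! j) v)"
      using v(1) by (rule level_eq_lin) simp
    then show ?thesis
      using v(2) by metis
  qed
  fix a a' i assume "Q.lin qs a = Q.lin qs a'" "i < length qs"
  then have "E (os ! i) (lin (map e os) a) = E (os ! i) (lin (map e os) a')"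
    unfolding Q_lin level_eq_iff[OF lin_mem] by simp
  then show "a i = a' i"
    using \<open>i < length qs\<close> by (simp add: E_lin)
qed

section \<open>Maps that permute the forms\<close>

context
  fixes T :: "'v \<Rightarrow> 'v" and \<sigma> :: "'z \<Rightarrow> 'z"
  assumes T_mem: "\<And>v. v \<in> carrier V \<Longrightarrow> T v \<in> carrier V"
    and \<sigma>: "bij_betw \<sigma> (set os) (set os)"
    and E_T: "\<And>z v. z \<in> set os \<Longrightarrow> v \<in> carrier V \<Longrightarrow> E (\<sigma> z) (T v) = E z v"
begin

lemma \<sigma>_ball: "(\<forall>z\<in>set os. P z) \<longleftrightarrow> (\<forall>z\<in>set os. P (\<sigma> z))"
  using \<sigma> unfolding bij_betw_def by (metis ball_simps(9))

lemma invariant_W: "v \<in> W \<Longrightarrow> T v \<in> W"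
  unfolding W_def using T_mem \<sigma>_ball[of "\<lambda>z. E z (T v) = 0"] E_T by simp

lemma quotient_endo_level:
  assumes v: "v \<in> carrier V"
  shows "quotient_endo V W T (level v) = level (T v)"
proof -
  have "W +> T u = level (T v)" if u: "u \<in> level v" for u
  proof -
    have uV: "u \<in> carrier V"
      using u by (simp add: level_def)
    have "level (T u) = level (T v)"
      unfolding level_eq_iff[OF T_mem[OF v]] using \<sigma>_ball[of "\<lambda>z. E z (T u) = E z (T v)"] u v uV E_T by (simp add: level_def)
    then show ?thesis
      using coset_eq[OF T_mem[OF uV]] by simp
  qed
  then have "(\<Union>u\<in>level v. W +> T u) = level (T v)"
    using level_self[OF v] by blast
  then show ?thesis
    using v by (simp add: quotient_endo_def Q_carrier)
qed

text \<open>Coordinate i of the image of the j-th basis vector is a value of the form with index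
  \<open>os ! i\<close>; writing this index as \<open>\<sigma> z'\<close> removes T and leaves
  duality.\<close>

lemma matrix_wrt_quotient_endo: "matrix_wrt Q qs (quotient_endo V W T) = permutation_matrix os \<sigma>"
proof (rule Q.matrix_wrt_eqI[OF ordered_basis_qs])
  show "permutation_matrix os \<sigma> \<in> carrier_mat (length qs) (length qs)"
    using permutation_matrix_carrier by simp
  fix j assume "j < length qs"
  then have j: "j < length os"
    by simp
  then have z: "os ! j \<in> set os"
    by simp
  have "E (os ! i) (T (e (os ! j))) = permutation_matrix os \<sigma> $$ (i, j)" if i: "i < length os" for i
  proof -
    obtain z' where z': "z' \<in> set os" "os ! i = \<sigma> z'"
      using \<sigma> i by (metis bij_betw_def imageE nth_mem)
    have "E (os ! i) (T (e (os ! j))) = (if z' = os ! j then 1 else 0)"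
      unfolding z'(2) using E_T[OF z'(1) e_mem[OF z]] E_e[OF z'(1) z] by simp
    also have "z' = os ! j \<longleftrightarrow> os ! i = \<sigma> (os ! j)"
      using \<sigma> z'(1) z unfolding z'(2) bij_betw_def by (auto dest: inj_onD)
    finally show ?thesis
      using i j by (simp add: permutation_matrix_def)
  qed
  then show "quotient_endo V W T (qs ! j) = Q.lin qs (\<lambda>i. permutation_matrix os \<sigma> $$ (i, j))"
    using j quotient_endo_level[OF e_mem[OF z]] level_eq_lin[OF T_mem[OF e_mem[OF z]]] by simp
qed

text \<open>Linearity of the induced map comes from the forms: the value of
  \<open>E (\<sigma> z)\<close> at \<open>T v\<close> is \<open>E z v\<close>, which is linear in v,
  and every form has an index of the shape \<open>\<sigma> z\<close>.\<close>

lemma endo_matrix_quotient_endo: "similar_mat (endo_matrix Q (quotient_endo V W T)) (permutation_matrix os \<sigma>)"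
proof -
  have "similar_mat (endo_matrix Q (quotient_endo V W T)) (matrix_wrt Q qs (quotient_endo V W T))"
  proof (rule Q.endo_matrix_similar[OF ordered_basis_qs])
    fix C assume "C \<in> carrier Q"
    then obtain v where v: "v \<in> carrier V" "C = level v"
      unfolding Q_carrier by blast
    show "quotient_endo V W T C \<in> carrier Q"
      using v T_mem by (simp add: quotient_endo_level Q_carrier)
    show "quotient_endo V W T (c \<odot>\<^bsub>Q\<^esub> C) = c \<odot>\<^bsub>Q\<^esub> quotient_endo V W T C" for c
      unfolding v(2) Q_smult[OF v(1)] quotient_endo_level[OF v(1)] quotient_endo_level[OF smult_mem[OF v(1)]] Q_smult[OF T_mem[OF v(1)]]
        level_eq_iff[OF smult_mem[OF T_mem[OF v(1)]]]
      using \<sigma>_ball[of "\<lambda>z. E z (T (c \<odot> v)) = E z (c \<odot> T v)"] \<sigma> v(1)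
      by (simp add: E_T smult_mem E_smult T_mem bij_betw_apply)
    fix D assume "D \<in> carrier Q"
    then obtain w where w: "w \<in> carrier V" "D = level w"
      unfolding Q_carrier by blast
    have vw: "v \<oplus> w \<in> carrier V" "T v \<oplus> T w \<in> carrier V"
      using v w T_mem by auto
    show "quotient_endo V W T (C \<oplus>\<^bsub>Q\<^esub> D) = quotient_endo V W T C \<oplus>\<^bsub>Q\<^esub> quotient_endo V W T D"
      unfolding v(2) w(2) Q_add[OF v(1) w(1)] quotient_endo_level[OF v(1)] quotient_endo_level[OF w(1)] quotient_endo_level[OF vw(1)]
        Q_add[OF T_mem[OF v(1)] T_mem[OF w(1)]] level_eq_iff[OF vw(2)]
      using \<sigma>_ball[of "\<lambda>z. E z (T (v \<oplus> w)) = E z (T v \<oplus> T w)"] \<sigma> v(1) w(1)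
      by (simp add: E_T E_add T_mem bij_betw_apply)
  qed
  then show ?thesis
    by (simp add: matrix_wrt_quotient_endo)
qed

end

end

section \<open>Periodic orbits\<close>

lemma has_least_period_iff:
  "has_least_period x m \<longleftrightarrow> 0 < m \<and> translate (int m) x = x \<and> (\<forall>k. 0 < k \<and> k < m \<longrightarrow> translate (int k) x \<noteq> x)"
  by (simp add: has_least_period_def shift_funpow)

lemma orbit_shift: "Orbits.orbit shift x = {translate (int n) x | n. 0 < n}"
  by (simp add: orbit_altdef shift_funpow)

lemma periodic_point_eqI:
  assumes P: "0 < P" "translate P x = x" "translate P w = w" and ag: "agree {0..<P} x w"
  shows "x = w"
proof
  fix i
  have red: "y i = y (i mod P)" if "translate P y = y" for y :: "'a point"
  proof -
    have "y (i mod P + i div P * P) = y (i mod P)"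
      using translate_periodic[OF that, of "i div P"] by (metis translate_apply)
    then show ?thesis
      by simp
  qed
  have "x (i mod P) = w (i mod P)"
    using P(1) by (intro agreeD[OF ag]) simp
  then show "x i = w i"
    using red[OF P(2)] red[OF P(3)] by simp
qed

lemma orbit_shift_eq_imp:
  assumes "has_least_period x m" "Orbits.orbit shift w = Orbits.orbit shift x"
  shows "\<exists>k. x = translate k w"
proof -
  \<comment> \<open>\<open>orbit\<close> begins with the first iterate, so periodicity is what puts
    x itself into it.\<close>
  have "x \<in> Orbits.orbit shift x"
    using assms(1) by (auto simp: orbit_shift has_least_period_iff intro!: exI[of _ m])
  then show ?thesis
    using assms(2) by (auto simp: orbit_shift)
qed

lemma orbit_shift_translate:
  assumes w: "has_least_period w m"
  shows "Orbits.orbit shift (translate k w) = Orbits.orbit shift w"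
proof -
  have m: "0 < int m" "translate (int m) w = w"
    using w by (simp_all add: has_least_period_iff)
  have sub: "Orbits.orbit shift (translate j v) \<subseteq> Orbits.orbit shift v" if "translate (int m) v = v" for j v
  proof
    fix y assume "y \<in> Orbits.orbit shift (translate j v)"
    then obtain n where y: "y = translate (int n + j) v"
      by (auto simp: orbit_shift)
    \<comment> \<open>The additional m keeps the exponent positive, as \<open>orbit\<close>
      requires, when the residue is 0.\<close>
    define r where "r = (int n + j) mod int m + int m"
    have "translate (int n + j) v = translate ((int n + j) mod int m) (translate ((int n + j) div int m * int m) v)"
      by simp
    also have "\<dots> = translate r v"
      using translate_periodic[OF that] that by (simp add: r_def flip: translate_translate)
    finally have "y = translate r v"
      using y by simp
    moreover have "0 < r"
      using pos_mod_sign[OF m(1), of "int n + j"] m(1) unfolding r_def by linarith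
    ultimately have "y = translate (int (nat r)) v" "0 < nat r"
      by simp_all
    then show "y \<in> Orbits.orbit shift v"
      unfolding orbit_shift by blast
  qed
  have "translate (int m) (translate k w) = translate k (translate (int m) w)"
    by (simp add: add.commute)
  then have "translate (int m) (translate k w) = translate k w"
    using m(2) by simp
  then have "Orbits.orbit shift (translate (- k) (translate k w)) \<subseteq> Orbits.orbit shift (translate k w)"
    by (rule sub)
  then show ?thesis
    using sub[OF m(2), of k] by simp
qed

text \<open>A point of period m is determined by m consecutive letters, for which a finite alphabet
  leaves finitely many choices.\<close>

lemma finite_periodic_orbits:
  assumes "subshift X"
  shows "finite (periodic_orbits m X)"
proof -
  obtain A where A: "finite A" "X \<subseteq> {x. range x \<subseteq> A}"
    using assms by (auto simp: subshift_def shift_space_def)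
  let ?S = "{x \<in> X. has_least_period x m}"
  let ?r = "\<lambda>x. restrict x {0..<int m}"
  have "inj_on ?r ?S"
  proof (rule inj_onI)
    fix x y assume "x \<in> ?S" "y \<in> ?S" "?r x = ?r y"
    then have "0 < int m" "translate (int m) x = x" "translate (int m) y = y" "agree {0..<int m} x y"
      by (simp_all add: has_least_period_iff restrict_eq_iff_agree)
    then show "x = y"
      by (rule periodic_point_eqI)
  qed
  moreover have "finite (?r ` ?S)"
  proof (rule finite_subset)
    have "x i \<in> A" if "x \<in> X" for x i
      using A(2) that by blast
    then show "?r ` ?S \<subseteq> {0..<int m} \<rightarrow>\<^sub>E A"
      by auto
    show "finite ({0..<int m} \<rightarrow>\<^sub>E A)"
      using A(1) by (intro finite_PiE) auto
  qed
  ultimately have "finite ?S"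
    by (rule finite_imageD[rotated])
  moreover have "periodic_orbits m X = Orbits.orbit shift ` ?S"
    by (auto simp: periodic_orbits_def)
  ultimately show ?thesis
    by simp
qed

lemma periodic_orbits_subset:
  assumes "subshift X" "orb \<in> periodic_orbits m X"
  shows "orb \<subseteq> X"
  using assms translate_mem by (auto simp: periodic_orbits_def orbit_shift)

lemma conjugacy_orbit:
  assumes X: "subshift X" and f: "topological_conjugacy X X f" and x: "x \<in> X" "has_least_period x m"
  shows "f ` Orbits.orbit shift x = Orbits.orbit shift (f x)" "has_least_period (f x) m"
proof -
  have tr: "f (translate k x) = translate k (f x)" for k
    by (rule sliding_block_code_translate[OF X conjugacyD(1)[OF f] x(1)])
  have "f ` {translate (int n) x | n. 0 < n} = {f (translate (int n) x) | n. 0 < n}"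
    by blast
  then show "f ` Orbits.orbit shift x = Orbits.orbit shift (f x)"
    by (simp add: orbit_shift tr)
  have "translate k (f x) = f x \<longleftrightarrow> translate k x = x" for k
    using inj_on_eq_iff[OF conjugacyD(5)[OF f] translate_mem[OF X x(1)] x(1)] by (simp flip: tr)
  then show "has_least_period (f x) m"
    using x(2) by (simp add: has_least_period_iff)
qed

text \<open>An injective map of a finite set into itself is surjective.\<close>

lemma conjugacy_periodic_orbits:
  assumes X: "subshift X" and f: "topological_conjugacy X X f"
  shows "bij_betw (\<lambda>orb. f ` orb) (periodic_orbits m X) (periodic_orbits m X)"
proof -
  have inj: "inj_on (\<lambda>orb. f ` orb) (periodic_orbits m X)"
    using inj_on_image_eq_iff[OF conjugacyD(5)[OF f]] periodic_orbits_subset[OF X] by (metis inj_onI)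
  moreover have "(\<lambda>orb. f ` orb) ` periodic_orbits m X \<subseteq> periodic_orbits m X"
  proof (rule image_subsetI)
    fix orb assume "orb \<in> periodic_orbits m X"
    then obtain x where "x \<in> X" "has_least_period x m" "orb = Orbits.orbit shift x"
      by (auto simp: periodic_orbits_def)
    then show "f ` orb \<in> periodic_orbits m X"
      using conjugacy_orbit[OF X f] conjugacyD(6)[OF f] unfolding periodic_orbits_def by blast
  qed
  ultimately show ?thesis
    using endo_inj_surj[OF finite_periodic_orbits[OF X]] by (simp add: bij_betw_def)
qed

section \<open>Orbit evaluations and their dual characters\<close>

context absolute_galois
begin

definition orbit_eval :: "nat \<Rightarrow> 'a point set \<Rightarrow> ('a gal_elem \<Rightarrow> 'k) \<Rightarrow> 'k" where
  "orbit_eval m orb = frob_eval (int m) (SOME x. x \<in> X \<and> has_least_period x m \<and> orb = Orbits.orbit shift x)"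

text \<open>One witness serves all characters at once, so that linearity for the orbit is linearity
  at a single point.\<close>

lemma orbit_eval_witness:
  assumes "orb \<in> periodic_orbits m X"
  obtains x where "x \<in> X" "has_least_period x m" "orb = Orbits.orbit shift x"
    "orbit_eval m orb = (frob_eval (int m) x :: ('a gal_elem \<Rightarrow> 'k) \<Rightarrow> 'k)"
proof -
  let ?P = "\<lambda>x. x \<in> X \<and> has_least_period x m \<and> orb = Orbits.orbit shift x"
  have "\<exists>x. ?P x"
    using assms by (auto simp: periodic_orbits_def)
  then have "?P (SOME x. ?P x)"
    by (rule someI_ex)
  then show thesis
    by (intro that[of "SOME x. ?P x"]) (simp_all add: orbit_eval_def)
qed

text \<open>The point chosen in \<open>orbit_eval\<close> is a translate of x, and translation does
  not change the value of a character on Frobenius elements.\<close>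

lemma orbit_eval_orbit:
  fixes \<chi> :: "'a gal_elem \<Rightarrow> 'p::prime_card mod_ring"
  assumes x: "x \<in> X" "has_least_period x m" and \<chi>: "\<chi> \<in> carrier (H1 X x0 R)"
  shows "orbit_eval m (Orbits.orbit shift x) \<chi> = frob_eval (int m) x \<chi>"
proof -
  have "Orbits.orbit shift x \<in> periodic_orbits m X"
    using x by (auto simp: periodic_orbits_def)
  then obtain w where w: "w \<in> X" "has_least_period w m" "Orbits.orbit shift x = Orbits.orbit shift w"
    "orbit_eval m (Orbits.orbit shift x) \<chi> = frob_eval (int m) w \<chi>"
    by (rule orbit_eval_witness[where ?'k = "'p mod_ring"]) metis
  obtain k where "w = translate k x"
    using orbit_shift_eq_imp[OF w(2,3)] by blast
  then show ?thesis
    using w(4) frob_eval_translate[OF x(1) _ \<chi>, of "int m" k] x(2) by (simp add: has_least_period_iff)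
qed

lemma orbit_eval_upsilon:
  fixes \<chi> :: "'a gal_elem \<Rightarrow> 'p::prime_card mod_ring"
  assumes f: "topological_conjugacy X X f" and orb: "orb \<in> periodic_orbits m X" and \<chi>: "\<chi> \<in> carrier (H1 X x0 R)"
  shows "orbit_eval m (f ` orb) (upsilon X x0 R f \<chi>) = orbit_eval m orb \<chi>"
proof -
  obtain x where x: "x \<in> X" "has_least_period x m" "orb = Orbits.orbit shift x"
    using orb by (auto simp: periodic_orbits_def)
  note fx = conjugacy_orbit[OF sub f x(1,2)]
  have "orbit_eval m (f ` orb) (upsilon X x0 R f \<chi>) = frob_eval (int m) (f x) (upsilon X x0 R f \<chi>)"
    unfolding x(3) fx(1) by (rule orbit_eval_orbit[OF conjugacyD(6)[OF f x(1)] fx(2) upsilon_closed[OF f \<chi>]])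
  also have "\<dots> = frob_eval (int m) x \<chi>"
    using x(2) by (intro frob_eval_upsilon[OF f x(1) _ \<chi>]) (simp add: has_least_period_iff)
  also have "\<dots> = orbit_eval m orb \<chi>"
    unfolding x(3) by (rule orbit_eval_orbit[OF x(1,2) \<chi>, symmetric])
  finally show ?thesis .
qed

lemma orbit_eval_linear:
  fixes \<chi> \<psi> :: "'a gal_elem \<Rightarrow> 'p::prime_card mod_ring"
  assumes "orb \<in> periodic_orbits m X"
  shows "orbit_eval m orb (\<chi> \<oplus>\<^bsub>H1 X x0 R\<^esub> \<psi>) = orbit_eval m orb \<chi> + orbit_eval m orb \<psi>"
    and "orbit_eval m orb (a \<odot>\<^bsub>H1 X x0 R\<^esub> \<chi>) = a * orbit_eval m orb \<chi>"
proof -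
  obtain x where x: "x \<in> X" "has_least_period x m"
    "orbit_eval m orb = (frob_eval (int m) x :: ('a gal_elem \<Rightarrow> 'p mod_ring) \<Rightarrow> 'p mod_ring)"
    using assms by (rule orbit_eval_witness)
  show "orbit_eval m orb (\<chi> \<oplus>\<^bsub>H1 X x0 R\<^esub> \<psi>) = orbit_eval m orb \<chi> + orbit_eval m orb \<psi>"
    "orbit_eval m orb (a \<odot>\<^bsub>H1 X x0 R\<^esub> \<chi>) = a * orbit_eval m orb \<chi>"
    unfolding x(3) using x(2) by (intro frob_eval_linear[OF x(1)]; simp add: has_least_period_iff)+
qed

text \<open>The cocycle is the indicator of the cylinder around a point \<open>w\<close> of the orbit; a point of
  period \<open>m\<close> visits this cylinder only at \<open>w\<close> itself.\<close>

lemma orbit_eval_dual: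
  assumes orb: "orb \<in> periodic_orbits m X"
  shows "\<exists>\<chi>\<in>carrier (H1 X x0 R). \<forall>orb'\<in>periodic_orbits m X.
           orbit_eval m orb' \<chi> = (if orb' = orb then 1 else 0 :: 'p::prime_card mod_ring)"
proof -
  obtain w where w: "w \<in> X" "has_least_period w m" "orb = Orbits.orbit shift w"
    using orb by (auto simp: periodic_orbits_def)
  have m: "0 < m" "translate (int m) w = w"
    using w(2) by (simp_all add: has_least_period_iff)
  define c where "c = (\<lambda>x. if agree {0..<int m} x w then 1 else 0 :: 'p mod_ring)"
  have hit: "translate j x = w" if "translate (int m) x = x" "c (translate j x) \<noteq> 0" for x j
  proof (rule periodic_point_eqI[of "int m"])
    have "translate (int m) (translate j x) = translate j (translate (int m) x)"
      by (simp add: add.commute)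
    then show "translate (int m) (translate j x) = translate j x"
      using that(1) by simp
    show "agree {0..<int m} (translate j x) w"
      using that(2) by (simp add: c_def split: if_splits)
  qed (use m in auto)
  \<comment> \<open>Within one period w meets its own cylinder only at j = 0, because m is its least
    period.\<close>
  have "c (translate j w) = 0" if "j \<in> {0..<int m} - {0}" for j
  proof (rule ccontr)
    assume "c (translate j w) \<noteq> 0"
    then have "translate (int (nat j)) w = w"
      using hit[OF m(2)] that by simp
    moreover have "0 < nat j" "nat j < m"
      using that by auto
    ultimately show False
      using w(2) unfolding has_least_period_iff by blast
  qed
  then have sum_w: "(\<Sum>j\<in>{0..<int m}. c (translate j w)) = 1"
    using m(1) by (subst sum.remove[of _ 0]) (simp_all add: c_def)
  have "c x = c z" if "agree {0..int m} x z" for x z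
  proof -
    have "agree {0..<int m} x w \<longleftrightarrow> agree {0..<int m} z w"
      using that by (auto simp: agree_def)
    then show ?thesis
      by (simp add: c_def)
  qed
  then obtain \<chi> where \<chi>: "\<chi> \<in> carrier (H1 X x0 R)"
    "\<forall>x\<in>X. \<forall>n\<ge>0. translate n x = x \<longrightarrow> frob_eval n x \<chi> = (\<Sum>j\<in>{0..<n}. c (translate j x))"
    using skew_product_character[OF _ _ w(1) m(2) _ sum_w, of "int m"] m(1) by auto
  have "orbit_eval m orb' \<chi> = (if orb' = orb then 1 else 0)" if orb': "orb' \<in> periodic_orbits m X" for orb'
  proof (cases "orb' = orb")
    case True
    then show ?thesis
      using orbit_eval_orbit[OF w(1,2) \<chi>(1)] \<chi>(2) w(1) m sum_w by (simp add: w(3))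
  next
    case False
    obtain x where x: "x \<in> X" "has_least_period x m" "orb' = Orbits.orbit shift x"
      using orb' by (auto simp: periodic_orbits_def)
    have per: "translate (int m) x = x"
      using x(2) by (simp add: has_least_period_iff)
    have "c (translate j x) = 0" for j
    proof (rule ccontr)
      assume "c (translate j x) \<noteq> 0"
      then have "w = translate j x"
        using hit[OF per] by simp
      then show False
        using False orbit_shift_translate[OF x(2), of j] w(3) x(3) by simp
    qed
    then show ?thesis
      using False orbit_eval_orbit[OF x(1,2) \<chi>(1)] \<chi>(2) x(1) per by (simp add: x(3))
  qed
  then show ?thesis
    using \<chi>(1) by blast
qed

end

section \<open>The permutation quotient\<close>

theorem theorem1p3:
  fixes X :: "'a point set" and x0 :: "'a point" and R :: "'a reps" and m :: nat
  assumes X: "irreducible_sft X"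
    and x0: "x0 \<in> X"
    and R: "\<And>i. i \<in> galois_classes X x0 \<Longrightarrow> R i \<in> i"
    and m: "1 \<le> m"
  shows "\<exists>W :: ('a gal_elem \<Rightarrow> 'p::prime_card mod_ring) set.
    VectorSpace.subspace class_ring W (H1 X x0 R) \<and>
    (\<forall>f\<in>carrier (shift_aut X). \<forall>\<chi>\<in>W. upsilon X x0 R f \<chi> \<in> W) \<and>
    (let V = quotient_space (H1 X x0 R) W;
         \<rho> = (\<lambda>f. quotient_endo (H1 X x0 R) W (upsilon X x0 R f))
     in \<exists>bs os. ordered_basis V bs \<and> distinct os \<and> set os = periodic_orbits m X \<and>
       (\<forall>f\<in>carrier (shift_aut X).
          matrix_wrt V bs (\<rho> f) = permutation_matrix os (\<lambda>orb. f ` orb) \<and>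
          endo_det V (\<rho> f) = of_int (orbit_sign m X f) \<and>
          (\<forall>h\<in>carrier (shift_aut X).
             let f' = h \<otimes>\<^bsub>shift_aut X\<^esub> f \<otimes>\<^bsub>shift_aut X\<^esub> inv\<^bsub>shift_aut X\<^esub> h
             in endo_char_poly V (\<rho> f') = endo_char_poly V (\<rho> f) \<and>
                endo_det V (\<rho> f') = endo_det V (\<rho> f) \<and>
                endo_trace V (\<rho> f') = endo_trace V (\<rho> f))))"
proof -
  interpret absolute_galois X x0 R
    by (rule absolute_galois.intro[OF X x0 R])
  let ?H = "H1 X x0 R :: ('p mod_ring, _) module"
  obtain os where os: "set os = periodic_orbits m X" "distinct os"
    using finite_distinct_list[OF finite_periodic_orbits[OF sub]] by blast
  have "\<forall>orb\<in>periodic_orbits m X. \<exists>\<chi>. \<chi> \<in> carrier ?H \<and> (\<forall>orb'\<in>periodic_orbits m X.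
      orbit_eval m orb' \<chi> = (if orb' = orb then 1 else 0))"
    using orbit_eval_dual unfolding Bex_def by (rule ballI)
  from bchoice[OF this] obtain e where e: "\<forall>orb\<in>periodic_orbits m X. e orb \<in> carrier ?H \<and>
      (\<forall>orb'\<in>periodic_orbits m X. orbit_eval m orb' (e orb) = (if orb' = orb then 1 else 0))" ..
  interpret D: dual_system ?H os "orbit_eval m" e
  proof (rule dual_system.intro)
    show "class_vectorspace ?H"
      by (rule class_vectorspace.intro[OF H1_vectorspace])
    show "dual_system_axioms ?H os (orbit_eval m) e"
      by (rule dual_system_axioms.intro) (use os orbit_eval_linear e in simp_all)
  qed
  let ?\<rho> = "\<lambda>f. quotient_endo ?H D.W (upsilon X x0 R f)"
  let ?P = "\<lambda>f. permutation_matrix os (\<lambda>orb. f ` orb) :: 'p mod_ring mat"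
  have perm: "bij_betw (\<lambda>orb. f ` orb) (set os) (set os)" if "topological_conjugacy X X f" for f
    unfolding os(1) by (rule conjugacy_periodic_orbits[OF sub that])
  have E: "orbit_eval m (f ` orb) (upsilon X x0 R f \<chi>) = orbit_eval m orb \<chi>"
    if "topological_conjugacy X X f" "orb \<in> set os" "\<chi> \<in> carrier ?H" for f orb \<chi>
    using orbit_eval_upsilon[OF that(1) _ that(3)] that(2) unfolding os(1) .
  \<comment> \<open>The conditions on a map that permutes the forms, here for
    \<open>upsilon X x0 R f\<close> and the action of f on orbits.\<close>
  note act = upsilon_closed perm E
  have similar: "similar_mat (endo_matrix D.Q (?\<rho> f)) (?P f)" if "topological_conjugacy X X f" for f
    by (rule D.endo_matrix_quotient_endo[OF act[OF that]])
  have det: "endo_det D.Q (?\<rho> f) = of_int (orbit_sign m X f)" if "topological_conjugacy X X f" for f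
    unfolding endo_det_def orbit_sign_def det_similar[OF similar[OF that]] det_permutation_matrix[OF os(2) perm[OF that]] os(1) ..
  \<comment> \<open>Conjugate automorphisms permute the orbits by conjugate permutations, so their
    permutation matrices are similar; each endomorphism matrix is similar to its permutation matrix
    and inherits this.\<close>
  have conj: "similar_mat (endo_matrix D.Q (?\<rho> (h \<otimes>\<^bsub>shift_aut X\<^esub> f \<otimes>\<^bsub>shift_aut X\<^esub> inv\<^bsub>shift_aut X\<^esub> h)))
      (endo_matrix D.Q (?\<rho> f))"
    if f: "f \<in> carrier (shift_aut X)" and h: "h \<in> carrier (shift_aut X)" for f h
  proof -
    interpret A: group "shift_aut X"
      by (rule shift_aut_group[OF sub])
    define h' where "h' = inv\<^bsub>shift_aut X\<^esub> h"
    have h': "h' \<in> carrier (shift_aut X)"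
      unfolding h'_def using h by (rule A.inv_closed)
    \<comment> \<open>Products in \<open>shift_aut X\<close> are compositions restricted to X; on
      orbits the restriction is invisible, since they lie in X.\<close>
    have comp: "(a \<otimes>\<^bsub>shift_aut X\<^esub> b) ` orb = a ` b ` orb"
      if "a \<in> carrier (shift_aut X)" "b \<in> carrier (shift_aut X)" "orb \<in> set os" for a b orb
    proof -
      have "orb \<subseteq> X"
        using periodic_orbits_subset[OF sub] that(3) os(1) by simp
      then show ?thesis
        using that(1,2) by (auto simp: shift_aut_mult compose_def image_iff subset_iff)
    qed
    have mult: "?P (a \<otimes>\<^bsub>shift_aut X\<^esub> b) = ?P a * ?P b"
      if "a \<in> carrier (shift_aut X)" "b \<in> carrier (shift_aut X)" for a b
    proof -
      have "?P a * ?P b = permutation_matrix os (\<lambda>orb. a ` b ` orb)"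
        using perm[of b] that(2) by (intro permutation_matrix_mult[OF os(2)]) (auto simp: bij_betw_def)
      also have "\<dots> = ?P (a \<otimes>\<^bsub>shift_aut X\<^esub> b)"
        by (rule permutation_matrix_cong) (simp add: comp[OF that])
      finally show ?thesis ..
    qed
    have one: "?P \<one>\<^bsub>shift_aut X\<^esub> = 1\<^sub>m (length os)"
    proof (rule permutation_matrix_id[OF os(2)])
      fix orb assume "orb \<in> set os"
      then have "orb \<subseteq> X"
        using periodic_orbits_subset[OF sub] os(1) by simp
      then show "\<one>\<^bsub>shift_aut X\<^esub> ` orb = orb"
        by (auto simp: image_iff subset_iff)
    qed
    have "?P h * ?P h' = 1\<^sub>m (length os)" "?P h' * ?P h = 1\<^sub>m (length os)"
      using mult[OF h h'] mult[OF h' h] one A.r_inv[OF h] A.l_inv[OF h] by (simp_all add: h'_def)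
    moreover have "?P (h \<otimes>\<^bsub>shift_aut X\<^esub> f \<otimes>\<^bsub>shift_aut X\<^esub> h') = ?P h * ?P f * ?P h'"
      using mult[OF A.m_closed[OF h f] h'] mult[OF h f] by simp
    ultimately have "similar_mat_wit (?P (h \<otimes>\<^bsub>shift_aut X\<^esub> f \<otimes>\<^bsub>shift_aut X\<^esub> h')) (?P f) (?P h) (?P h')"
      unfolding similar_mat_wit_def Let_def carrier_matD(1)[OF permutation_matrix_carrier]
      by (simp add: permutation_matrix_carrier mult_carrier_mat[OF mult_carrier_mat[OF permutation_matrix_carrier permutation_matrix_carrier] permutation_matrix_carrier])
    then have "similar_mat (?P (h \<otimes>\<^bsub>shift_aut X\<^esub> f \<otimes>\<^bsub>shift_aut X\<^esub> h')) (?P f)"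
      unfolding similar_mat_def by blast
    moreover have "topological_conjugacy X X (h \<otimes>\<^bsub>shift_aut X\<^esub> f \<otimes>\<^bsub>shift_aut X\<^esub> h')" "topological_conjugacy X X f"
      using A.m_closed[OF A.m_closed[OF h f] h'] f by simp_all
    ultimately show ?thesis
      using similar similar_mat_trans similar_mat_sym unfolding h'_def by blast
  qed
  have main: "\<forall>f\<in>carrier (shift_aut X).
      matrix_wrt D.Q D.qs (?\<rho> f) = ?P f \<and> endo_det D.Q (?\<rho> f) = of_int (orbit_sign m X f) \<and>
      (\<forall>h\<in>carrier (shift_aut X).
         let f' = h \<otimes>\<^bsub>shift_aut X\<^esub> f \<otimes>\<^bsub>shift_aut X\<^esub> inv\<^bsub>shift_aut X\<^esub> h
         in endo_char_poly D.Q (?\<rho> f') = endo_char_poly D.Q (?\<rho> f) \<and>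
            endo_det D.Q (?\<rho> f') = endo_det D.Q (?\<rho> f) \<and>
            endo_trace D.Q (?\<rho> f') = endo_trace D.Q (?\<rho> f))"
  proof (intro ballI conjI)
    fix f assume f: "f \<in> carrier (shift_aut X)"
    then have fc: "topological_conjugacy X X f"
      by simp
    show "matrix_wrt D.Q D.qs (?\<rho> f) = ?P f"
      by (rule D.matrix_wrt_quotient_endo[OF act[OF fc]])
    show "endo_det D.Q (?\<rho> f) = of_int (orbit_sign m X f)"
      by (rule det[OF fc])
    fix h assume h: "h \<in> carrier (shift_aut X)"
    show "let f' = h \<otimes>\<^bsub>shift_aut X\<^esub> f \<otimes>\<^bsub>shift_aut X\<^esub> inv\<^bsub>shift_aut X\<^esub> h
         in endo_char_poly D.Q (?\<rho> f') = endo_char_poly D.Q (?\<rho> f) \<and>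
            endo_det D.Q (?\<rho> f') = endo_det D.Q (?\<rho> f) \<and>
            endo_trace D.Q (?\<rho> f') = endo_trace D.Q (?\<rho> f)"
      unfolding Let_def endo_char_poly_def endo_det_def endo_trace_def
      by (intro conjI char_poly_similar det_similar trace_similar conj[OF f h])
  qed
  show ?thesis
  proof (intro exI[of _ D.W] conjI ballI)
    show "VectorSpace.subspace class_ring D.W ?H"
      by (rule D.subspace_W)
    show "upsilon X x0 R f \<chi> \<in> D.W" if f: "f \<in> carrier (shift_aut X)" and \<chi>: "\<chi> \<in> D.W" for f \<chi>
    proof -
      have fc: "topological_conjugacy X X f"
        using f by simp
      show ?thesis
        by (rule D.invariant_W[OF act[OF fc] \<chi>])
    qed
    show "let V = D.Q; \<rho> = ?\<rho>
     in \<exists>bs os. ordered_basis V bs \<and> distinct os \<and> set os = periodic_orbits m X \<and>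
       (\<forall>f\<in>carrier (shift_aut X).
          matrix_wrt V bs (\<rho> f) = permutation_matrix os (\<lambda>orb. f ` orb) \<and>
          endo_det V (\<rho> f) = of_int (orbit_sign m X f) \<and>
          (\<forall>h\<in>carrier (shift_aut X).
             let f' = h \<otimes>\<^bsub>shift_aut X\<^esub> f \<otimes>\<^bsub>shift_aut X\<^esub> inv\<^bsub>shift_aut X\<^esub> h
             in endo_char_poly V (\<rho> f') = endo_char_poly V (\<rho> f) \<and>
                endo_det V (\<rho> f') = endo_det V (\<rho> f) \<and>
                endo_trace V (\<rho> f') = endo_trace V (\<rho> f)))"
      unfolding Let_def[of D.Q] Let_def[of ?\<rho>]
      by (intro exI[of _ D.qs] exI[of _ os] conjI D.ordered_basis_qs os main)
  qed
qed

end
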